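(* Let $\Sigma$ be a surface in the three dimensional Heisenberg group $\mathbb{H}_3$. If the mean curvature of $\Sigma$ is zero with respect to both metrics $g$ and $g_L$, then there is an isometry $\varphi$ of $\mathrm{Nil}^3=(\mathbb{H}_3,g)$ such that $\varphi(\Sigma)$ is a part of one of the following surfaces: the horizontal plane $z=0$; the vertical plane $y=0$; a helicoid $\tan(\lambda z)=\frac{y}{x}$ for some real $\lambda\neq 0$; the hyperbolic paraboloid $z=-\frac{xy}{2}$.
   Context: $\mathbb{H}_3$ is identified with $\mathbb{R}^3$ with coordinates $(x,y,z)$, and carries the left-invariant Riemannian metric $g=dx^2+dy^2+\left(dz+\frac12(y\,dx-x\,dy)\right)^2$ and the left-invariant Lorentzian metric $g_L=dx^2+dy^2-\left(dz+\frac12(y\,dx-x\,dy)\right)^2$. $\mathrm{Nil}^3$ denotes $\mathbb{R}^3$ with the metric $g$. A surface means a connected smooth immersed surface. A point $p\in\Sigma$ is spacelike, timelike or lightlike according as the restriction of $g_L$ to $T_p\Sigma$ is Riemannian, Lorentzian, or of rank $1$. The mean curvature with respect to $g_L$ is not defined at lightlike points, so the hypothesis that it is zero includes that $\Sigma$ has no lightlike points; it is then the usual mean curvature (half the trace, with respect to the induced metric, of the second fundamental form given by the Levi-Civita connection of $g_L$ and a unit normal). The helicoid $\tan(\lambda z)=\frac{y}{x}$ is understood as the full smooth surface $\{(x,y,z): x\sin(\lambda z)=y\cos(\lambda z)\}=\{(t\cos(\lambda z),t\sin(\lambda z),z): t,z\in\mathbb{R}\}$, which includes the $z$-axis. "A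 part of" a surface $S$ means that the surface in question is contained in $S$. *)

theory Defs
  imports "HOL-Analysis.Analysis"
begin

section \<open>Smooth maps\<close>

primrec times_differentiable_on ::
  "nat \<Rightarrow> 'a::real_normed_vector set \<Rightarrow> ('a \<Rightarrow> 'b::real_normed_vector) \<Rightarrow> bool" where
  "times_differentiable_on 0 U f \<longleftrightarrow> continuous_on U f"
| "times_differentiable_on (Suc n) U f \<longleftrightarrow>
     (\<forall>x\<in>U. f differentiable (at x)) \<and>
     (\<forall>v. times_differentiable_on n U (\<lambda>x. frechet_derivative f (at x) v))"

text \<open>Only meaningful for open \<open>U\<close>.\<close>

definition smooth_on ::
  "'a::real_normed_vector set \<Rightarrow> ('a \<Rightarrow> 'b::real_normed_vector) \<Rightarrow> bool" where
  "smooth_on U f \<longleftrightarrow> (\<forall>n. times_differentiable_on n U f)"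

definition partial :: "'n::finite \<Rightarrow> (real^'n \<Rightarrow> 'b::real_normed_vector) \<Rightarrow> real^'n \<Rightarrow> 'b" where
  "partial i f u = frechet_derivative f (at u) (axis i 1)"


section \<open>Surfaces and immersions\<close>

text \<open>
  A smooth surface is a space \<open>M\<close> with an atlas \<open>A\<close> of local parametrisations \<open>(U, X)\<close>,
  where \<open>X\<close> maps the open set \<open>U\<close> of the plane onto an open subset of \<open>M\<close>
  (so \<open>X\<close> is the inverse of a coordinate chart).
\<close>

type_synonym 'a atlas = "((real^2) set \<times> (real^2 \<Rightarrow> 'a)) set"

definition smooth_surface :: "'a topology \<Rightarrow> 'a atlas \<Rightarrow> bool" where
  "smooth_surface M A \<longleftrightarrow>
     Hausdorff_space M \<and> second_countable M \<and>
     (\<forall>(U, X)\<in>A. open U \<and> openin M (X ` U) \<and>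
        homeomorphic_map (top_of_set U) (subtopology M (X ` U)) X) \<and>
     (\<Union>(U, X)\<in>A. X ` U) = topspace M \<and>
     (\<forall>(U, X)\<in>A. \<forall>(V, Y)\<in>A. smooth_on {u \<in> U. X u \<in> Y ` V} (\<lambda>u. inv_into V Y (X u)))"

definition smooth_immersion :: "'a atlas \<Rightarrow> ('a \<Rightarrow> real^3) \<Rightarrow> bool" where
  "smooth_immersion A f \<longleftrightarrow>
     (\<forall>(U, X)\<in>A. smooth_on U (f \<circ> X) \<and>
        (\<forall>u\<in>U. inj (frechet_derivative (f \<circ> X) (at u))))"

definition connected_immersed_surface :: "'a topology \<Rightarrow> 'a atlas \<Rightarrow> ('a \<Rightarrow> real^3) \<Rightarrow> bool" where
  "connected_immersed_surface M A f \<longleftrightarrow>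
     connected_space M \<and> smooth_surface M A \<and> smooth_immersion A f"


section \<open>Metrics on three-space and mean curvature\<close>

text \<open>\<open>G p v w\<close> is the value of the metric \<open>G\<close> at the point \<open>p\<close> on tangent vectors \<open>v\<close>, \<open>w\<close>.\<close>

type_synonym metric3 = "real^3 \<Rightarrow> real^3 \<Rightarrow> real^3 \<Rightarrow> real"

definition gram :: "metric3 \<Rightarrow> real^3 \<Rightarrow> real^3^3" where
  "gram G p = (\<chi> i j. G p (axis i 1) (axis j 1))"

text \<open>\<open>christoffel G p k i j\<close> is the symbol with upper index \<open>k\<close> and lower indices \<open>i\<close>, \<open>j\<close>
  of the Levi-Civita connection of \<open>G\<close>.\<close>

definition christoffel :: "metric3 \<Rightarrow> real^3 \<Rightarrow> 3 \<Rightarrow> 3 \<Rightarrow> 3 \<Rightarrow> real" where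
  "christoffel G p k i j =
     (1/2) * (\<Sum>l\<in>UNIV. matrix_inv (gram G p) $ k $ l *
       (partial i (\<lambda>q. gram G q $ j $ l) p + partial j (\<lambda>q. gram G q $ i $ l) p
        - partial l (\<lambda>q. gram G q $ i $ j) p))"

text \<open>The Levi-Civita derivative of the vector field \<open>\<partial>\<^sub>j Y\<close> along \<open>\<partial>\<^sub>i Y\<close>.\<close>

definition covariant_partial ::
  "metric3 \<Rightarrow> (real^2 \<Rightarrow> real^3) \<Rightarrow> real^2 \<Rightarrow> 2 \<Rightarrow> 2 \<Rightarrow> real^3" where
  "covariant_partial G Y u i j = (\<chi> k. partial i (partial j Y) u $ k +
     (\<Sum>a\<in>UNIV. \<Sum>b\<in>UNIV. christoffel G (Y u) k a b * partial i Y u $ a * partial j Y u $ b))"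

definition first_form :: "metric3 \<Rightarrow> (real^2 \<Rightarrow> real^3) \<Rightarrow> real^2 \<Rightarrow> real^2^2" where
  "first_form G Y u = (\<chi> i j. G (Y u) (partial i Y u) (partial j Y u))"

definition second_form ::
  "metric3 \<Rightarrow> (real^2 \<Rightarrow> real^3) \<Rightarrow> real^2 \<Rightarrow> real^3 \<Rightarrow> real^2^2" where
  "second_form G Y u N = (\<chi> i j. G (Y u) (covariant_partial G Y u i j) N)"

definition unit_normal :: "metric3 \<Rightarrow> (real^2 \<Rightarrow> real^3) \<Rightarrow> real^2 \<Rightarrow> real^3 \<Rightarrow> bool" where
  "unit_normal G Y u N \<longleftrightarrow> (\<forall>i. G (Y u) N (partial i Y u) = 0) \<and> \<bar>G (Y u) N N\<bar> = 1"

definition mean_curvature ::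
  "metric3 \<Rightarrow> (real^2 \<Rightarrow> real^3) \<Rightarrow> real^2 \<Rightarrow> real^3 \<Rightarrow> real" where
  "mean_curvature G Y u N = trace (matrix_inv (first_form G Y u) ** second_form G Y u N) / 2"

definition lightlike_point :: "metric3 \<Rightarrow> (real^2 \<Rightarrow> real^3) \<Rightarrow> real^2 \<Rightarrow> bool" where
  "lightlike_point G Y u \<longleftrightarrow> rank (first_form G Y u) = 1"

text \<open>
  At a point that is not lightlike there are exactly two unit normals, \<open>N\<close> and \<open>- N\<close>, and
  replacing one by the other only changes the sign of the mean curvature. At lightlike points the
  mean curvature is undefined, so its vanishing includes their absence; for a Riemannian metric
  no point is lightlike.
\<close>

definition zero_mean_curvature :: "metric3 \<Rightarrow> 'a atlas \<Rightarrow> ('a \<Rightarrow> real^3) \<Rightarrow> bool" where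
  "zero_mean_curvature G A f \<longleftrightarrow>
     (\<forall>(U, X)\<in>A. \<forall>u\<in>U. \<not> lightlike_point G (f \<circ> X) u \<and>
        (\<forall>N. unit_normal G (f \<circ> X) u N \<longrightarrow> mean_curvature G (f \<circ> X) u N = 0))"


section \<open>The Heisenberg group\<close>

text \<open>The contact form \<open>dz + (y dx - x dy) / 2\<close> at \<open>p = (x, y, z)\<close>.\<close>

definition contact_form :: "real^3 \<Rightarrow> real^3 \<Rightarrow> real" where
  "contact_form p v = v$3 + (p$2 * v$1 - p$1 * v$2) / 2"

definition heis_riem :: metric3 where
  "heis_riem p v w = v$1 * w$1 + v$2 * w$2 + contact_form p v * contact_form p w"

definition heis_lor :: metric3 where
  "heis_lor p v w = v$1 * w$1 + v$2 * w$2 - contact_form p v * contact_form p w"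

definition riem_isometry :: "metric3 \<Rightarrow> (real^3 \<Rightarrow> real^3) \<Rightarrow> bool" where
  "riem_isometry G \<phi> \<longleftrightarrow>
     bij \<phi> \<and> smooth_on UNIV \<phi> \<and> smooth_on UNIV (inv \<phi>) \<and>
     (\<forall>p v w. G (\<phi> p) (frechet_derivative \<phi> (at p) v) (frechet_derivative \<phi> (at p) w) = G p v w)"

definition horizontal_plane :: "(real^3) set" where
  "horizontal_plane = {p. p$3 = 0}"

definition vertical_plane :: "(real^3) set" where
  "vertical_plane = {p. p$2 = 0}"

definition helicoid :: "real \<Rightarrow> (real^3) set" where
  "helicoid c = {p. p$1 * sin (c * p$3) = p$2 * cos (c * p$3)}"

definition hyperbolic_paraboloid :: "(real^3) set" where
  "hyperbolic_paraboloid = {p. p$3 = - (p$1 * p$2) / 2}"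

end

theory Submission
  imports Defs "HOL-Complex_Analysis.Conformal_Mappings"
begin

text \<open>The idea is to subtract the two mean curvature equations. Let \<open>\<omega>\<close> be the contact form, and call a
  vector horizontal if \<open>\<omega>\<close> vanishes on it. In a chart the equation of vanishing mean curvature, cleared of
  denominators, has the form \<open>P + e Q = 0\<close> with \<open>e = 1\<close> for the Riemannian and \<open>e = - 1\<close> for the Lorentzian
  metric; the terms that come from the curvature of the contact planes drop out of both \<open>P\<close> and \<open>Q\<close>. So the two conditions
  amount to \<open>P = 0\<close> and \<open>Q = 0\<close> (\<open>doubly_minimal_chartI\<close>), and each of these is elementary.

  The equation \<open>Q = 0\<close> says that the second derivative of the surface along its horizontal tangent direction is tangent.
  Hence that direction, projected to the \<open>(x, y)\<close>-plane, is constant along its own integral curves (\<open>slope_constant\<close>):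
  near every noncharacteristic point, where the tangent plane is not the contact plane, the surface is ruled by
  horizontal straight lines. After a motion the ruling is \<open>y = b + k x\<close>, \<open>z = m - b x / 2\<close>, where \<open>b\<close> and \<open>k\<close> are functions
  of \<open>m\<close> on the surface. The equation \<open>P = 0\<close> becomes a polynomial in \<open>x\<close> with coefficients depending on \<open>m\<close> alone, and
  its coefficients give two ordinary differential equations for \<open>b\<close> and \<open>k\<close> (\<open>ruling_equations\<close>). They can be
  solved explicitly. If \<open>k\<close> varies, all rulings meet a vertical axis and the surface is a helicoid or a plane of
  horizontal lines through one point; if \<open>k\<close> is constant, it is a hyperbolic paraboloid or a vertical plane
  (\<open>local_classification\<close>). All of this is carried out with functions on the given chart, so that no new
  parametrisation is needed.

  The passage from a piece to the whole connected surface is a unique continuation argument: every point has a neighbourhood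
  \<open>V\<close> such that an analytic set containing a nonempty open part of \<open>V\<close> contains \<open>V\<close> (\<open>local_continuation\<close>).
  Where the tangent plane does not contain the \<open>z\<close>-direction, the surface is a graph \<open>z = u(x, y)\<close>, and \<open>P = 0\<close> says that \<open>u\<close> is
  harmonic; this includes the characteristic points, at which the ruling breaks down. At a vertical point, the equation
  for \<open>b\<close> forces \<open>b\<close> to be constant and the surface is \<open>y = x tan (\<lambda> z)\<close> in suitable coordinates. In both cases the
  surface has an analytic description. The set of points near which the surface lies in a given model is therefore open and closed.\<close>

section \<open>Smooth functions on the plane\<close>

lemma times_differentiable_on_Suc_D:
  "times_differentiable_on (Suc n) U f \<Longrightarrow> times_differentiable_on n U f"
proof (induction n arbitrary: f)
  case 0
  then show ?case
    by (auto intro!: continuous_at_imp_continuous_on differentiable_imp_continuous_within)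
next
  case (Suc n)
  then show ?case by (metis times_differentiable_on.simps(2))
qed

lemma times_differentiable_on_cong:
  assumes "open U" "times_differentiable_on n U f" "\<And>x. x \<in> U \<Longrightarrow> f x = g x"
  shows "times_differentiable_on n U g"
  using assms(2,3)
proof (induction n arbitrary: f g)
  case 0
  then show ?case by (simp cong: continuous_on_cong)
next
  case (Suc n)
  have D: "(g has_derivative frechet_derivative f (at x)) (at x)" if "x \<in> U" for x
    using Suc.prems that assms(1)
    by (metis frechet_derivative_works has_derivative_transform_within_open times_differentiable_on.simps(2))
  have "frechet_derivative g (at x) = frechet_derivative f (at x)" if "x \<in> U" for x
    using frechet_derivative_at[OF D[OF that]] by simp
  then have "times_differentiable_on n U (\<lambda>x. frechet_derivative g (at x) v)" for v
    using Suc.IH[of "\<lambda>x. frechet_derivative f (at x) v" "\<lambda>x. frechet_derivative g (at x) v"] Suc.prems by auto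
  then show ?case
    using D by (auto simp: differentiable_def)
qed

lemma times_differentiable_on_const: "times_differentiable_on n U (\<lambda>x. c)"
  by (induction n arbitrary: c) auto

lemma times_differentiable_on_bounded_linear:
  assumes "open U" "bounded_linear L" "times_differentiable_on n U f"
  shows "times_differentiable_on n U (\<lambda>x. L (f x))"
  using assms(3)
proof (induction n arbitrary: f)
  case 0
  then show ?case
    using assms(2) by (auto intro: bounded_linear.continuous_on)
next
  case (Suc n)
  have D: "((\<lambda>x. L (f x)) has_derivative (\<lambda>v. L (frechet_derivative f (at x) v))) (at x)" if "x \<in> U" for x
    using Suc.prems that by (auto intro!: bounded_linear.has_derivative[OF assms(2)] simp: frechet_derivative_works[symmetric])
  have E: "frechet_derivative (\<lambda>x. L (f x)) (at x) = (\<lambda>v. L (frechet_derivative f (at x) v))" if "x \<in> U" for x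
    using frechet_derivative_at[OF D[OF that]] by simp
  have "times_differentiable_on n U (\<lambda>x. frechet_derivative (\<lambda>x. L (f x)) (at x) v)" for v
    by (rule times_differentiable_on_cong[OF assms(1) Suc.IH]) (use Suc.prems E in auto)
  then show ?case
    using D by (auto simp: differentiable_def)
qed

lemma times_differentiable_on_add:
  assumes "open U" "times_differentiable_on n U f" "times_differentiable_on n U g"
  shows "times_differentiable_on n U (\<lambda>x. f x + g x)"
  using assms(2,3)
proof (induction n arbitrary: f g)
  case 0
  then show ?case by (simp add: continuous_on_add)
next
  case (Suc n)
  have D: "((\<lambda>x. f x + g x) has_derivative (\<lambda>v. frechet_derivative f (at x) v + frechet_derivative g (at x) v)) (at x)"
    if "x \<in> U" for x
    using Suc.prems that by (auto intro!: has_derivative_add simp: frechet_derivative_works[symmetric])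
  have E: "frechet_derivative (\<lambda>x. f x + g x) (at x)
      = (\<lambda>v. frechet_derivative f (at x) v + frechet_derivative g (at x) v)" if "x \<in> U" for x
    using frechet_derivative_at[OF D[OF that]] by simp
  have "times_differentiable_on n U (\<lambda>x. frechet_derivative (\<lambda>x. f x + g x) (at x) v)" for v
    by (rule times_differentiable_on_cong[OF assms(1) Suc.IH]) (use Suc.prems E in auto)
  then show ?case
    using D by (auto simp: differentiable_def)
qed

lemma times_differentiable_on_mult:
  fixes f g :: "'a::real_normed_vector \<Rightarrow> real"
  assumes "open U" "times_differentiable_on n U f" "times_differentiable_on n U g"
  shows "times_differentiable_on n U (\<lambda>x. f x * g x)"
  using assms(2,3)
proof (induction n arbitrary: f g)
  case 0
  then show ?case by (simp add: continuous_on_mult)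
next
  case (Suc n)
  have D: "((\<lambda>x. f x * g x) has_derivative
      (\<lambda>v. f x * frechet_derivative g (at x) v + frechet_derivative f (at x) v * g x)) (at x)"
    if "x \<in> U" for x
    using Suc.prems that by (auto intro!: has_derivative_mult simp: frechet_derivative_works[symmetric])
  have E: "frechet_derivative (\<lambda>x. f x * g x) (at x)
      = (\<lambda>v. f x * frechet_derivative g (at x) v + frechet_derivative f (at x) v * g x)" if "x \<in> U" for x
    using frechet_derivative_at[OF D[OF that]] by simp
  have "times_differentiable_on n U (\<lambda>x. f x * frechet_derivative g (at x) v + frechet_derivative f (at x) v * g x)" for v
    using Suc.prems times_differentiable_on_Suc_D[OF Suc.prems(1)] times_differentiable_on_Suc_D[OF Suc.prems(2)]
    by (intro times_differentiable_on_add[OF assms(1)] Suc.IH) auto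
  then have "times_differentiable_on n U (\<lambda>x. frechet_derivative (\<lambda>x. f x * g x) (at x) v)" for v
    by (rule times_differentiable_on_cong[OF assms(1)]) (use E in auto)
  then show ?case
    using D by (auto simp: differentiable_def)
qed

lemma times_differentiable_on_inverse:
  fixes f :: "'a::real_normed_vector \<Rightarrow> real"
  assumes "open U" "times_differentiable_on n U f" "\<And>x. x \<in> U \<Longrightarrow> f x \<noteq> 0"
  shows "times_differentiable_on n U (\<lambda>x. inverse (f x))"
  using assms(2)
proof (induction n)
  case 0
  then show ?case using assms(3) by (simp add: continuous_on_inverse)
next
  case (Suc n)
  have D: "((\<lambda>x. inverse (f x)) has_derivative
      (\<lambda>v. - (inverse (f x) * frechet_derivative f (at x) v * inverse (f x)))) (at x)"
    if "x \<in> U" for x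
    using Suc.prems that assms(3) by (auto intro!: has_derivative_inverse simp: frechet_derivative_works[symmetric])
  have E: "frechet_derivative (\<lambda>x. inverse (f x)) (at x)
      = (\<lambda>v. - (inverse (f x) * frechet_derivative f (at x) v * inverse (f x)))" if "x \<in> U" for x
    using frechet_derivative_at[OF D[OF that]] by simp
  have "times_differentiable_on n U (\<lambda>x. (-1) * (inverse (f x) * frechet_derivative f (at x) v * inverse (f x)))" for v
    using Suc.prems Suc.IH[OF times_differentiable_on_Suc_D[OF Suc.prems]]
    by (intro times_differentiable_on_mult[OF assms(1)] times_differentiable_on_const) auto
  then have "times_differentiable_on n U (\<lambda>x. frechet_derivative (\<lambda>x. inverse (f x)) (at x) v)" for v
    by (rule times_differentiable_on_cong[OF assms(1)]) (use E in auto)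
  then show ?case
    using D by (auto simp: differentiable_def)
qed

lemma smooth_on_subset:
  assumes "smooth_on U f" "V \<subseteq> U"
  shows "smooth_on V f"
proof -
  have "times_differentiable_on n U f \<Longrightarrow> times_differentiable_on n V f" for n
    using assms(2) by (induction n arbitrary: f) (auto intro: continuous_on_subset)
  then show ?thesis using assms(1) unfolding smooth_on_def by blast
qed

lemma smooth_on_const: "smooth_on U (\<lambda>x. c)"
  by (simp add: smooth_on_def times_differentiable_on_const)

lemma smooth_on_bounded_linear:
  assumes "open U" "bounded_linear L" "smooth_on U f"
  shows "smooth_on U (\<lambda>x. L (f x))"
  unfolding smooth_on_def
proof
  fix n
  have "times_differentiable_on n U f" using assms(3) by (simp add: smooth_on_def)
  then show "times_differentiable_on n U (\<lambda>x. L (f x))"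
    by (rule times_differentiable_on_bounded_linear[OF assms(1,2)])
qed

lemma smooth_on_add:
  assumes "open U" "smooth_on U f" "smooth_on U g"
  shows "smooth_on U (\<lambda>x. f x + g x)"
  unfolding smooth_on_def
proof
  fix n
  have "times_differentiable_on n U f" "times_differentiable_on n U g"
    using assms(2,3) by (simp_all add: smooth_on_def)
  then show "times_differentiable_on n U (\<lambda>x. f x + g x)"
    by (rule times_differentiable_on_add[OF assms(1)])
qed

lemma smooth_on_mult:
  fixes f g :: "'a::real_normed_vector \<Rightarrow> real"
  assumes "open U" "smooth_on U f" "smooth_on U g"
  shows "smooth_on U (\<lambda>x. f x * g x)"
  unfolding smooth_on_def
proof
  fix n
  have "times_differentiable_on n U f" "times_differentiable_on n U g"
    using assms(2,3) by (simp_all add: smooth_on_def)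
  then show "times_differentiable_on n U (\<lambda>x. f x * g x)"
    by (rule times_differentiable_on_mult[OF assms(1)])
qed

lemma smooth_on_minus:
  assumes "open U" "smooth_on U f"
  shows "smooth_on U (\<lambda>x. - f x)"
  by (rule smooth_on_bounded_linear[OF assms(1) bounded_linear_minus[OF bounded_linear_ident] assms(2)])

lemma smooth_on_diff:
  assumes "open U" "smooth_on U f" "smooth_on U g"
  shows "smooth_on U (\<lambda>x. f x - g x)"
  using smooth_on_add[OF assms(1,2) smooth_on_minus[OF assms(1,3)]] by simp

lemma smooth_on_divide:
  fixes f g :: "'a::real_normed_vector \<Rightarrow> real"
  assumes "open U" "smooth_on U f" "smooth_on U g" "\<And>x. x \<in> U \<Longrightarrow> g x \<noteq> 0"
  shows "smooth_on U (\<lambda>x. f x / g x)"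
proof -
  have "smooth_on U (\<lambda>x. inverse (g x))"
    using assms by (simp add: smooth_on_def times_differentiable_on_inverse)
  then show ?thesis
    using smooth_on_mult[OF assms(1,2)] by (simp add: divide_inverse)
qed

lemmas smooth_intros = smooth_on_const smooth_on_add smooth_on_diff smooth_on_minus
  smooth_on_mult smooth_on_divide

lemma smooth_on_differentiable: "smooth_on U f \<Longrightarrow> u \<in> U \<Longrightarrow> f differentiable (at u)"
  unfolding smooth_on_def by (metis times_differentiable_on.simps(2))

lemma smooth_on_continuous_on: "smooth_on U f \<Longrightarrow> continuous_on U f"
  unfolding smooth_on_def by (metis times_differentiable_on.simps(1))

lemma smooth_on_partial: "smooth_on U f \<Longrightarrow> smooth_on U (partial i f)"
  unfolding smooth_on_def partial_def[abs_def] by (metis times_differentiable_on.simps(2))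

lemma partial_unique:
  "(f has_derivative f') (at u) \<Longrightarrow> partial i f u = f' (axis i 1)"
  unfolding partial_def by (metis frechet_derivative_at)

lemma partial_const [simp]: "partial i (\<lambda>u. c) u = 0"
  by (simp add: partial_def)

lemma partial_bounded_linear:
  assumes "bounded_linear L" "f differentiable (at u)"
  shows "partial i (\<lambda>u. L (f u)) u = L (partial i f u)"
  using partial_unique[OF bounded_linear.has_derivative[OF assms(1)]] assms(2)
  unfolding frechet_derivative_works partial_def by blast

lemma partial_component:
  fixes f :: "real^'n::finite \<Rightarrow> real^'m::finite"
  assumes "f differentiable (at u)"
  shows "partial i f u $ k = partial i (\<lambda>u. f u $ k) u"
  using partial_bounded_linear[OF bounded_linear_vec_nth assms] by simp

lemma partial_add:
  assumes "f differentiable (at u)" "g differentiable (at u)"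
  shows "partial i (\<lambda>u. f u + g u) u = partial i f u + partial i g u"
  using partial_unique[OF has_derivative_add] assms
  unfolding frechet_derivative_works partial_def by blast

lemma partial_diff:
  assumes "f differentiable (at u)" "g differentiable (at u)"
  shows "partial i (\<lambda>u. f u - g u) u = partial i f u - partial i g u"
  using partial_unique[OF has_derivative_diff] assms
  unfolding frechet_derivative_works partial_def by blast

lemma partial_mult:
  fixes f g :: "real^'n::finite \<Rightarrow> real"
  assumes "f differentiable (at u)" "g differentiable (at u)"
  shows "partial i (\<lambda>u. f u * g u) u = f u * partial i g u + partial i f u * g u"
  using partial_unique[OF has_derivative_mult] assms
  unfolding frechet_derivative_works partial_def by blast

text \<open>The chain rule with a real outer function; it covers inverses and the arctangent.\<close>

lemma partial_compose_real:
  fixes f :: "real^'n::finite \<Rightarrow> real"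
  assumes "f differentiable (at u)" "(\<phi> has_real_derivative d) (at (f u))"
  shows "partial i (\<lambda>u. \<phi> (f u)) u = d * partial i f u"
proof -
  have "((\<lambda>u. \<phi> (f u)) has_derivative (\<lambda>v. d * frechet_derivative f (at u) v)) (at u)"
    using has_derivative_compose[of f "frechet_derivative f (at u)" u UNIV \<phi> "(*) d"] assms
    by (simp add: frechet_derivative_works[symmetric] has_field_derivative_def)
  then show ?thesis
    using partial_unique unfolding partial_def by metis
qed

lemma partial_divide:
  fixes f g :: "real^'n::finite \<Rightarrow> real"
  assumes "f differentiable (at u)" "g differentiable (at u)" "g u \<noteq> 0"
  shows "partial i (\<lambda>u. f u / g u) u = (partial i f u * g u - f u * partial i g u) / (g u)\<^sup>2"
proof -
  have D: "(inverse has_real_derivative - (inverse (g u))\<^sup>2) (at (g u))"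
    using DERIV_inverse[OF assms(3)] by (simp add: numeral_2_eq_2)
  have dinv: "(\<lambda>u. inverse (g u)) differentiable (at u)"
    using assms by simp
  have "partial i (\<lambda>u. f u * inverse (g u)) u =
      f u * (- (inverse (g u))\<^sup>2 * partial i g u) + partial i f u * inverse (g u)"
    using partial_mult[OF assms(1) dinv] partial_compose_real[OF assms(2) D] by simp
  also have "\<dots> = (partial i f u * g u - f u * partial i g u) / (g u)\<^sup>2"
    using assms(3) by (simp add: field_simps power2_eq_square)
  finally show ?thesis
    by (simp only: divide_inverse)
qed

lemma partial_cong:
  assumes "open U" "u \<in> U" "\<And>v. v \<in> U \<Longrightarrow> f v = g v"
  shows "partial i f u = partial i g u"
proof -
  have "(f has_derivative D) (at u) \<longleftrightarrow> (g has_derivative D) (at u)" for D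
    using has_derivative_transform_within_open[OF _ assms(1,2)] assms(3) by metis
  then show ?thesis
    by (simp add: partial_def frechet_derivative_def)
qed

lemmas partial_rules = partial_add partial_diff partial_mult partial_const

text \<open>In the plane the derivative is determined by the two partial derivatives, and everything below is phrased in them.\<close>

lemma has_derivative_partials:
  fixes g :: "real^2 \<Rightarrow> real"
  assumes "g differentiable (at u)"
  shows "(g has_derivative (\<lambda>v. v$1 * partial 1 g u + v$2 * partial 2 g u)) (at u)"
proof -
  let ?D = "frechet_derivative g (at u)"
  have lin: "linear ?D"
    using assms by (rule linear_frechet_derivative)
  have "?D v = v$1 * partial 1 g u + v$2 * partial 2 g u" for v
  proof -
    have "v = v$1 *\<^sub>R axis 1 1 + v$2 *\<^sub>R axis 2 1"
      by (simp add: vec_eq_iff forall_2 axis_def)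
    then have "?D v = ?D (v$1 *\<^sub>R axis 1 1 + v$2 *\<^sub>R axis 2 1)" by simp
    also have "\<dots> = v$1 * partial 1 g u + v$2 * partial 2 g u"
      using lin by (simp add: linear_add linear_scale partial_def)
    finally show ?thesis .
  qed
  then have "?D = (\<lambda>v. v$1 * partial 1 g u + v$2 * partial 2 g u)" by auto
  then show ?thesis
    using assms by (metis frechet_derivative_works)
qed

lemma constant_if_partials_zero:
  fixes g :: "real^2 \<Rightarrow> real"
  assumes "convex B" "\<And>u. u \<in> B \<Longrightarrow> g differentiable (at u)"
    and "\<And>u. u \<in> B \<Longrightarrow> partial 1 g u = 0" "\<And>u. u \<in> B \<Longrightarrow> partial 2 g u = 0"
    and "a \<in> B" "b \<in> B"
  shows "g a = g b"
proof -
  have "(g has_derivative (\<lambda>v. 0)) (at u within B)" if "u \<in> B" for u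
    using has_derivative_partials[OF assms(2)[OF that]] assms(3,4) that
    by (auto intro: has_derivative_at_withinI)
  then obtain c where "\<And>x. x \<in> B \<Longrightarrow> g x = c"
    using has_derivative_zero_constant[OF assms(1)] by metis
  then show ?thesis using assms by auto
qed

text \<open>If the mixed partial derivatives differed at \<open>p\<close>, they would be separated by a constant on a
  small square, but both of them compute the same second difference of \<open>g\<close> over that square.\<close>

lemma partial_mixed_le:
  fixes g :: "real^2 \<Rightarrow> real"
  assumes "open U" "smooth_on U g" "p \<in> U" "{i, j} = {1, 2::2}"
  shows "partial i (partial j g) p \<le> partial j (partial i g) p"
proof (rule ccontr)
  assume "\<not> ?thesis"
  then obtain c where c: "partial j (partial i g) p < c" "c < partial i (partial j g) p"
    using dense by (metis not_le_imp_less)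
  have ij: "i \<noteq> j" using assms(4) by (auto simp: doubleton_eq_iff)
  have sm: "smooth_on U (partial j (partial i g))" "smooth_on U (partial i (partial j g))"
    "smooth_on U (partial i g)" "smooth_on U (partial j g)"
    using assms(2) by (auto intro: smooth_on_partial)
  have "\<forall>\<^sub>F q in at p. partial j (partial i g) q < c"
    "\<forall>\<^sub>F q in at p. c < partial i (partial j g) q"
    using c sm(1,2)[THEN smooth_on_continuous_on] assms(1,3)
    by (auto simp: continuous_on_eq_continuous_at isCont_def dest: order_tendstoD)
  then have "\<forall>\<^sub>F q in at p. partial j (partial i g) q < c \<and> c < partial i (partial j g) q \<and> q \<in> U"
    using eventually_at_in_open'[OF assms(1,3)] by (simp add: eventually_conj_iff)
  then obtain r where r: "r > 0"
    and r': "\<And>q. q \<noteq> p \<Longrightarrow> dist q p < r \<Longrightarrow>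
      partial j (partial i g) q < c \<and> c < partial i (partial j g) q \<and> q \<in> U"
    unfolding eventually_at by auto
  have near: "partial j (partial i g) q < c \<and> c < partial i (partial j g) q \<and> q \<in> U" if "dist q p < r" for q
    using r'[of q] that c assms(3) by (cases "q = p") auto
  define h where "h = r / 4"
  have h: "h > 0" using r by (simp add: h_def)
  define P where "P s t = p + s *\<^sub>R axis i 1 + t *\<^sub>R axis j (1::real)" for s t
  have P: "dist (P s t) p < r" if "0 \<le> s" "s \<le> h" "0 \<le> t" "t \<le> h" for s t
  proof -
    have "norm (s *\<^sub>R axis i 1 + t *\<^sub>R axis j (1::real)) \<le> \<bar>s\<bar> * 1 + \<bar>t\<bar> * 1"
      by (rule norm_triangle_le) (simp add: norm_axis_1)
    then show ?thesis
      using that r by (simp add: P_def dist_norm h_def add.assoc)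
  qed
  have dP1: "((\<lambda>s. f (P s t)) has_real_derivative partial i f (P s t)) (at s)"
    if "smooth_on U f" "P s t \<in> U" for f s t
  proof -
    have fd: "(f has_derivative frechet_derivative f (at (P s t))) (at (P s t))"
      using smooth_on_differentiable[OF that] by (simp add: frechet_derivative_works)
    have "((\<lambda>s. P s t) has_derivative (\<lambda>d. d *\<^sub>R axis i 1)) (at s)"
      unfolding P_def by (auto intro!: derivative_eq_intros)
    from has_derivative_compose[OF this fd]
    have "((\<lambda>s. f (P s t)) has_derivative (\<lambda>d. frechet_derivative f (at (P s t)) (d *\<^sub>R axis i 1))) (at s)" .
    then show ?thesis
      using linear_frechet_derivative[OF smooth_on_differentiable[OF that]]
      by (simp add: has_field_derivative_def linear_scale partial_def mult_commute_abs)
  qed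
  have dP2: "((\<lambda>t. f (P s t)) has_real_derivative partial j f (P s t)) (at t)"
    if "smooth_on U f" "P s t \<in> U" for f s t
  proof -
    have fd: "(f has_derivative frechet_derivative f (at (P s t))) (at (P s t))"
      using smooth_on_differentiable[OF that] by (simp add: frechet_derivative_works)
    have "((\<lambda>t. P s t) has_derivative (\<lambda>d. d *\<^sub>R axis j 1)) (at t)"
      unfolding P_def by (auto intro!: derivative_eq_intros)
    from has_derivative_compose[OF this fd]
    have "((\<lambda>t. f (P s t)) has_derivative (\<lambda>d. frechet_derivative f (at (P s t)) (d *\<^sub>R axis j 1))) (at t)" .
    then show ?thesis
      using linear_frechet_derivative[OF smooth_on_differentiable[OF that]]
      by (simp add: has_field_derivative_def linear_scale partial_def mult_commute_abs)
  qed
  define \<Delta> where "\<Delta> = g (P h h) - g (P h 0) - g (P 0 h) + g (P 0 0)"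
  have inU: "P s t \<in> U" if "0 \<le> s" "s \<le> h" "0 \<le> t" "t \<le> h" for s t
    using P[OF that] near by blast
  have "\<exists>s>0. s < h \<and> (g (P h h) - g (P h 0)) - (g (P 0 h) - g (P 0 0)) =
      (h - 0) * (partial i g (P s h) - partial i g (P s 0))"
    using h inU by (intro MVT2[of 0 h "\<lambda>s. g (P s h) - g (P s 0)"] DERIV_diff dP1 assms) auto
  then obtain s where s: "s > 0" "s < h" "\<Delta> = h * (partial i g (P s h) - partial i g (P s 0))"
    by (auto simp: \<Delta>_def)
  have "\<exists>t>0. t < h \<and> partial i g (P s h) - partial i g (P s 0) = (h - 0) * partial j (partial i g) (P s t)"
    using h inU s by (intro MVT2[of 0 h "\<lambda>t. partial i g (P s t)"] dP2 sm) auto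
  then obtain t where "t > 0" "t < h" "\<Delta> = h * (h * partial j (partial i g) (P s t))"
    using s(3) by auto
  then have "\<Delta> < h * (h * c)"
    using near[OF P[of s t]] s h by simp
  moreover have "\<exists>s>0. s < h \<and> (g (P h h) - g (P 0 h)) - (g (P h 0) - g (P 0 0)) =
      (h - 0) * (partial j g (P h s) - partial j g (P 0 s))"
    using h inU by (intro MVT2[of 0 h "\<lambda>s. g (P h s) - g (P 0 s)"] DERIV_diff dP2 assms) auto
  then obtain s' where s': "s' > 0" "s' < h" "\<Delta> = h * (partial j g (P h s') - partial j g (P 0 s'))"
    by (auto simp: \<Delta>_def)
  have "\<exists>t>0. t < h \<and> partial j g (P h s') - partial j g (P 0 s') = (h - 0) * partial i (partial j g) (P t s')"
    using h inU s' by (intro MVT2[of 0 h "\<lambda>t. partial j g (P t s')"] dP1 sm) auto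
  then obtain t' where "t' > 0" "t' < h" "\<Delta> = h * (h * partial i (partial j g) (P t' s'))"
    using s'(3) by auto
  then have "\<Delta> > h * (h * c)"
    using near[OF P[of t' s']] s' h by simp
  ultimately show False by simp
qed

lemma partial_commute:
  fixes g :: "real^2 \<Rightarrow> real"
  assumes "open U" "smooth_on U g" "u \<in> U"
  shows "partial 2 (partial 1 g) u = partial 1 (partial 2 g) u"
  using partial_mixed_le[OF assms, of 1 2] partial_mixed_le[OF assms, of 2 1] by auto

section \<open>Mean curvature in the Heisenberg group\<close>

lemma matrix_inv_eqI:
  fixes P Q :: "real^'n^'n"
  assumes "P ** Q = mat 1" "Q ** P = mat 1"
  shows "matrix_inv P = Q"
  unfolding matrix_inv_def
proof (rule some_equality)
  show "P ** Q = mat 1 \<and> Q ** P = mat 1" using assms by simp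
next
  fix R assume R: "P ** R = mat 1 \<and> R ** P = mat 1"
  then show "R = Q"
    by (metis assms(1) matrix_mul_assoc matrix_mul_lid matrix_mul_rid)
qed

text \<open>The metric with parameter \<open>e\<close> is \<open>heis_riem\<close> for \<open>e = 1\<close> and \<open>heis_lor\<close> for \<open>e = - 1\<close>; one computation serves both.\<close>

definition heis_metric :: "real \<Rightarrow> metric3" where
  "heis_metric e p v w = v$1 * w$1 + v$2 * w$2 + e * contact_form p v * contact_form p w"

lemma heis_riem_eq: "heis_riem = heis_metric 1"
  by (auto simp: fun_eq_iff heis_riem_def heis_metric_def)

lemma heis_lor_eq: "heis_lor = heis_metric (-1)"
  by (auto simp: fun_eq_iff heis_lor_def heis_metric_def)

text \<open>Half of the exterior derivative \<open>- dx dy\<close> of the contact form. Since the coefficients of the contact form are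
  affine functions of the point, this is also the derivative of \<open>contact_form q w\<close> in \<open>q\<close> along \<open>v\<close>.\<close>

definition contact_curvature :: "real^3 \<Rightarrow> real^3 \<Rightarrow> real" where
  "contact_curvature v w = (v$2 * w$1 - v$1 * w$2) / 2"

lemma partial_gram_heis:
  "partial i (\<lambda>q. gram (heis_metric e) q $ j $ l) p =
    e * (contact_curvature (axis i 1) (axis j 1) * contact_form p (axis l 1) +
         contact_form p (axis j 1) * contact_curvature (axis i 1) (axis l 1))"
proof -
  have d: "((\<lambda>q. contact_form q w) has_derivative (\<lambda>v. contact_curvature v w)) (at p)" for w
    unfolding contact_form_def contact_curvature_def
    by (auto intro!: derivative_eq_intros bounded_linear.has_derivative[OF bounded_linear_vec_nth]
        simp: field_simps)
  have "((\<lambda>q. gram (heis_metric e) q $ j $ l) has_derivative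
      (\<lambda>v. e * (contact_curvature v (axis j 1) * contact_form p (axis l 1) +
         contact_form p (axis j 1) * contact_curvature v (axis l 1)))) (at p)"
    unfolding gram_def heis_metric_def
    by (auto intro!: derivative_eq_intros d simp: algebra_simps)
  then show ?thesis by (rule partial_unique)
qed

lemma gram_heis_inverse:
  assumes "e = 1 \<or> e = -1"
  shows "gram (heis_metric e) p ** matrix_inv (gram (heis_metric e) p) = mat 1"
proof -
  define Q :: "real^3^3" where
    "Q = vector [vector [1, 0, - (p$2) / 2], vector [0, 1, p$1 / 2],
                 vector [- (p$2) / 2, p$1 / 2, e + ((p$1)\<^sup>2 + (p$2)\<^sup>2) / 4]]"
  have "gram (heis_metric e) p ** Q = mat 1"
    using assms
    by (elim disjE; simp add: vec_eq_iff forall_3 matrix_matrix_mult_def sum_3 Q_def gram_def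
        heis_metric_def contact_form_def axis_def mat_def field_simps power2_eq_square)
  moreover have "Q ** gram (heis_metric e) p = mat 1"
    using calculation matrix_left_right_inverse by blast
  ultimately show ?thesis by (metis matrix_inv_eqI)
qed

lemma heis_metric_gram:
  "heis_metric e p v w = (gram (heis_metric e) p *v v) \<bullet> w"
  by (simp add: inner_vec_def matrix_vector_mult_def sum_3 gram_def heis_metric_def
      contact_form_def axis_def field_simps)

lemma heis_metric_add:
  "heis_metric e p (v + v') w = heis_metric e p v w + heis_metric e p v' w"
  by (simp add: heis_metric_def contact_form_def field_simps)

text \<open>In the Christoffel symbols with lowered index the derivatives of the contact form enter through a skew form: the terms in
  which it is evaluated on the two differentiation directions cancel, and the others add up in pairs.\<close>

lemma lowered_christoffel_algebra:
  fixes e :: real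
  assumes "bba = - bab" "bla = - bal" "blb = - bbl"
  shows "(1/2) * (e * (bab * wl + wb * bal) + e * (bba * wl + wa * bbl) - e * (bla * wb + wa * blb))
    = e * (wb * bal + wa * bbl)"
  unfolding assms by (simp add: algebra_simps)

text \<open>Only the pairing of the acceleration with a normal vector is needed, and in this pairing the Gram matrix cancels the
  inverse Gram matrix in the Christoffel symbols.\<close>

lemma heis_covariant_partial:
  assumes "e = 1 \<or> e = -1"
  shows "heis_metric e (Y u) (covariant_partial (heis_metric e) Y u i j) N =
    heis_metric e (Y u) (partial i (partial j Y) u) N +
    e * (contact_form (Y u) (partial i Y u) * contact_curvature (partial j Y u) N +
         contact_form (Y u) (partial j Y u) * contact_curvature (partial i Y u) N)"
proof -
  define G where "G = gram (heis_metric e)"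
  define p where "p = Y u"
  define v where "v = partial i Y u"
  define w where "w = partial j Y u"
  \<comment> \<open>the Christoffel symbols with lowered upper index\<close>
  define L :: "3 \<Rightarrow> 3 \<Rightarrow> 3 \<Rightarrow> real" where
    "L = (\<lambda>l a b. (1/2) * (partial a (\<lambda>q. G q $ b $ l) p + partial b (\<lambda>q. G q $ a $ l) p
        - partial l (\<lambda>q. G q $ a $ b) p))"
  define Lv :: "real^3" where "Lv = (\<chi> l. \<Sum>a\<in>UNIV. \<Sum>b\<in>UNIV. L l a b * v $ a * w $ b)"
  have chr: "christoffel (heis_metric e) p k a b = (\<Sum>l\<in>UNIV. matrix_inv (G p) $ k $ l * L l a b)" for k a b
    by (simp add: christoffel_def L_def G_def sum_distrib_left)
  have "(\<Sum>a\<in>UNIV. \<Sum>b\<in>UNIV. christoffel (heis_metric e) p k a b * v $ a * w $ b)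
      = (matrix_inv (G p) *v Lv) $ k" for k
    unfolding chr Lv_def matrix_vector_mult_def sum_3 by (simp add: algebra_simps)
  then have "covariant_partial (heis_metric e) Y u i j =
      partial i (partial j Y) u + matrix_inv (G p) *v Lv"
    by (simp add: covariant_partial_def vec_eq_iff p_def v_def w_def)
  moreover have "heis_metric e p (matrix_inv (G p) *v Lv) N = Lv \<bullet> N"
    by (subst heis_metric_gram)
      (simp only: G_def matrix_vector_mul_assoc gram_heis_inverse[OF assms] matrix_vector_mul_lid)
  moreover have "Lv \<bullet> N = e * (contact_form p v * contact_curvature w N +
         contact_form p w * contact_curvature v N)"
  proof -
    define \<omega> where "\<omega> a = contact_form p (axis a 1)" for a
    define B where "B a b = contact_curvature (axis a 1) (axis b (1::real))" for a b
    have "B b a = - B a b" for a b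
      by (simp add: B_def contact_curvature_def field_simps)
    note antisym = this
    have L: "L l a b = e * (\<omega> b * B a l + \<omega> a * B b l)" for l a b
      unfolding L_def G_def partial_gram_heis \<omega>_def[symmetric] B_def[symmetric]
      by (intro lowered_christoffel_algebra antisym)
    have \<omega>: "\<omega> 1 = p$2 / 2" "\<omega> 2 = - (p$1) / 2" "\<omega> 3 = 1"
      by (simp_all add: \<omega>_def contact_form_def axis_def)
    have B: "B 1 1 = 0" "B 1 2 = - 1/2" "B 1 3 = 0" "B 2 1 = 1/2" "B 2 2 = 0" "B 2 3 = 0"
      "B 3 1 = 0" "B 3 2 = 0" "B 3 3 = 0"
      by (simp_all add: B_def contact_curvature_def axis_def)
    show ?thesis
      unfolding inner_vec_def Lv_def L sum_3
      by (simp add: \<omega> B contact_form_def contact_curvature_def field_simps)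
  qed
  ultimately show ?thesis
    by (simp add: heis_metric_add p_def v_def w_def)
qed

definition det3 :: "real^3 \<Rightarrow> real^3 \<Rightarrow> real^3 \<Rightarrow> real" where
  "det3 a b c = a$1 * (b$2 * c$3 - b$3 * c$2) - a$2 * (b$1 * c$3 - b$3 * c$1)
     + a$3 * (b$1 * c$2 - b$2 * c$1)"

text \<open>In the left-invariant frame dual to \<open>dx\<close>, \<open>dy\<close>, \<open>\<omega>\<close> this is the cross product of \<open>v\<close> and \<open>w\<close> with its last entry multiplied by \<open>e\<close>,
  that is, the vector which the metric identifies with the covector \<open>det (v, w, _)\<close>.\<close>

definition frame_normal :: "real \<Rightarrow> real^3 \<Rightarrow> real^3 \<Rightarrow> real^3 \<Rightarrow> real^3" where
  "frame_normal e p v w = (let n1 = v$2 * contact_form p w - contact_form p v * w$2;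
      n2 = contact_form p v * w$1 - v$1 * contact_form p w; n3 = v$1 * w$2 - v$2 * w$1
    in vector [n1, n2, e * n3 - (p$2 * n1 - p$1 * n2) / 2])"

lemma frame_normal_components:
  "frame_normal e p v w $ 1 = v$2 * contact_form p w - contact_form p v * w$2"
  "frame_normal e p v w $ 2 = contact_form p v * w$1 - v$1 * contact_form p w"
  "contact_form p (frame_normal e p v w) = e * (v$1 * w$2 - v$2 * w$1)"
  by (simp_all add: frame_normal_def Let_def contact_form_def[of p "vector _"])

lemma heis_metric_frame_normal:
  assumes "e = 1 \<or> e = -1"
  shows "heis_metric e p X (frame_normal e p v w) = det3 v w X"
proof -
  have ee: "e * e = 1" using assms by auto
  have "heis_metric e p X (frame_normal e p v w) =
     X$1 * (v$2 * contact_form p w - contact_form p v * w$2)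
     + X$2 * (contact_form p v * w$1 - v$1 * contact_form p w)
     + (e * e) * contact_form p X * (v$1 * w$2 - v$2 * w$1)"
    unfolding heis_metric_def frame_normal_components by (simp add: algebra_simps)
  also have "\<dots> = det3 v w X"
    unfolding ee det3_def contact_form_def by (simp add: algebra_simps add_divide_distrib diff_divide_distrib)
  finally show ?thesis .
qed

lemma heis_metric_commute: "heis_metric e p v w = heis_metric e p w v"
  by (simp add: heis_metric_def)

lemma heis_metric_scaleR: "heis_metric e p X (c *\<^sub>R N) = c * heis_metric e p X N"
  by (simp add: heis_metric_def contact_form_def field_simps)

lemma frame_normal_norm:
  assumes "e = 1 \<or> e = -1"
  shows "heis_metric e p v v * heis_metric e p w w - (heis_metric e p v w)\<^sup>2 =
    e * heis_metric e p (frame_normal e p v w) (frame_normal e p v w)"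
proof -
  have ee: "e * e = 1" using assms by auto
  have "e * heis_metric e p (frame_normal e p v w) (frame_normal e p v w) =
      e * (v$2 * contact_form p w - contact_form p v * w$2)\<^sup>2
      + e * (contact_form p v * w$1 - v$1 * contact_form p w)\<^sup>2
      + (e * e) * (e * e) * (v$1 * w$2 - v$2 * w$1)\<^sup>2"
    unfolding heis_metric_def frame_normal_components by (simp add: power2_eq_square algebra_simps)
  moreover have "heis_metric e p v v * heis_metric e p w w - (heis_metric e p v w)\<^sup>2 =
      e * (v$2 * contact_form p w - contact_form p v * w$2)\<^sup>2
      + e * (contact_form p v * w$1 - v$1 * contact_form p w)\<^sup>2
      + (v$1 * w$2 - v$2 * w$1)\<^sup>2"
    unfolding heis_metric_def by (simp add: power2_eq_square algebra_simps)
  ultimately show ?thesis unfolding ee by simp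
qed

lemma matrix_inv_2:
  fixes g :: "real^2^2"
  assumes "g$1$1 * g$2$2 - g$1$2 * g$2$1 \<noteq> 0"
  shows "matrix_inv g = (1 / (g$1$1 * g$2$2 - g$1$2 * g$2$1)) *\<^sub>R
    vector [vector [g$2$2, - g$1$2], vector [- g$2$1, g$1$1]]"
proof -
  define d where "d = g$1$1 * g$2$2 - g$1$2 * g$2$1"
  define Q :: "real^2^2" where "Q = (1/d) *\<^sub>R vector [vector [g$2$2, - g$1$2], vector [- g$2$1, g$1$1]]"
  have d: "d \<noteq> 0" using assms by (simp add: d_def)
  have "g$1$1 * g$2$2 = d + g$1$2 * g$2$1" by (simp add: d_def)
  then have "g ** Q = mat 1"
    using d by (simp add: vec_eq_iff forall_2 matrix_matrix_mult_def sum_2 Q_def mat_def field_simps)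
  then have "matrix_inv g = Q"
    using matrix_left_right_inverse matrix_inv_eqI by blast
  then show ?thesis by (simp add: Q_def d_def)
qed

text \<open>The trace with respect to the first fundamental form, multiplied by its determinant, with the unnormalised normal vector.
  A degenerate first fundamental form at a point that is not lightlike vanishes, and then the equation is trivial.\<close>

lemma zero_mean_curvature_cofactor:
  assumes e: "e = 1 \<or> e = -1"
    and ll: "\<not> lightlike_point (heis_metric e) Y u"
    and H: "\<And>N. unit_normal (heis_metric e) Y u N \<Longrightarrow> mean_curvature (heis_metric e) Y u N = 0"
  defines "g \<equiv> first_form (heis_metric e) Y u"
    and "S \<equiv> second_form (heis_metric e) Y u (frame_normal e (Y u) (partial 1 Y u) (partial 2 Y u))"
  shows "g$2$2 * S$1$1 - g$1$2 * (S$1$2 + S$2$1) + g$1$1 * S$2$2 = 0"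
proof (cases "det g = 0")
  case True
  then have "rank g < 2" by (simp add: det_eq_0_rank)
  then have "rank g = 0" using ll by (auto simp: lightlike_point_def g_def)
  then show ?thesis by (simp add: rank_eq_0)
next
  case False
  define M where "M = frame_normal e (Y u) (partial 1 Y u) (partial 2 Y u)"
  define Q where "Q = heis_metric e (Y u) M M"
  have sym: "g$2$1 = g$1$2" by (simp add: g_def first_form_def heis_metric_commute)
  have det: "det g = g$1$1 * g$2$2 - g$1$2 * g$2$1" by (simp add: det_2)
  also have "\<dots> = e * Q"
    using frame_normal_norm[OF e, of "Y u" "partial 1 Y u" "partial 2 Y u"]
    unfolding sym by (simp add: g_def first_form_def Q_def M_def power2_eq_square)
  finally have Q: "Q \<noteq> 0" using False by auto
  define c where "c = 1 / sqrt \<bar>Q\<bar>"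
  have c: "c \<noteq> 0" "c * c = 1 / \<bar>Q\<bar>" using Q by (simp_all add: c_def)
  have "unit_normal (heis_metric e) Y u (c *\<^sub>R M)"
    unfolding unit_normal_def
  proof
    show "\<forall>i. heis_metric e (Y u) (c *\<^sub>R M) (partial i Y u) = 0"
      by (simp add: forall_2 heis_metric_commute[of e "Y u" "c *\<^sub>R M"] heis_metric_scaleR)
        (simp add: M_def heis_metric_frame_normal[OF e] det3_def algebra_simps)
    have "heis_metric e (Y u) (c *\<^sub>R M) (c *\<^sub>R M) = c * c * Q"
      unfolding heis_metric_scaleR heis_metric_commute[of e "Y u" "c *\<^sub>R M"] by (simp add: Q_def)
    then show "\<bar>heis_metric e (Y u) (c *\<^sub>R M) (c *\<^sub>R M)\<bar> = 1"
      using Q c by (simp add: abs_mult)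
  qed
  then have "mean_curvature (heis_metric e) Y u (c *\<^sub>R M) = 0" by (rule H)
  moreover have "second_form (heis_metric e) Y u (c *\<^sub>R M) = c *\<^sub>R S"
    by (simp add: second_form_def S_def M_def heis_metric_scaleR vec_eq_iff)
  ultimately have "trace (matrix_inv g ** (c *\<^sub>R S)) = 0"
    by (simp add: mean_curvature_def g_def)
  moreover have "matrix_inv g = (1 / det g) *\<^sub>R vector [vector [g$2$2, - g$1$2], vector [- g$2$1, g$1$1]]"
    using matrix_inv_2[of g] False det by simp
  then have "trace (matrix_inv g ** (c *\<^sub>R S)) =
      (c / det g) * (g$2$2 * S$1$1 - g$1$2 * (S$1$2 + S$2$1) + g$1$1 * S$2$2)"
    using sym by (simp add: trace_def sum_2 matrix_matrix_mult_def ring_distribs add_divide_distrib diff_divide_distrib)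
      (simp add: mult_ac)
  ultimately have "(c / det g) * (g$2$2 * S$1$1 - g$1$2 * (S$1$2 + S$2$1) + g$1$1 * S$2$2) = 0"
    by simp
  then show ?thesis using c False by simp
qed

definition contact_partial ::
  "(real^2 \<Rightarrow> real) \<Rightarrow> (real^2 \<Rightarrow> real) \<Rightarrow> (real^2 \<Rightarrow> real) \<Rightarrow> 2 \<Rightarrow> real^2 \<Rightarrow> real" where
  "contact_partial x y z i u = partial i z u + (y u * partial i x u - x u * partial i y u) / 2"

text \<open>The determinant of the two tangent vectors and a second derivative of the parametrisation. The ordinary second derivative
  suffices because, for the combinations that occur, the Christoffel terms cancel.\<close>

definition normal_acceleration ::
  "(real^2 \<Rightarrow> real) \<Rightarrow> (real^2 \<Rightarrow> real) \<Rightarrow> (real^2 \<Rightarrow> real) \<Rightarrow> 2 \<Rightarrow> 2 \<Rightarrow> real^2 \<Rightarrow> real" where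
  "normal_acceleration x y z i j u =
     (partial 1 y u * partial 2 z u - partial 1 z u * partial 2 y u) * partial i (partial j x) u
   + (partial 1 z u * partial 2 x u - partial 1 x u * partial 2 z u) * partial i (partial j y) u
   + (partial 1 x u * partial 2 y u - partial 1 y u * partial 2 x u) * partial i (partial j z) u"

text \<open>The matrix of normal accelerations is contracted with the cofactors of two quadratic forms on the tangent plane, the square of
  the contact form and the horizontal inner product \<open>dx\<^sup>2 + dy\<^sup>2\<close>. The cofactors of the first form are the products of the entries of
  \<open>(w2, - w1)\<close>, the horizontal direction, so that the first equation concerns the second derivative in that direction.\<close>

definition doubly_minimal_chart ::
  "(real^2) set \<Rightarrow> (real^2 \<Rightarrow> real) \<Rightarrow> (real^2 \<Rightarrow> real) \<Rightarrow> (real^2 \<Rightarrow> real) \<Rightarrow> bool" where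
  "doubly_minimal_chart U x y z \<longleftrightarrow> open U \<and> smooth_on U x \<and> smooth_on U y \<and> smooth_on U z \<and>
    (\<forall>u\<in>U.
      (partial 1 y u * partial 2 z u - partial 1 z u * partial 2 y u \<noteq> 0 \<or>
       partial 1 z u * partial 2 x u - partial 1 x u * partial 2 z u \<noteq> 0 \<or>
       partial 1 x u * partial 2 y u - partial 1 y u * partial 2 x u \<noteq> 0) \<and>
      (contact_partial x y z 2 u)\<^sup>2 * normal_acceleration x y z 1 1 u
        - 2 * contact_partial x y z 1 u * contact_partial x y z 2 u * normal_acceleration x y z 1 2 u
        + (contact_partial x y z 1 u)\<^sup>2 * normal_acceleration x y z 2 2 u = 0 \<and>
      ((partial 2 x u)\<^sup>2 + (partial 2 y u)\<^sup>2) * normal_acceleration x y z 1 1 u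
        - 2 * (partial 1 x u * partial 2 x u + partial 1 y u * partial 2 y u) * normal_acceleration x y z 1 2 u
        + ((partial 1 x u)\<^sup>2 + (partial 1 y u)\<^sup>2) * normal_acceleration x y z 2 2 u = 0)"

text \<open>The equations for \<open>e = 1\<close> and \<open>e = - 1\<close> are added and subtracted. In the sum the terms with \<open>n1\<close> and \<open>n2\<close>, which come
  from the Christoffel symbols, cancel identically; in the difference they cancel because \<open>(n1, n2)\<close> is the horizontal part of the
  cross product.\<close>

lemma sum_difference_algebra:
  fixes h11 h12 h22 v1 v2 w1 w2 a b :: real
  assumes E: "\<And>e. e = 1 \<or> e = -1 \<Longrightarrow>
    (w1 * w1 + w2 * w2 + e * b * b) * (h11 + e * (2 * a * ((v2 * n1 - v1 * n2) / 2)))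
    - (v1 * w1 + v2 * w2 + e * a * b) * (2 * (h12 + e * (a * ((w2 * n1 - w1 * n2) / 2) + b * ((v2 * n1 - v1 * n2) / 2))))
    + (v1 * v1 + v2 * v2 + e * a * a) * (h22 + e * (2 * b * ((w2 * n1 - w1 * n2) / 2))) = 0"
    and n: "n1 = v2 * b - a * w2" "n2 = a * w1 - v1 * b"
  shows "b\<^sup>2 * h11 - 2 * a * b * h12 + a\<^sup>2 * h22 = 0"
    and "(w1\<^sup>2 + w2\<^sup>2) * h11 - 2 * (v1 * w1 + v2 * w2) * h12 + (v1\<^sup>2 + v2\<^sup>2) * h22 = 0"
proof -
  define c1 where "c1 = (v2 * n1 - v1 * n2) / 2"
  define c2 where "c2 = (w2 * n1 - w1 * n2) / 2"
  have c: "2 * c1 = v2 * n1 - v1 * n2" "2 * c2 = w2 * n1 - w1 * n2"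
    by (simp_all add: c1_def c2_def)
  have p: "(w1 * w1 + w2 * w2 + b * b) * (h11 + 2 * a * c1)
    - (v1 * w1 + v2 * w2 + a * b) * (2 * (h12 + (a * c2 + b * c1)))
    + (v1 * v1 + v2 * v2 + a * a) * (h22 + 2 * b * c2) = 0"
    using E[of 1, folded c1_def c2_def] by (simp add: mult.assoc)
  have m: "(w1 * w1 + w2 * w2 - b * b) * (h11 - 2 * a * c1)
    - (v1 * w1 + v2 * w2 - a * b) * (2 * (h12 - (a * c2 + b * c1)))
    + (v1 * v1 + v2 * v2 - a * a) * (h22 - 2 * b * c2) = 0"
    using E[of "-1", folded c1_def c2_def] by (simp add: algebra_simps)
  have "2 * ((w1 * w1 + w2 * w2) * a * c1 - (v1 * w1 + v2 * w2) * (a * c2 + b * c1)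
      + (v1 * v1 + v2 * v2) * b * c2)
    = (2 * c1) * ((w1 * w1 + w2 * w2) * a - (v1 * w1 + v2 * w2) * b)
      + (2 * c2) * ((v1 * v1 + v2 * v2) * b - (v1 * w1 + v2 * w2) * a)"
    by (simp add: algebra_simps)
  also have "\<dots> = 0"
    unfolding c n by (simp add: algebra_simps)
  finally have t: "(w1 * w1 + w2 * w2) * a * c1 - (v1 * w1 + v2 * w2) * (a * c2 + b * c1)
      + (v1 * v1 + v2 * v2) * b * c2 = 0" by simp
  from p m t show "b\<^sup>2 * h11 - 2 * a * b * h12 + a\<^sup>2 * h22 = 0"
    unfolding power2_eq_square by algebra
  from p m show "(w1\<^sup>2 + w2\<^sup>2) * h11 - 2 * (v1 * w1 + v2 * w2) * h12 + (v1\<^sup>2 + v2\<^sup>2) * h22 = 0"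
    unfolding power2_eq_square by algebra
qed

lemma doubly_minimal_chartI:
  fixes Y :: "real^2 \<Rightarrow> real^3"
  assumes U: "open U" and Y: "smooth_on U Y"
    and inj: "\<And>u. u \<in> U \<Longrightarrow> inj (frechet_derivative Y (at u))"
    and ll: "\<And>e u. e = 1 \<or> e = -1 \<Longrightarrow> u \<in> U \<Longrightarrow> \<not> lightlike_point (heis_metric e) Y u"
    and H: "\<And>e u N. e = 1 \<or> e = -1 \<Longrightarrow> u \<in> U \<Longrightarrow> unit_normal (heis_metric e) Y u N \<Longrightarrow>
       mean_curvature (heis_metric e) Y u N = 0"
  shows "doubly_minimal_chart U (\<lambda>u. Y u $ 1) (\<lambda>u. Y u $ 2) (\<lambda>u. Y u $ 3)"
proof -
  define x y z where "x = (\<lambda>u. Y u $ 1)" and "y = (\<lambda>u. Y u $ 2)" and "z = (\<lambda>u. Y u $ 3)"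
  have sm: "smooth_on U (\<lambda>u. Y u $ k)" for k
    by (rule smooth_on_bounded_linear[OF U bounded_linear_vec_nth Y])
  then have smxyz: "smooth_on U x" "smooth_on U y" "smooth_on U z"
    unfolding x_def y_def z_def by blast+
  have p1k: "partial i Y u $ k = partial i (\<lambda>u. Y u $ k) u" if "u \<in> U" for u i k
    by (rule partial_component[OF smooth_on_differentiable[OF Y that]])
  have p1: "partial i Y u $ 1 = partial i x u" "partial i Y u $ 2 = partial i y u" "partial i Y u $ 3 = partial i z u"
    if "u \<in> U" for u i
    using p1k[OF that] by (simp_all add: x_def y_def z_def)
  have p2k: "partial i (partial j Y) u $ k = partial i (partial j (\<lambda>u. Y u $ k)) u" if "u \<in> U" for u i j k
  proof -
    have "partial i (partial j Y) u $ k = partial i (\<lambda>v. partial j Y v $ k) u"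
      by (rule partial_component[OF smooth_on_differentiable[OF smooth_on_partial[OF Y] that]])
    also have "\<dots> = partial i (partial j (\<lambda>u. Y u $ k)) u"
      by (rule partial_cong[OF U that p1k])
    finally show ?thesis .
  qed
  have p2: "partial i (partial j Y) u $ 1 = partial i (partial j x) u"
    "partial i (partial j Y) u $ 2 = partial i (partial j y) u"
    "partial i (partial j Y) u $ 3 = partial i (partial j z) u"
    if "u \<in> U" for u i j
    using p2k[OF that] by (simp_all add: x_def y_def z_def)
  have cp: "contact_form (Y u) (partial i Y u) = contact_partial x y z i u" if "u \<in> U" for u i
    by (simp add: contact_form_def contact_partial_def p1[OF that]) (simp add: x_def y_def)
  have na: "det3 (partial 1 Y u) (partial 2 Y u) (partial i (partial j Y) u) = normal_acceleration x y z i j u"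
    if "u \<in> U" for u i j
    by (simp add: det3_def normal_acceleration_def p1[OF that] p2[OF that] algebra_simps)
  have na21: "normal_acceleration x y z 2 1 u = normal_acceleration x y z 1 2 u" if "u \<in> U" for u
    unfolding normal_acceleration_def using smxyz by (simp add: partial_commute[OF U _ that])
  \<comment> \<open>linear independence of the tangent vectors, written with the entries of their cross product\<close>
  have imm: "partial 1 y u * partial 2 z u - partial 1 z u * partial 2 y u \<noteq> 0 \<or>
       partial 1 z u * partial 2 x u - partial 1 x u * partial 2 z u \<noteq> 0 \<or>
       partial 1 x u * partial 2 y u - partial 1 y u * partial 2 x u \<noteq> 0" if u: "u \<in> U" for u
  proof (rule ccontr)
    assume "\<not> ?thesis"
    then have cr: "partial 1 y u * partial 2 z u = partial 1 z u * partial 2 y u"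
       "partial 1 z u * partial 2 x u = partial 1 x u * partial 2 z u"
       "partial 1 x u * partial 2 y u = partial 1 y u * partial 2 x u" by auto
    let ?D = "frechet_derivative Y (at u)"
    have lin: "linear ?D" by (rule linear_frechet_derivative[OF smooth_on_differentiable[OF Y u]])
    have D: "?D (a *\<^sub>R axis 1 1 + b *\<^sub>R axis 2 1) = a *\<^sub>R partial 1 Y u + b *\<^sub>R partial 2 Y u" for a b
      using lin by (simp add: linear_add linear_scale partial_def)
    have inj0: "a = 0 \<and> b = 0" if "a *\<^sub>R partial 1 Y u + b *\<^sub>R partial 2 Y u = 0" for a b
    proof -
      have "?D (a *\<^sub>R axis 1 1 + b *\<^sub>R axis 2 1) = ?D 0"
        using that D lin by (simp add: linear_0)
      then have "a *\<^sub>R axis 1 1 + b *\<^sub>R axis 2 (1::real) = (0 :: real^2)"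
        using inj[OF u] by (metis injD)
      then show ?thesis by (simp add: vec_eq_iff forall_2 axis_def)
    qed
    have "partial 2 x u = 0"
      using inj0[of "partial 2 x u" "- partial 1 x u"] cr
      by (simp add: vec_eq_iff forall_3 p1[OF u] mult.commute)
    moreover have "partial 2 y u = 0"
      using inj0[of "partial 2 y u" "- partial 1 y u"] cr
      by (simp add: vec_eq_iff forall_3 p1[OF u] mult.commute)
    moreover have "partial 2 z u = 0"
      using inj0[of "partial 2 z u" "- partial 1 z u"] cr
      by (simp add: vec_eq_iff forall_3 p1[OF u] mult.commute)
    ultimately show False
      using inj0[of 0 1] by (simp add: vec_eq_iff forall_3 p1[OF u])
  qed
  have eqs: "(contact_partial x y z 2 u)\<^sup>2 * normal_acceleration x y z 1 1 u
        - 2 * contact_partial x y z 1 u * contact_partial x y z 2 u * normal_acceleration x y z 1 2 u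
        + (contact_partial x y z 1 u)\<^sup>2 * normal_acceleration x y z 2 2 u = 0 \<and>
      ((partial 2 x u)\<^sup>2 + (partial 2 y u)\<^sup>2) * normal_acceleration x y z 1 1 u
        - 2 * (partial 1 x u * partial 2 x u + partial 1 y u * partial 2 y u) * normal_acceleration x y z 1 2 u
        + ((partial 1 x u)\<^sup>2 + (partial 1 y u)\<^sup>2) * normal_acceleration x y z 2 2 u = 0"
    if u: "u \<in> U" for u
  proof -
    define a b where "a = contact_partial x y z 1 u" and "b = contact_partial x y z 2 u"
    define n1 n2 where "n1 = partial 1 y u * b - a * partial 2 y u" and "n2 = a * partial 2 x u - partial 1 x u * b"
    define h where "h i j = normal_acceleration x y z i j u" for i j
    define B where "B i = (partial i y u * n1 - partial i x u * n2) / 2" for i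
    have main: "(partial 2 x u * partial 2 x u + partial 2 y u * partial 2 y u + e * b * b)
        * (h 1 1 + e * (2 * a * B 1))
      - (partial 1 x u * partial 2 x u + partial 1 y u * partial 2 y u + e * a * b)
        * (2 * (h 1 2 + e * (a * B 2
                            + b * B 1)))
      + (partial 1 x u * partial 1 x u + partial 1 y u * partial 1 y u + e * a * a)
        * (h 2 2 + e * (2 * b * B 2)) = 0"
      if e: "e = 1 \<or> e = -1" for e :: real
    proof -
      define N where "N = frame_normal e (Y u) (partial 1 Y u) (partial 2 Y u)"
      have N: "N $ 1 = n1" "N $ 2 = n2"
        by (simp_all add: N_def frame_normal_def Let_def n1_def n2_def cp[OF u] p1[OF u] a_def b_def)
      have S: "second_form (heis_metric e) Y u N $ i $ j = h i j +
          e * (contact_partial x y z i u * B j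
             + contact_partial x y z j u * B i)" for i j
        by (simp add: second_form_def heis_covariant_partial[OF e] cp[OF u] contact_curvature_def N p1[OF u] B_def)
          (simp add: N_def heis_metric_frame_normal[OF e] na[OF u] h_def)
      have g: "first_form (heis_metric e) Y u $ i $ j =
          partial i x u * partial j x u + partial i y u * partial j y u
          + e * contact_partial x y z i u * contact_partial x y z j u" for i j
        by (simp add: first_form_def heis_metric_def cp[OF u] p1[OF u])
      have h21: "h 2 1 = h 1 2" by (simp add: h_def na21[OF u])
      have "0 = (first_form (heis_metric e) Y u)$2$2 * (second_form (heis_metric e) Y u N)$1$1
        - (first_form (heis_metric e) Y u)$1$2 * ((second_form (heis_metric e) Y u N)$1$2 + (second_form (heis_metric e) Y u N)$2$1)
        + (first_form (heis_metric e) Y u)$1$1 * (second_form (heis_metric e) Y u N)$2$2"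
        unfolding N_def by (rule sym, rule zero_mean_curvature_cofactor[OF e ll[OF e u] H[OF e u]])
      then show ?thesis
        unfolding S g h21 a_def[symmetric] b_def[symmetric] by (simp add: algebra_simps)
    qed
    show ?thesis
      using sum_difference_algebra[OF main[unfolded B_def] n1_def n2_def] by (simp add: a_def b_def h_def)
  qed
  show ?thesis
    using U smxyz imm eqs unfolding doubly_minimal_chart_def x_def y_def z_def by blast
qed

section \<open>Isometries\<close>

text \<open>The rotation about the \<open>z\<close>-axis with cosine \<open>c\<close> and sine \<open>s\<close>, followed by the left translation by \<open>(a, b, d)\<close>. These maps are
  affine, so that the second derivatives of a parametrisation transform linearly.\<close>

definition heis_motion :: "real \<Rightarrow> real \<Rightarrow> real \<Rightarrow> real \<Rightarrow> real \<Rightarrow> real^3 \<Rightarrow> real^3" where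
  "heis_motion c s a b d p = vector [c * p$1 - s * p$2 + a, s * p$1 + c * p$2 + b,
     p$3 + (a * (s * p$1 + c * p$2) - b * (c * p$1 - s * p$2)) / 2 + d]"

lemma heis_motion_components [simp]:
  "heis_motion c s a b d p $ 1 = c * p$1 - s * p$2 + a"
  "heis_motion c s a b d p $ 2 = s * p$1 + c * p$2 + b"
  "heis_motion c s a b d p $ 3 = p$3 + (a * (s * p$1 + c * p$2) - b * (c * p$1 - s * p$2)) / 2 + d"
  by (simp_all add: heis_motion_def)

text \<open>A rotation can be moved past a translation because it preserves the area form \<open>a b' - b a'\<close> in the group law.\<close>

lemma heis_motion_compose:
  assumes "c\<^sup>2 + s\<^sup>2 = 1"
  shows "heis_motion c s a b d (heis_motion c' s' a' b' d' p) =
    heis_motion (c * c' - s * s') (s * c' + c * s') (c * a' - s * b' + a) (s * a' + c * b' + b)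
      (d + d' + (a * (s * a' + c * b') - b * (c * a' - s * b')) / 2) p"
proof -
  define X Y where "X = c' * p$1 - s' * p$2" and "Y = s' * p$1 + c' * p$2"
  have "a' * Y - b' * X = (c\<^sup>2 + s\<^sup>2) * (a' * Y - b' * X)" using assms by simp
  also have "\<dots> = (c * a' - s * b') * (s * X + c * Y) - (s * a' + c * b') * (c * X - s * Y)"
    by (simp add: power2_eq_square algebra_simps)
  finally have *: "a' * Y - b' * X = \<dots>" .
  have S: "(s * c' + c * s') * p$1 + (c * c' - s * s') * p$2 = s * X + c * Y"
    and C: "(c * c' - s * s') * p$1 - (s * c' + c * s') * p$2 = c * X - s * Y"
    by (simp_all add: X_def Y_def algebra_simps)
  show ?thesis
    unfolding vec_eq_iff forall_3 heis_motion_components X_def[symmetric] Y_def[symmetric] S C *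
    by (simp add: field_simps)
qed

definition is_heis_motion :: "(real^3 \<Rightarrow> real^3) \<Rightarrow> bool" where
  "is_heis_motion \<phi> \<longleftrightarrow> (\<exists>c s a b d. c\<^sup>2 + s\<^sup>2 = 1 \<and> \<phi> = heis_motion c s a b d)"

lemma is_heis_motionI: "c\<^sup>2 + s\<^sup>2 = 1 \<Longrightarrow> is_heis_motion (heis_motion c s a b d)"
  unfolding is_heis_motion_def by blast

lemma heis_motion_id: "heis_motion 1 0 0 0 0 = (\<lambda>p. p)"
  by (auto simp: fun_eq_iff vec_eq_iff forall_3)

lemma is_heis_motion_id: "is_heis_motion (\<lambda>p. p)"
  unfolding is_heis_motion_def heis_motion_id[symmetric] by (rule exI[of _ 1], rule exI[of _ 0]) auto

lemma is_heis_motion_compose: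
  assumes "is_heis_motion \<phi>" "is_heis_motion \<psi>"
  shows "is_heis_motion (\<lambda>p. \<phi> (\<psi> p))"
proof -
  obtain c s a b d where 1: "c\<^sup>2 + s\<^sup>2 = 1" "\<phi> = heis_motion c s a b d"
    using assms(1) by (auto simp: is_heis_motion_def)
  obtain c' s' a' b' d' where 2: "c'\<^sup>2 + s'\<^sup>2 = 1" "\<psi> = heis_motion c' s' a' b' d'"
    using assms(2) by (auto simp: is_heis_motion_def)
  have "(c * c' - s * s')\<^sup>2 + (s * c' + c * s')\<^sup>2 = (c\<^sup>2 + s\<^sup>2) * (c'\<^sup>2 + s'\<^sup>2)"
    by (simp add: power2_eq_square algebra_simps)
  then show ?thesis
    unfolding is_heis_motion_def 1(2) 2(2) heis_motion_compose[OF 1(1)] using 1(1) 2(1)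
    by (metis mult_1)
qed

lemma is_heis_motion_inverse:
  assumes "is_heis_motion \<phi>"
  obtains \<psi> where "is_heis_motion \<psi>" "\<And>p. \<psi> (\<phi> p) = p" "\<And>p. \<phi> (\<psi> p) = p"
proof -
  obtain c s a b d where 1: "c\<^sup>2 + s\<^sup>2 = 1" "\<phi> = heis_motion c s a b d"
    using assms by (auto simp: is_heis_motion_def)
  have 2: "c\<^sup>2 + (- s)\<^sup>2 = 1" using 1(1) by simp
  let ?\<psi> = "heis_motion c (- s) (- (c * a + s * b)) (s * a - c * b) (- d)"
  have cs: "c * c + s * s = 1" using 1(1) by (simp add: power2_eq_square)
  show ?thesis
  proof
    show "is_heis_motion ?\<psi>" using 2 by (rule is_heis_motionI)
    show "?\<psi> (\<phi> p) = p" for p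
    proof -
      have "c * c - - s * s = 1" "- s * c + c * s = 0" "c * a - - s * b + - (c * a + s * b) = 0"
        "- s * a + c * b + (s * a - c * b) = 0"
        "- d + d + (- (c * a + s * b) * (- s * a + c * b) - (s * a - c * b) * (c * a - - s * b)) / 2 = 0"
        using cs by (simp_all add: algebra_simps)
      then show ?thesis
        unfolding 1(2) heis_motion_compose[OF 2] by (simp only: heis_motion_id)
    qed
    show "\<phi> (?\<psi> p) = p" for p
    proof -
      have "c * - (c * a + s * b) - s * (s * a - c * b) = - (c * c + s * s) * a"
        "s * - (c * a + s * b) + c * (s * a - c * b) = - (c * c + s * s) * b"
        by (simp_all add: algebra_simps)
      then have t: "c * - (c * a + s * b) - s * (s * a - c * b) = - a"
        "s * - (c * a + s * b) + c * (s * a - c * b) = - b"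
        unfolding cs by simp_all
      have "c * c - s * - s = 1" "s * c + c * - s = 0" using cs by (simp_all add: algebra_simps)
      then show ?thesis
        unfolding 1(2) heis_motion_compose[OF 1(1)] t by (simp add: heis_motion_id)
    qed
  qed
qed

lemma has_derivative_heis_motion:
  "(heis_motion c s a b d has_derivative (\<lambda>v. vector [c * v$1 - s * v$2, s * v$1 + c * v$2,
     v$3 + (a * (s * v$1 + c * v$2) - b * (c * v$1 - s * v$2)) / 2])) (at p)"
proof -
  have L: "linear (\<lambda>v::real^3. vector [c * v$1 - s * v$2, s * v$1 + c * v$2,
     v$3 + (a * (s * v$1 + c * v$2) - b * (c * v$1 - s * v$2)) / 2] :: real^3)"
    by (rule linearI) (simp_all add: vec_eq_iff forall_3 field_simps)
  have "heis_motion c s a b d = (\<lambda>v. vector [c * v$1 - s * v$2, s * v$1 + c * v$2,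
     v$3 + (a * (s * v$1 + c * v$2) - b * (c * v$1 - s * v$2)) / 2] + vector [a, b, d])"
    by (simp add: fun_eq_iff vec_eq_iff forall_3)
  then show ?thesis
    using has_derivative_add[OF linear_imp_has_derivative[OF L] has_derivative_const[of "vector [a, b, d]"]]
    by simp
qed

lemma is_heis_motion_smooth:
  assumes "is_heis_motion \<phi>"
  shows "smooth_on UNIV \<phi>"
proof -
  obtain c s a b d where \<phi>: "\<phi> = heis_motion c s a b d"
    using assms by (auto simp: is_heis_motion_def)
  have D: "frechet_derivative \<phi> (at p) = (\<lambda>v. vector [c * v$1 - s * v$2, s * v$1 + c * v$2,
     v$3 + (a * (s * v$1 + c * v$2) - b * (c * v$1 - s * v$2)) / 2])" for p
    unfolding \<phi> using frechet_derivative_at[OF has_derivative_heis_motion] by simp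
  have d: "\<phi> differentiable (at p)" for p
    unfolding \<phi> differentiable_def by (rule exI, rule has_derivative_heis_motion)
  have "times_differentiable_on n UNIV \<phi>" for n
    by (cases n) (auto simp: D d times_differentiable_on_const
        intro!: continuous_at_imp_continuous_on differentiable_imp_continuous_within)
  then show ?thesis by (simp add: smooth_on_def)
qed

lemma is_heis_motion_isometry:
  assumes "is_heis_motion \<phi>"
  shows "riem_isometry heis_riem \<phi>"
proof -
  obtain c s a b d where 1: "c\<^sup>2 + s\<^sup>2 = 1" "\<phi> = heis_motion c s a b d"
    using assms by (auto simp: is_heis_motion_def)
  obtain \<psi> where \<psi>: "is_heis_motion \<psi>" "\<And>p. \<psi> (\<phi> p) = p" "\<And>p. \<phi> (\<psi> p) = p"
    using is_heis_motion_inverse[OF assms] by blast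
  have bij: "bij \<phi>" using \<psi>(2,3) by (metis bijI')
  have inv: "inv \<phi> = \<psi>" using \<psi>(3) bij by (metis bij_inv_eq_iff ext)
  have D: "frechet_derivative \<phi> (at p) = (\<lambda>v. vector [c * v$1 - s * v$2, s * v$1 + c * v$2,
     v$3 + (a * (s * v$1 + c * v$2) - b * (c * v$1 - s * v$2)) / 2])" for p
    unfolding 1(2) using frechet_derivative_at[OF has_derivative_heis_motion] by simp
  have "heis_riem (\<phi> p) (frechet_derivative \<phi> (at p) v) (frechet_derivative \<phi> (at p) w) = heis_riem p v w"
    for p v w
  proof -
    have \<phi>p: "\<phi> p $ 1 = c * p$1 - s * p$2 + a" "\<phi> p $ 2 = s * p$1 + c * p$2 + b"
      by (simp_all add: 1(2))
    have cf: "contact_form (\<phi> p) (frechet_derivative \<phi> (at p) v) = contact_form p v" for v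
    proof -
      have "contact_form (\<phi> p) (frechet_derivative \<phi> (at p) v) =
          v$3 + (c\<^sup>2 + s\<^sup>2) * ((p$2 * v$1 - p$1 * v$2) / 2)"
        by (simp add: D contact_form_def \<phi>p power2_eq_square field_simps)
      then show ?thesis by (simp add: 1(1) contact_form_def)
    qed
    have "heis_riem (\<phi> p) (frechet_derivative \<phi> (at p) v) (frechet_derivative \<phi> (at p) w)
      = (c\<^sup>2 + s\<^sup>2) * (v$1 * w$1 + v$2 * w$2) + contact_form p v * contact_form p w"
      unfolding heis_riem_def cf by (simp add: D power2_eq_square algebra_simps)
    then show ?thesis by (simp add: 1(1) heis_riem_def)
  qed
  then show ?thesis
    unfolding riem_isometry_def inv
    using bij is_heis_motion_smooth[OF assms] is_heis_motion_smooth[OF \<psi>(1)] by blast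
qed

lemma partial_affine:
  fixes f g h :: "real^2 \<Rightarrow> real"
  assumes "f differentiable (at u)" "g differentiable (at u)" "h differentiable (at u)"
  shows "partial i (\<lambda>u. p * f u + q * g u + r * h u + e) u =
      p * partial i f u + q * partial i g u + r * partial i h u"
  using assms by (simp add: partial_rules)

lemma contact_partial_motion:
  fixes x y z :: "real^2 \<Rightarrow> real"
  assumes cs: "c\<^sup>2 + s\<^sup>2 = 1"
    and d: "x differentiable (at u)" "y differentiable (at u)" "z differentiable (at u)"
  shows "contact_partial (\<lambda>u. c * x u - s * y u + a) (\<lambda>u. s * x u + c * y u + b)
    (\<lambda>u. z u + (a * (s * x u + c * y u) - b * (c * x u - s * y u)) / 2 + d) i u = contact_partial x y z i u"
proof -
  have z': "(\<lambda>u. z u + (a * (s * x u + c * y u) - b * (c * x u - s * y u)) / 2 + d) =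
      (\<lambda>u. (a * s - b * c) / 2 * x u + (a * c + b * s) / 2 * y u + 1 * z u + d)"
    by (simp add: fun_eq_iff field_simps)
  have x1: "partial i (\<lambda>u. c * x u - s * y u + a) u = c * partial i x u - s * partial i y u"
    and y1: "partial i (\<lambda>u. s * x u + c * y u + b) u = s * partial i x u + c * partial i y u"
    using partial_affine[OF d, of i c "-s" 0 a] partial_affine[OF d, of i s c 0 b] by simp_all
  have "contact_partial (\<lambda>u. c * x u - s * y u + a) (\<lambda>u. s * x u + c * y u + b)
      (\<lambda>u. z u + (a * (s * x u + c * y u) - b * (c * x u - s * y u)) / 2 + d) i u =
      partial i z u + (c\<^sup>2 + s\<^sup>2) * ((y u * partial i x u - x u * partial i y u) / 2)"
    unfolding contact_partial_def z' partial_affine[OF d] x1 y1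
    by (simp add: power2_eq_square field_simps)
  then show ?thesis by (simp add: cs contact_partial_def)
qed

text \<open>The two equations of a doubly minimal chart are preserved because a motion acts on tangent
  vectors by a linear map of determinant one that preserves the contact form and the horizontal
  inner product.\<close>

lemma doubly_minimal_chart_motion:
  assumes ch: "doubly_minimal_chart U x y z" and cs: "c\<^sup>2 + s\<^sup>2 = 1"
  shows "doubly_minimal_chart U (\<lambda>u. c * x u - s * y u + a) (\<lambda>u. s * x u + c * y u + b)
    (\<lambda>u. z u + (a * (s * x u + c * y u) - b * (c * x u - s * y u)) / 2 + d)"
proof -
  have U: "open U" and sm: "smooth_on U x" "smooth_on U y" "smooth_on U z"
    using ch by (auto simp: doubly_minimal_chart_def)
  define m1 m2 where "m1 = (a * s - b * c) / 2" and "m2 = (a * c + b * s) / 2"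
  define x' y' z' where "x' = (\<lambda>u. c * x u - s * y u + a)" and "y' = (\<lambda>u. s * x u + c * y u + b)"
    and "z' = (\<lambda>u. z u + (m1 * x u + m2 * y u) + d)"
  have z': "(\<lambda>u. z u + (a * (s * x u + c * y u) - b * (c * x u - s * y u)) / 2 + d) = z'"
    by (simp add: z'_def m1_def m2_def fun_eq_iff field_simps)
  have sm': "smooth_on U x'" "smooth_on U y'" "smooth_on U z'"
    unfolding x'_def y'_def z'_def by (intro smooth_intros U sm)+
  have lin: "partial i (\<lambda>u. p * f u + q * g u + r * h u + e) u =
      p * partial i f u + q * partial i g u + r * partial i h u"
    if "smooth_on U f" "smooth_on U g" "smooth_on U h" "u \<in> U" for i p q r e u and f g h :: "real^2 \<Rightarrow> real"
    using that by (simp add: partial_affine smooth_on_differentiable)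
  have x1: "partial i x' u = c * partial i x u - s * partial i y u" if "u \<in> U" for i u
    using lin[OF sm that, of i c "-s" 0 a] by (simp add: x'_def)
  have y1: "partial i y' u = s * partial i x u + c * partial i y u" if "u \<in> U" for i u
    using lin[OF sm that, of i s c 0 b] by (simp add: y'_def)
  have z1: "partial i z' u = partial i z u + (m1 * partial i x u + m2 * partial i y u)" if "u \<in> U" for i u
    using lin[OF sm that, of i m1 m2 1 d] by (simp add: z'_def algebra_simps)
  have smp: "smooth_on U (partial j x)" "smooth_on U (partial j y)" "smooth_on U (partial j z)" for j
    using sm by (auto intro: smooth_on_partial)
  have x2: "partial i (partial j x') u = c * partial i (partial j x) u - s * partial i (partial j y) u"
    if "u \<in> U" for i j u
    using lin[OF smp(1)[of j] smp(2)[of j] smp(3)[of j] that, of i c "-s" 0 0] partial_cong[OF U that x1] by simp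
  have y2: "partial i (partial j y') u = s * partial i (partial j x) u + c * partial i (partial j y) u"
    if "u \<in> U" for i j u
    using lin[OF smp(1)[of j] smp(2)[of j] smp(3)[of j] that, of i s c 0 0] partial_cong[OF U that y1] by simp
  have z2: "partial i (partial j z') u = partial i (partial j z) u
      + (m1 * partial i (partial j x) u + m2 * partial i (partial j y) u)" if "u \<in> U" for i j u
    using lin[OF smp(1)[of j] smp(2)[of j] smp(3)[of j] that, of i m1 m2 1 0] partial_cong[OF U that z1] by (simp add: algebra_simps)
  have cp: "contact_partial x' y' z' i u = contact_partial x y z i u" if "u \<in> U" for i u
    using contact_partial_motion[OF cs sm[THEN smooth_on_differentiable, OF that], of a b d i]
    unfolding x'_def y'_def z' .
  have hor: "partial i x' u * partial j x' u + partial i y' u * partial j y' u =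
      partial i x u * partial j x u + partial i y u * partial j y u" if "u \<in> U" for i j u
  proof -
    have "partial i x' u * partial j x' u + partial i y' u * partial j y' u =
      (c\<^sup>2 + s\<^sup>2) * (partial i x u * partial j x u + partial i y u * partial j y u)"
      unfolding x1[OF that] y1[OF that] by (simp add: power2_eq_square algebra_simps)
    then show ?thesis by (simp add: cs)
  qed
  define \<nu> where "\<nu> f g u = partial 1 f u * partial 2 g u - partial 1 g u * partial 2 f u"
    for f g :: "real^2 \<Rightarrow> real" and u
  \<comment> \<open>the transpose of the linear part maps the new cross product to the old one\<close>
  have n3: "\<nu> x y u = \<nu> x' y' u" and n1: "\<nu> y z u = c * \<nu> y' z' u + s * \<nu> z' x' u + m1 * \<nu> x' y' u"
    and n2: "\<nu> z x u = c * \<nu> z' x' u - s * \<nu> y' z' u + m2 * \<nu> x' y' u" if "u \<in> U" for u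
  proof -
    have "\<nu> x' y' u = (c\<^sup>2 + s\<^sup>2) * \<nu> x y u"
      "c * \<nu> y' z' u + s * \<nu> z' x' u + m1 * \<nu> x' y' u = (c\<^sup>2 + s\<^sup>2) * \<nu> y z u"
      "c * \<nu> z' x' u - s * \<nu> y' z' u + m2 * \<nu> x' y' u = (c\<^sup>2 + s\<^sup>2) * \<nu> z x u"
      unfolding \<nu>_def x1[OF that] y1[OF that] z1[OF that] by (simp_all add: power2_eq_square algebra_simps)
    then show "\<nu> x y u = \<nu> x' y' u" "\<nu> y z u = c * \<nu> y' z' u + s * \<nu> z' x' u + m1 * \<nu> x' y' u"
      "\<nu> z x u = c * \<nu> z' x' u - s * \<nu> y' z' u + m2 * \<nu> x' y' u"
      by (simp_all add: cs)
  qed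
  have na\<nu>: "normal_acceleration x y z i j u = \<nu> y z u * partial i (partial j x) u
      + \<nu> z x u * partial i (partial j y) u + \<nu> x y u * partial i (partial j z) u" for x y z i j u
    by (simp add: normal_acceleration_def \<nu>_def)
  have na: "normal_acceleration x' y' z' i j u = normal_acceleration x y z i j u" if "u \<in> U" for i j u
    unfolding na\<nu> x2[OF that] y2[OF that] z2[OF that] n1[OF that] n2[OF that] n3[OF that]
    by (simp add: algebra_simps)
  have imm: "\<nu> y' z' u \<noteq> 0 \<or> \<nu> z' x' u \<noteq> 0 \<or> \<nu> x' y' u \<noteq> 0" if "u \<in> U" for u
  proof -
    have "\<nu> y z u \<noteq> 0 \<or> \<nu> z x u \<noteq> 0 \<or> \<nu> x y u \<noteq> 0"
      using ch that unfolding doubly_minimal_chart_def \<nu>_def by blast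
    then show ?thesis using n1[OF that] n2[OF that] n3[OF that] by auto
  qed
  have "doubly_minimal_chart U x' y' z'"
    unfolding doubly_minimal_chart_def
  proof (intro conjI ballI U sm')
    fix u assume u: "u \<in> U"
    show "partial 1 y' u * partial 2 z' u - partial 1 z' u * partial 2 y' u \<noteq> 0 \<or>
       partial 1 z' u * partial 2 x' u - partial 1 x' u * partial 2 z' u \<noteq> 0 \<or>
       partial 1 x' u * partial 2 y' u - partial 1 y' u * partial 2 x' u \<noteq> 0"
      using imm[OF u] by (simp add: \<nu>_def)
    show "(contact_partial x' y' z' 2 u)\<^sup>2 * normal_acceleration x' y' z' 1 1 u
        - 2 * contact_partial x' y' z' 1 u * contact_partial x' y' z' 2 u * normal_acceleration x' y' z' 1 2 u
        + (contact_partial x' y' z' 1 u)\<^sup>2 * normal_acceleration x' y' z' 2 2 u = 0"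
      unfolding cp[OF u] na[OF u] using ch u by (simp add: doubly_minimal_chart_def)
    show "((partial 2 x' u)\<^sup>2 + (partial 2 y' u)\<^sup>2) * normal_acceleration x' y' z' 1 1 u
        - 2 * (partial 1 x' u * partial 2 x' u + partial 1 y' u * partial 2 y' u) * normal_acceleration x' y' z' 1 2 u
        + ((partial 1 x' u)\<^sup>2 + (partial 1 y' u)\<^sup>2) * normal_acceleration x' y' z' 2 2 u = 0"
      unfolding power2_eq_square hor[OF u] na[OF u]
      using ch u by (simp add: doubly_minimal_chart_def power2_eq_square)
  qed
  then show ?thesis unfolding x'_def y'_def z' .
qed

section \<open>The ruling by horizontal lines\<close>

lemma partial_divide_const:
  fixes f :: "real^'n::finite \<Rightarrow> real"
  assumes "f differentiable (at u)"
  shows "partial i (\<lambda>u. f u / c) u = partial i f u / c"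
  using partial_mult[OF assms, of "\<lambda>u. 1 / c"] by simp

lemma partial_contact_partial:
  assumes "open U" "smooth_on U x" "smooth_on U y" "smooth_on U z" "u \<in> U"
  shows "partial i (contact_partial x y z j) u = partial i (partial j z) u
    + (partial i y u * partial j x u + y u * partial i (partial j x) u
      - partial i x u * partial j y u - x u * partial i (partial j y) u) / 2"
proof -
  note d = assms(2-4)[THEN smooth_on_differentiable, OF assms(5)]
    assms(2-4)[THEN smooth_on_partial, THEN smooth_on_differentiable, OF assms(5)]
  show ?thesis
    unfolding contact_partial_def[abs_def] by (simp add: partial_rules partial_divide_const d)
qed

text \<open>The conclusion is \<open>T\<^sub>x dT\<^sub>y - T\<^sub>y dT\<^sub>x = 0\<close>, where \<open>T\<close> is the horizontal combination of the tangent vectors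
  with coefficients \<open>w2\<close> and \<open>- w1\<close> and \<open>d\<close> is the derivative in the direction of \<open>T\<close>; so the projected direction of \<open>T\<close> does not turn.
  The variables \<open>W\<close> are the derivatives of \<open>w1\<close> and \<open>w2\<close>. The derivative of \<open>T\<close> differs from the second derivative along \<open>T\<close> by a tangent
  vector, and on horizontal vectors the conormal is a multiple of \<open>(T\<^sub>y, - T\<^sub>x)\<close>.\<close>

lemma slope_algebra:
  fixes x y :: real
  assumes w1: "w1 = z1 + (y * x1 - x * y1) / 2" and w2: "w2 = z2 + (y * x2 - x * y2) / 2"
    and W11: "W11 = z11 + (y1 * x1 + y * x11 - x1 * y1 - x * y11) / 2"
    and W12: "W12 = z12 + (y1 * x2 + y * x12 - x1 * y2 - x * y12) / 2"
    and W21: "W21 = z12 + (y2 * x1 + y * x12 - x2 * y1 - x * y12) / 2"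
    and W22: "W22 = z22 + (y2 * x2 + y * x22 - x2 * y2 - x * y22) / 2"
    and h11: "h11 = (y1 * z2 - z1 * y2) * x11 + (z1 * x2 - x1 * z2) * y11 + (x1 * y2 - y1 * x2) * z11"
    and h12: "h12 = (y1 * z2 - z1 * y2) * x12 + (z1 * x2 - x1 * z2) * y12 + (x1 * y2 - y1 * x2) * z12"
    and h22: "h22 = (y1 * z2 - z1 * y2) * x22 + (z1 * x2 - x1 * z2) * y22 + (x1 * y2 - y1 * x2) * z22"
    and E: "w2\<^sup>2 * h11 - 2 * w1 * w2 * h12 + w1\<^sup>2 * h22 = 0"
  shows "(w2 * x1 - w1 * x2) * (w2 * (W12 * y1 + w2 * y11 - W11 * y2 - w1 * y12)
            - w1 * (W22 * y1 + w2 * y12 - W21 * y2 - w1 * y22))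
       - (w2 * y1 - w1 * y2) * (w2 * (W12 * x1 + w2 * x11 - W11 * x2 - w1 * x12)
            - w1 * (W22 * x1 + w2 * x12 - W21 * x2 - w1 * x22)) = 0" (is "?L = 0")
proof -
  define Tx Ty n3 where "Tx = w2 * x1 - w1 * x2" and "Ty = w2 * y1 - w1 * y2" and "n3 = x1 * y2 - y1 * x2"
  have nu: "y1 * z2 - z1 * y2 = Ty + n3 * y / 2" "z1 * x2 - x1 * z2 = - Tx - n3 * x / 2"
    unfolding Tx_def Ty_def n3_def w1 w2 by (simp_all add: field_simps)
  have hh: "2 * h11 = 2 * (Ty * x11 - Tx * y11) + n3 * (2 * W11)"
    "2 * h12 = 2 * (Ty * x12 - Tx * y12) + n3 * (W12 + W21)"
    "2 * h22 = 2 * (Ty * x22 - Tx * y22) + n3 * (2 * W22)"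
    unfolding h11 h12 h22 nu W11 W12 W21 W22 n3_def[symmetric] by (simp_all add: field_simps)
  have "2 * ?L = - (w2\<^sup>2 * (2 * h11) - 2 * w1 * w2 * (2 * h12) + w1\<^sup>2 * (2 * h22))"
    unfolding hh Tx_def Ty_def n3_def power2_eq_square by (simp add: algebra_simps)
  also have "\<dots> = - 2 * (w2\<^sup>2 * h11 - 2 * w1 * w2 * h12 + w1\<^sup>2 * h22)"
    by (simp add: algebra_simps)
  finally show ?thesis unfolding E by simp
qed

text \<open>The second equation for the ruled surface \<open>(x, b + k x, m - b x / 2)\<close>, where \<open>b1\<close>, \<open>b2\<close> and \<open>k1\<close>, \<open>k2\<close> are the first two
  derivatives of \<open>b\<close> and \<open>k\<close> with respect to \<open>m\<close>. The functions \<open>x\<close> and \<open>m\<close> serve as coordinates, \<open>J\<close> being their Jacobian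
  determinant; all second derivatives of \<open>x\<close> and \<open>m\<close> in the given chart drop out, since they multiply tangent vectors.\<close>

lemma ruled_algebra:
  fixes x b k b1 k1 b2 k2 :: real
  assumes y1: "y1 = b1 * m1 + k1 * m1 * x + k * x1" and y2: "y2 = b1 * m2 + k1 * m2 * x + k * x2"
    and z1: "z1 = m1 - (b1 * m1 * x + b * x1) / 2" and z2: "z2 = m2 - (b1 * m2 * x + b * x2) / 2"
    and y: "\<And>i j. yy i j = b2 * mm i * mm j + b1 * m' i j + k2 * mm i * mm j * x + k1 * m' i j * x
       + k1 * mm j * xx i + k1 * mm i * xx j + k * x' i j"
    and z: "\<And>i j. zz i j = m' i j - (b2 * mm i * mm j * x + b1 * m' i j * x + b1 * mm j * xx i
       + b1 * mm i * xx j + b * x' i j) / 2"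
    and mm: "mm (1::2) = m1" "mm 2 = m2" and xx: "xx (1::2) = x1" "xx 2 = x2"
    and h: "\<And>i j. h i j = (y1 * z2 - z1 * y2) * x' i j + (z1 * x2 - x1 * z2) * yy i j + (x1 * y2 - y1 * x2) * zz i j"
    and E: "(x2\<^sup>2 + y2\<^sup>2) * h 1 1 - 2 * (x1 * x2 + y1 * y2) * h 1 2 + (x1\<^sup>2 + y1\<^sup>2) * h 2 2 = 0"
    and J: "x1 * m2 - x2 * m1 \<noteq> 0"
  defines "A \<equiv> k1 + b1\<^sup>2 / 2"
  shows "(2 * k * b1 * A - (1 + k\<^sup>2) * b2) + (2 * k * k1 * A - (1 + k\<^sup>2) * k2) * x
    + (1 + k\<^sup>2) * (b1 * k2 - k1 * b2) / 2 * (x * x) = 0"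
proof -
  define J D G where "J = x1 * m2 - x2 * m1" and "D = b1 + k1 * x" and "G = 1 - b1 * x / 2"
  define p where "p = - G * (b2 + k2 * x) - D * b2 * x / 2"
  have ys: "y1 = D * m1 + k * x1" "y2 = D * m2 + k * x2"
    unfolding y1 y2 D_def by (simp_all add: algebra_simps)
  have zs: "z1 = G * m1 - b * x1 / 2" "z2 = G * m2 - b * x2 / 2"
    unfolding z1 z2 G_def by (simp_all add: field_simps)
  have nu: "y1 * z2 - z1 * y2 = J * (k * G + b * D / 2)" "z1 * x2 - x1 * z2 = - J * G"
    "x1 * y2 - y1 * x2 = J * D"
    unfolding ys zs J_def by (simp_all add: field_simps)
  have hh: "h i j = J * (- A * (xx i * mm j + mm i * xx j) + p * (mm i * mm j))" for i j
  proof -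
    have A: "A = G * k1 + D * b1 / 2"
      unfolding A_def G_def D_def by (simp add: field_simps power2_eq_square)
    have Y: "yy i j = D * m' i j + (b2 + k2 * x) * (mm i * mm j) + k1 * (xx i * mm j + mm i * xx j) + k * x' i j"
      unfolding y D_def by (simp add: algebra_simps)
    have Z: "zz i j = G * m' i j - b2 * x / 2 * (mm i * mm j) - b1 / 2 * (xx i * mm j + mm i * xx j) - b / 2 * x' i j"
      unfolding z G_def by (simp add: field_simps)
    show ?thesis
      unfolding h nu p_def A Y Z by (simp add: algebra_simps add_divide_distrib diff_divide_distrib)
  qed
  have h1: "h 1 1 = J * (- A * (x1 * m1 + m1 * x1) + p * (m1 * m1))"
    "h 1 2 = J * (- A * (x1 * m2 + m1 * x2) + p * (m1 * m2))"
    "h 2 2 = J * (- A * (x2 * m2 + m2 * x2) + p * (m2 * m2))"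
    using hh[of 1 1] hh[of 1 2] hh[of 2 2] mm xx by simp_all
  have "(x2\<^sup>2 + y2\<^sup>2) * h 1 1 - 2 * (x1 * x2 + y1 * y2) * h 1 2 + (x1\<^sup>2 + y1\<^sup>2) * h 2 2 =
     J * J\<^sup>2 * (2 * k * D * A + (1 + k\<^sup>2) * p)"
    unfolding h1 ys J_def power2_eq_square by (simp add: algebra_simps)
  then have "2 * k * D * A + (1 + k\<^sup>2) * p = 0" using E J by (simp add: J_def)
  moreover have "p = - b2 - k2 * x + (b1 * k2 - k1 * b2) / 2 * (x * x)"
    unfolding p_def G_def D_def by (simp add: field_simps)
  ultimately show ?thesis
    unfolding D_def by (simp add: algebra_simps add_divide_distrib diff_divide_distrib)
qed

text \<open>A chart of noncharacteristic points in which the horizontal tangent direction has a nonzero \<open>x\<close>-component, so that it has a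
  finite slope in the \<open>(x, y)\<close>-plane.\<close>

locale foliated_chart =
  fixes B :: "(real^2) set" and x y z :: "real^2 \<Rightarrow> real"
  assumes chart: "doubly_minimal_chart B x y z"
    and ruling_x_nonzero: "u \<in> B \<Longrightarrow>
      contact_partial x y z 2 u * partial 1 x u - contact_partial x y z 1 u * partial 2 x u \<noteq> 0"
begin

abbreviation "w \<equiv> contact_partial x y z"

text \<open>The components of the horizontal tangent vector, and the line on which it lies: the ruling through \<open>u\<close> consists of the points
  \<open>(t, b + k t, m - b t / 2)\<close>, where \<open>k\<close>, \<open>b\<close>, \<open>m\<close> are the slope, the intercept and the height at \<open>u\<close>.\<close>

definition ruling_x :: "real^2 \<Rightarrow> real" where "ruling_x u = w 2 u * partial 1 x u - w 1 u * partial 2 x u"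
definition ruling_y :: "real^2 \<Rightarrow> real" where "ruling_y u = w 2 u * partial 1 y u - w 1 u * partial 2 y u"
definition slope :: "real^2 \<Rightarrow> real" where "slope u = ruling_y u / ruling_x u"
definition intercept :: "real^2 \<Rightarrow> real" where "intercept u = y u - slope u * x u"
definition height :: "real^2 \<Rightarrow> real" where "height u = z u + intercept u * x u / 2"

text \<open>The horizontal tangent direction is \<open>(w 2, - w 1)\<close> in the chart.\<close>

definition constant_along_ruling :: "(real^2 \<Rightarrow> real) \<Rightarrow> bool" where
  "constant_along_ruling g \<longleftrightarrow> smooth_on B g \<and> (\<forall>u\<in>B. w 2 u * partial 1 g u = w 1 u * partial 2 g u)"

lemma open_B: "open B" and smooth_xyz: "smooth_on B x" "smooth_on B y" "smooth_on B z"
  using chart by (auto simp: doubly_minimal_chart_def)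

lemma smooth_w: "smooth_on B (w i)"
  unfolding contact_partial_def
  by (intro smooth_intros open_B smooth_on_partial smooth_xyz) auto

lemma smooth_ruling: "smooth_on B ruling_x" "smooth_on B ruling_y"
  unfolding ruling_x_def ruling_y_def
  by (intro smooth_intros open_B smooth_on_partial smooth_xyz smooth_w)+

lemma ruling_x_nz: "u \<in> B \<Longrightarrow> ruling_x u \<noteq> 0"
  using ruling_x_nonzero by (simp add: ruling_x_def)

lemma smooth_slope: "smooth_on B slope"
  unfolding slope_def using ruling_x_nz by (intro smooth_on_divide open_B smooth_ruling)

lemma smooth_intercept: "smooth_on B intercept"
  unfolding intercept_def by (intro smooth_intros open_B smooth_xyz smooth_slope)

lemma smooth_height: "smooth_on B height"
  unfolding height_def by (intro smooth_intros open_B smooth_xyz smooth_intercept) auto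

lemma y_eq: "y u = intercept u + slope u * x u"
  by (simp add: intercept_def)

lemma z_eq: "z u = height u - intercept u * x u / 2"
  by (simp add: height_def)

lemma diff: "smooth_on B g \<Longrightarrow> u \<in> B \<Longrightarrow> g differentiable (at u)"
  by (rule smooth_on_differentiable)

lemma ruling_z: "w 2 u * partial 1 z u - w 1 u * partial 2 z u = (x u * ruling_y u - y u * ruling_x u) / 2"
  by (simp add: ruling_x_def ruling_y_def contact_partial_def field_simps)

lemma constant_along_ruling_add:
  "constant_along_ruling f \<Longrightarrow> constant_along_ruling g \<Longrightarrow> constant_along_ruling (\<lambda>u. f u + g u)"
  unfolding constant_along_ruling_def
  by (auto simp: smooth_on_add open_B partial_add diff ring_distribs)

lemma constant_along_ruling_mult:
  assumes "constant_along_ruling f" "constant_along_ruling g"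
  shows "constant_along_ruling (\<lambda>u. f u * g u)"
proof -
  have "w 2 u * (f u * partial 1 g u + partial 1 f u * g u) = w 1 u * (f u * partial 2 g u + partial 2 f u * g u)"
    if "u \<in> B" for u
  proof -
    have "w 2 u * partial 1 g u = w 1 u * partial 2 g u" "w 2 u * partial 1 f u = w 1 u * partial 2 f u"
      using assms that by (auto simp: constant_along_ruling_def)
    then show ?thesis by algebra
  qed
  then show ?thesis
    using assms unfolding constant_along_ruling_def by (auto simp: smooth_on_mult open_B partial_mult diff)
qed

lemma constant_along_ruling_const: "constant_along_ruling (\<lambda>u. c)"
  by (simp add: constant_along_ruling_def smooth_on_const)

lemma constant_along_ruling_diff:
  "constant_along_ruling f \<Longrightarrow> constant_along_ruling g \<Longrightarrow> constant_along_ruling (\<lambda>u. f u - g u)"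
  using constant_along_ruling_add[of f "\<lambda>u. (-1) * g u"] constant_along_ruling_mult[OF constant_along_ruling_const[of "-1"]]
  by simp

text \<open>The first equation of a doubly minimal chart says that the surface is ruled by straight lines.\<close>

lemma slope_constant: "constant_along_ruling slope"
  unfolding constant_along_ruling_def
proof (intro conjI ballI smooth_slope)
  fix u assume u: "u \<in> B"
  note d = smooth_xyz[THEN smooth_on_differentiable, OF u]
    smooth_xyz[THEN smooth_on_partial, THEN smooth_on_differentiable, OF u]
    smooth_w[THEN smooth_on_differentiable, OF u]
  have rx: "partial i ruling_x u = partial i (w 2) u * partial 1 x u + w 2 u * partial i (partial 1 x) u
      - partial i (w 1) u * partial 2 x u - w 1 u * partial i (partial 2 x) u" for i
    unfolding ruling_x_def[abs_def] by (simp add: partial_rules d)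
  have ry: "partial i ruling_y u = partial i (w 2) u * partial 1 y u + w 2 u * partial i (partial 1 y) u
      - partial i (w 1) u * partial 2 y u - w 1 u * partial i (partial 2 y) u" for i
    unfolding ruling_y_def[abs_def] by (simp add: partial_rules d)
  have comm: "partial 2 (partial 1 x) u = partial 1 (partial 2 x) u" "partial 2 (partial 1 y) u = partial 1 (partial 2 y) u"
    "partial 2 (partial 1 z) u = partial 1 (partial 2 z) u"
    using partial_commute[OF open_B _ u] smooth_xyz by auto
  note pw = partial_contact_partial[OF open_B smooth_xyz u]
  have E: "(w 2 u)\<^sup>2 * normal_acceleration x y z 1 1 u - 2 * w 1 u * w 2 u * normal_acceleration x y z 1 2 u
        + (w 1 u)\<^sup>2 * normal_acceleration x y z 2 2 u = 0"
    using chart u by (simp add: doubly_minimal_chart_def)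
  have "ruling_x u * (w 2 u * partial 1 ruling_y u - w 1 u * partial 2 ruling_y u)
      - ruling_y u * (w 2 u * partial 1 ruling_x u - w 1 u * partial 2 ruling_x u) = 0"
    unfolding rx ry ruling_x_def ruling_y_def comm
    using slope_algebra[OF contact_partial_def[of x y z 1 u] contact_partial_def[of x y z 2 u]
      pw[of 1 1] pw[of 1 2] pw[of 2 1, unfolded comm] pw[of 2 2]
      normal_acceleration_def[of x y z 1 1 u] normal_acceleration_def[of x y z 1 2 u] normal_acceleration_def[of x y z 2 2 u]
      E] .
  then have "w 2 u * (partial 1 ruling_y u * ruling_x u - ruling_y u * partial 1 ruling_x u)
      = w 1 u * (partial 2 ruling_y u * ruling_x u - ruling_y u * partial 2 ruling_x u)"
    by (simp add: algebra_simps)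
  then show "w 2 u * partial 1 slope u = w 1 u * partial 2 slope u"
    unfolding slope_def[abs_def]
    by (simp add: partial_divide ruling_x_nz[OF u] smooth_on_differentiable[OF smooth_ruling(1) u]
        smooth_on_differentiable[OF smooth_ruling(2) u])
qed

lemma intercept_constant: "constant_along_ruling intercept"
  unfolding constant_along_ruling_def
proof (intro conjI ballI smooth_intercept)
  fix u assume u: "u \<in> B"
  note d = smooth_xyz[THEN smooth_on_differentiable, OF u] smooth_slope[THEN smooth_on_differentiable, OF u]
  have I: "partial i intercept u = partial i y u - (slope u * partial i x u + partial i slope u * x u)" for i
    unfolding intercept_def[abs_def] by (simp add: partial_rules d)
  have k: "w 2 u * partial 1 slope u = w 1 u * partial 2 slope u"
    using slope_constant u by (simp add: constant_along_ruling_def)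
  have s: "w 2 u * partial 1 y u - w 1 u * partial 2 y u = slope u * (w 2 u * partial 1 x u - w 1 u * partial 2 x u)"
    using ruling_x_nz[OF u] by (simp add: slope_def ruling_x_def ruling_y_def)
  show "w 2 u * partial 1 intercept u = w 1 u * partial 2 intercept u"
    unfolding I using k s by algebra
qed

text \<open>On a horizontal line of slope \<open>k\<close> and intercept \<open>b\<close> the coordinate \<open>z\<close> has derivative \<open>- b / 2\<close> with respect to \<open>x\<close>.\<close>

lemma height_constant: "constant_along_ruling height"
  unfolding constant_along_ruling_def
proof (intro conjI ballI smooth_height)
  fix u assume u: "u \<in> B"
  note d = smooth_xyz[THEN smooth_on_differentiable, OF u] smooth_intercept[THEN smooth_on_differentiable, OF u]
  have h: "partial i height u = partial i z u + (intercept u * partial i x u + partial i intercept u * x u) / 2" for i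
    unfolding height_def[abs_def] by (simp add: partial_rules partial_divide_const d)
  have i: "w 2 u * partial 1 intercept u = w 1 u * partial 2 intercept u"
    using intercept_constant u by (simp add: constant_along_ruling_def)
  have s: "ruling_y u = slope u * ruling_x u"
    using ruling_x_nz[OF u] by (simp add: slope_def)
  have "2 * (w 2 u * partial 1 z u - w 1 u * partial 2 z u) = x u * ruling_y u - y u * ruling_x u"
    using ruling_z[of u] by simp
  then have "2 * (w 2 u * partial 1 z u - w 1 u * partial 2 z u) = - intercept u * ruling_x u"
    unfolding s y_eq[of u] by (simp add: algebra_simps)
  then have "2 * (w 2 u * partial 1 height u - w 1 u * partial 2 height u) = 0"
    unfolding h ruling_x_def using i by (simp add: field_simps)
  then show "w 2 u * partial 1 height u = w 1 u * partial 2 height u" by simp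
qed

text \<open>A polynomial in \<open>x\<close> whose coefficients are constant along the ruling can vanish only if all
  its coefficients do, since \<open>x\<close> varies along the ruling.\<close>

lemma polynomial_in_x_zero:
  assumes "constant_along_ruling c0" "constant_along_ruling c1" "constant_along_ruling c2"
    and z: "\<And>u. u \<in> B \<Longrightarrow> c0 u + c1 u * x u + c2 u * (x u * x u) = 0"
    and u: "u \<in> B"
  shows "c0 u = 0" "c1 u = 0" "c2 u = 0"
proof -
  \<comment> \<open>differentiate along the ruling\<close>
  have lin: "a1 v = 0" if a: "constant_along_ruling a0" "constant_along_ruling a1"
    and eq: "\<And>u. u \<in> B \<Longrightarrow> a0 u + a1 u * x u = 0" and v: "v \<in> B" for a0 a1 v
  proof -
    have d: "a0 differentiable (at v)" "a1 differentiable (at v)" "x differentiable (at v)"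
      using a v smooth_xyz by (auto simp: constant_along_ruling_def intro: diff)
    have "partial i (\<lambda>u. a0 u + a1 u * x u) v = 0" for i
      using partial_cong[OF open_B v, of "\<lambda>u. a0 u + a1 u * x u" "\<lambda>u. 0"] eq by simp
    then have e: "partial i a0 v + (a1 v * partial i x v + partial i a1 v * x v) = 0" for i
      by (simp add: partial_rules d)
    have f: "w 2 v * partial 1 a0 v = w 1 v * partial 2 a0 v" "w 2 v * partial 1 a1 v = w 1 v * partial 2 a1 v"
      using a v by (simp_all add: constant_along_ruling_def)
    have "a1 v * ruling_x v = 0"
      unfolding ruling_x_def using e[of 1] e[of 2] f by algebra
    then show ?thesis using ruling_x_nz[OF v] by simp
  qed
  have lin': "a0 v = 0" if a: "constant_along_ruling a0" "constant_along_ruling a1"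
    and eq: "\<And>u. u \<in> B \<Longrightarrow> a0 u + a1 u * x u = 0" and v: "v \<in> B" for a0 a1 v
    using lin[OF a eq v] eq[OF v] by simp
  have q: "c1 v + (2 * c2 v) * x v = 0" if v: "v \<in> B" for v
  proof -
    have d: "c0 differentiable (at v)" "c1 differentiable (at v)" "c2 differentiable (at v)" "x differentiable (at v)"
      using assms(1-3) v smooth_xyz by (auto simp: constant_along_ruling_def intro: diff)
    have "partial i (\<lambda>u. c0 u + c1 u * x u + c2 u * (x u * x u)) v = 0" for i
      using partial_cong[OF open_B v, of "\<lambda>u. c0 u + c1 u * x u + c2 u * (x u * x u)" "\<lambda>u. 0"] z by simp
    then have e: "partial i c0 v + (c1 v * partial i x v + partial i c1 v * x v)
        + (c2 v * (x v * partial i x v + partial i x v * x v) + partial i c2 v * (x v * x v)) = 0" for i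
      by (simp add: partial_rules d)
    have f: "w 2 v * partial 1 c0 v = w 1 v * partial 2 c0 v" "w 2 v * partial 1 c1 v = w 1 v * partial 2 c1 v"
      "w 2 v * partial 1 c2 v = w 1 v * partial 2 c2 v"
      using assms(1-3) v by (simp_all add: constant_along_ruling_def)
    have "(c1 v + (2 * c2 v) * x v) * ruling_x v = 0"
      unfolding ruling_x_def using e[of 1] e[of 2] f by algebra
    then show ?thesis using ruling_x_nz[OF v] by simp
  qed
  have c: "constant_along_ruling (\<lambda>u. 2 * c2 u)"
    by (intro constant_along_ruling_mult constant_along_ruling_const assms)
  show c2: "c2 u = 0" using lin[OF assms(2) c q u] by simp
  show c1: "c1 u = 0" by (rule lin'[OF assms(2) c q u])
  show "c0 u = 0" using z[OF u] c1 c2 by simp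
qed

end

text \<open>The height separates the rulings: its differential vanishes on the ruling, and here it is required to be nonzero. Functions that are
  constant along the ruling can then be differentiated with respect to the height.\<close>

locale ruled_chart = foliated_chart +
  assumes transversal: "u \<in> B \<Longrightarrow> partial 1 height u * w 1 u + partial 2 height u * w 2 u \<noteq> 0"
begin

definition height_deriv :: "(real^2 \<Rightarrow> real) \<Rightarrow> real^2 \<Rightarrow> real" where
  "height_deriv g u = (partial 1 g u * w 1 u + partial 2 g u * w 2 u)
     / (partial 1 height u * w 1 u + partial 2 height u * w 2 u)"

lemma partial_eq_height_deriv:
  assumes g: "constant_along_ruling g" and u: "u \<in> B"
  shows "partial i g u = height_deriv g u * partial i height u"
proof -
  have 1: "w 2 u * partial 1 g u = w 1 u * partial 2 g u" "w 2 u * partial 1 height u = w 1 u * partial 2 height u"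
    using g height_constant u by (simp_all add: constant_along_ruling_def)
  have q: "partial 1 height u * w 1 u + partial 2 height u * w 2 u \<noteq> 0"
    by (rule transversal[OF u])
  have "partial 1 g u * (partial 1 height u * w 1 u + partial 2 height u * w 2 u)
      = (partial 1 g u * w 1 u + partial 2 g u * w 2 u) * partial 1 height u"
    "partial 2 g u * (partial 1 height u * w 1 u + partial 2 height u * w 2 u)
      = (partial 1 g u * w 1 u + partial 2 g u * w 2 u) * partial 2 height u"
    using 1 by algebra+
  then have "partial 1 g u = height_deriv g u * partial 1 height u" "partial 2 g u = height_deriv g u * partial 2 height u"
    unfolding height_deriv_def using q by (simp_all add: eq_divide_eq)
  then show ?thesis using exhaust_2[of i] by auto
qed

lemma smooth_height_deriv:
  assumes "smooth_on B g"
  shows "smooth_on B (height_deriv g)"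
  unfolding height_deriv_def[abs_def] using transversal
  by (intro smooth_intros open_B smooth_on_partial assms smooth_height smooth_w)

text \<open>If \<open>dg = g' dm\<close>, then \<open>dg'\<close> is a multiple of \<open>dm\<close> too, because the mixed partial derivatives of \<open>g\<close> and of \<open>m\<close> commute.\<close>

lemma height_deriv_constant:
  assumes g: "constant_along_ruling g"
  shows "constant_along_ruling (height_deriv g)"
  unfolding constant_along_ruling_def
proof (intro conjI ballI)
  have sm: "smooth_on B g" using g by (simp add: constant_along_ruling_def)
  show smd: "smooth_on B (height_deriv g)" by (rule smooth_height_deriv[OF sm])
  fix u assume u: "u \<in> B"
  let ?d = "height_deriv g"
  note d = diff[OF smd u] diff[OF smooth_on_partial[OF smooth_height] u]
  have "partial i (partial j g) u = ?d u * partial i (partial j height) u + partial i ?d u * partial j height u" for i j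
    using partial_cong[OF open_B u partial_eq_height_deriv[OF g]] by (simp add: partial_rules d)
  from this[of 2 1] this[of 1 2]
  have 1: "partial 2 ?d u * partial 1 height u = partial 1 ?d u * partial 2 height u"
    using partial_commute[OF open_B sm u] partial_commute[OF open_B smooth_height u] by simp
  have 2: "w 2 u * partial 1 height u = w 1 u * partial 2 height u"
    using height_constant u by (simp add: constant_along_ruling_def)
  have "(w 2 u * partial 1 ?d u - w 1 u * partial 2 ?d u) * (partial 1 height u * w 1 u + partial 2 height u * w 2 u) = 0"
    using 1 2 by algebra
  then show "w 2 u * partial 1 ?d u = w 1 u * partial 2 ?d u"
    using transversal[OF u] by simp
qed

abbreviation "slope' \<equiv> height_deriv slope"
abbreviation "intercept' \<equiv> height_deriv intercept"
abbreviation "slope'' \<equiv> height_deriv slope'"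
abbreviation "intercept'' \<equiv> height_deriv intercept'"

lemmas constants = slope_constant intercept_constant height_constant
  height_deriv_constant[OF slope_constant] height_deriv_constant[OF intercept_constant]
  height_deriv_constant[OF height_deriv_constant[OF slope_constant]]
  height_deriv_constant[OF height_deriv_constant[OF intercept_constant]]

lemma constant_along_ruling_smooth: "constant_along_ruling g \<Longrightarrow> smooth_on B g"
  by (simp add: constant_along_ruling_def)

lemma jacobian_nonzero:
  assumes u: "u \<in> B"
  shows "partial 1 x u * partial 2 height u - partial 2 x u * partial 1 height u \<noteq> 0"
proof
  assume J: "partial 1 x u * partial 2 height u - partial 2 x u * partial 1 height u = 0"
  have "w 2 u * partial 1 height u = w 1 u * partial 2 height u"
    using height_constant u by (simp add: constant_along_ruling_def)
  then have "(partial 1 height u * w 1 u + partial 2 height u * w 2 u) * ruling_x u = 0"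
    using J unfolding ruling_x_def by algebra
  then show False using transversal[OF u] ruling_x_nz[OF u] by simp
qed

lemma partial_y:
  assumes u: "u \<in> B"
  shows "partial i y u = intercept' u * partial i height u + slope' u * partial i height u * x u + slope u * partial i x u"
proof -
  note d = diff[OF smooth_slope u] diff[OF smooth_intercept u] diff[OF smooth_xyz(1) u]
  have "partial i y u = partial i (\<lambda>u. intercept u + slope u * x u) u"
    using y_eq by (metis (no_types, lifting) ext)
  then show ?thesis
    by (simp add: partial_rules d partial_eq_height_deriv[OF slope_constant u]
        partial_eq_height_deriv[OF intercept_constant u])
qed

lemma partial_z:
  assumes u: "u \<in> B"
  shows "partial i z u = partial i height u - (intercept' u * partial i height u * x u + intercept u * partial i x u) / 2"
proof -
  note d = diff[OF smooth_height u] diff[OF smooth_intercept u] diff[OF smooth_xyz(1) u]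
  have "partial i z u = partial i (\<lambda>u. height u - intercept u * x u / 2) u"
    using z_eq by (metis (no_types, lifting) ext)
  then show ?thesis
    by (simp add: partial_rules partial_divide_const d partial_eq_height_deriv[OF intercept_constant u])
qed

text \<open>The tangent plane is vertical where this minor vanishes; on each ruling this happens at most once or everywhere.\<close>

lemma vertical_minor:
  assumes u: "u \<in> B"
  shows "partial 1 x u * partial 2 y u - partial 2 x u * partial 1 y u =
    (partial 1 x u * partial 2 height u - partial 2 x u * partial 1 height u) * (intercept' u + slope' u * x u)"
  unfolding partial_y[OF u] by (simp add: algebra_simps)

lemma ruling_polynomial:
  assumes u: "u \<in> B"
  defines "A \<equiv> slope' u + (intercept' u)\<^sup>2 / 2"
  shows "(2 * slope u * intercept' u * A - (1 + (slope u)\<^sup>2) * intercept'' u)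
    + (2 * slope u * slope' u * A - (1 + (slope u)\<^sup>2) * slope'' u) * x u
    + (1 + (slope u)\<^sup>2) * (intercept' u * slope'' u - slope' u * intercept'' u) / 2 * (x u * x u) = 0"
proof -
  note d = smooth_xyz[THEN diff, OF u] smooth_xyz[THEN smooth_on_partial, THEN diff, OF u]
    constants[THEN constant_along_ruling_smooth, THEN diff, OF u]
    constants[THEN constant_along_ruling_smooth, THEN smooth_on_partial, THEN diff, OF u]
  note pe = constants(1,2,4,5)[THEN partial_eq_height_deriv, OF u]
  have yy: "partial i (partial j y) u = intercept'' u * partial i height u * partial j height u
      + intercept' u * partial i (partial j height) u
      + slope'' u * partial i height u * partial j height u * x u
      + slope' u * partial i (partial j height) u * x u
      + slope' u * partial j height u * partial i x u + slope' u * partial i height u * partial j x u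
      + slope u * partial i (partial j x) u" for i j
    using partial_cong[OF open_B u partial_y] by (simp add: partial_rules d pe) (simp add: algebra_simps)
  have zz: "partial i (partial j z) u = partial i (partial j height) u
      - (intercept'' u * partial i height u * partial j height u * x u
      + intercept' u * partial i (partial j height) u * x u
      + intercept' u * partial j height u * partial i x u
      + intercept' u * partial i height u * partial j x u + intercept u * partial i (partial j x) u) / 2" for i j
    using partial_cong[OF open_B u partial_z]
    by (simp add: partial_rules partial_divide_const d pe) (simp add: field_simps)
  have E: "((partial 2 x u)\<^sup>2 + (partial 2 y u)\<^sup>2) * normal_acceleration x y z 1 1 u
        - 2 * (partial 1 x u * partial 2 x u + partial 1 y u * partial 2 y u) * normal_acceleration x y z 1 2 u
        + ((partial 1 x u)\<^sup>2 + (partial 1 y u)\<^sup>2) * normal_acceleration x y z 2 2 u = 0"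
    using chart u by (simp add: doubly_minimal_chart_def)
  show ?thesis
    unfolding A_def
    by (rule ruled_algebra[where m' = "\<lambda>i j. partial i (partial j height) u" and mm = "\<lambda>i. partial i height u"
        and x' = "\<lambda>i j. partial i (partial j x) u" and xx = "\<lambda>i. partial i x u",
        OF partial_y[OF u] partial_y[OF u] partial_z[OF u] partial_z[OF u] yy zz refl refl refl refl
        normal_acceleration_def E jacobian_nonzero[OF u]])
qed

text \<open>The coefficients in \<open>ruling_polynomial\<close> vanish separately, because they are constant along each ruling while \<open>x\<close> varies.\<close>

lemma ruling_equations:
  assumes u: "u \<in> B"
  shows "(1 + (slope u)\<^sup>2) * intercept'' u = 2 * slope u * intercept' u * (slope' u + (intercept' u)\<^sup>2 / 2)"
    and "(1 + (slope u)\<^sup>2) * slope'' u = 2 * slope u * slope' u * (slope' u + (intercept' u)\<^sup>2 / 2)"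
proof -
  define A where "A = (\<lambda>u. slope' u + (1/2) * (intercept' u * intercept' u))"
  define P where "P = (\<lambda>u. 1 + slope u * slope u)"
  define c0 where "c0 = (\<lambda>u. 2 * (slope u * (intercept' u * A u)) - P u * intercept'' u)"
  define c1 where "c1 = (\<lambda>u. 2 * (slope u * (slope' u * A u)) - P u * slope'' u)"
  define c2 where "c2 = (\<lambda>u. (1/2) * (P u * (intercept' u * slope'' u - slope' u * intercept'' u)))"
  have "constant_along_ruling c0" "constant_along_ruling c1" "constant_along_ruling c2"
    unfolding c0_def c1_def c2_def A_def P_def
    by (intro constant_along_ruling_add constant_along_ruling_diff constant_along_ruling_mult
        constant_along_ruling_const constants)+
  moreover have "c0 u + c1 u * x u + c2 u * (x u * x u) = 0" if "u \<in> B" for u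
    using ruling_polynomial[OF that]
    by (simp add: c0_def c1_def c2_def A_def P_def power2_eq_square mult.assoc)
  ultimately have "c0 u = 0" "c1 u = 0"
    using polynomial_in_x_zero u by blast+
  then show "(1 + (slope u)\<^sup>2) * intercept'' u = 2 * slope u * intercept' u * (slope' u + (intercept' u)\<^sup>2 / 2)"
    "(1 + (slope u)\<^sup>2) * slope'' u = 2 * slope u * slope' u * (slope' u + (intercept' u)\<^sup>2 / 2)"
    by (simp_all add: c0_def c1_def A_def P_def power2_eq_square mult.assoc)
qed

end

section \<open>Local classification\<close>

lemma linear_ode_zero:
  fixes g \<rho> :: "real \<Rightarrow> real"
  assumes g: "\<And>t. t \<in> {0..1} \<Longrightarrow> (g has_real_derivative \<rho> t * g t) (at t within {0..1})"
    and \<rho>: "continuous_on {0..1} \<rho>" and g0: "g 0 = 0" and t: "t \<in> {0..1}"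
  shows "g t = 0"
proof -
  \<comment> \<open>the integrating factor is \<open>exp (- P)\<close>\<close>
  obtain P where P: "\<And>t. t \<in> {0..1} \<Longrightarrow> (P has_vector_derivative \<rho> t) (at t within {0..1})"
    using antiderivative_continuous[OF \<rho>] by blast
  have "((\<lambda>t. g t * exp (- P t)) has_field_derivative 0) (at t within {0..1})" if "t \<in> {0..1}" for t
    using g[OF that] P[OF that] unfolding has_real_derivative_iff_has_vector_derivative[symmetric]
    by (auto intro!: derivative_eq_intros)
  then obtain c where c: "\<And>t. t \<in> {0..1} \<Longrightarrow> g t * exp (- P t) = c"
    using has_field_derivative_zero_constant[of "{0..1}" "\<lambda>t. g t * exp (- P t)"] by (metis convex_real_interval(5))
  have "c = 0" using c[of 0] g0 by simp
  then show ?thesis using c[OF t] by simp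
qed

definition minimal_model :: "(real^3) set \<Rightarrow> bool" where
  "minimal_model S \<longleftrightarrow> S = horizontal_plane \<or> S = vertical_plane \<or> (\<exists>c. c \<noteq> 0 \<and> S = helicoid c) \<or>
     S = hyperbolic_paraboloid"

context ruled_chart
begin

lemma constant_if_height_deriv_zero:
  assumes g: "constant_along_ruling g" and "convex B" "\<And>u. u \<in> B \<Longrightarrow> height_deriv g u = 0" "a \<in> B" "b \<in> B"
  shows "g a = g b"
  using assms constant_along_ruling_smooth[OF g]
  by (intro constant_if_partials_zero[of B g]) (auto simp: partial_eq_height_deriv[OF g] intro: diff)

text \<open>The differential equation is restricted to the segment from \<open>a\<close> to \<open>b\<close>.\<close>

lemma zero_if_linear_equation:
  assumes g: "constant_along_ruling g" and B: "convex B"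
    and eq: "\<And>u. u \<in> B \<Longrightarrow> height_deriv g u = \<psi> u * g u" and \<psi>: "continuous_on B \<psi>"
    and a: "a \<in> B" "g a = 0" and b: "b \<in> B"
  shows "g b = 0"
proof -
  define \<gamma> where "\<gamma> t = a + t *\<^sub>R (b - a)" for t :: real
  define v where "v = b - a"
  define \<rho> where "\<rho> t = \<psi> (\<gamma> t) * (v$1 * partial 1 height (\<gamma> t) + v$2 * partial 2 height (\<gamma> t))" for t
  have \<gamma>: "\<gamma> t \<in> B" if "t \<in> {0..1}" for t
    using convexD_alt[OF B a(1) b, of t] that by (simp add: \<gamma>_def algebra_simps)
  have "((\<lambda>t. g (\<gamma> t)) has_real_derivative \<rho> t * g (\<gamma> t)) (at t within {0..1})" if t: "t \<in> {0..1}" for t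
  proof -
    have 1: "(\<gamma> has_derivative (\<lambda>s. s *\<^sub>R v)) (at t)"
      unfolding \<gamma>_def v_def by (auto intro!: derivative_eq_intros)
    have 2: "(g has_derivative (\<lambda>v. v$1 * partial 1 g (\<gamma> t) + v$2 * partial 2 g (\<gamma> t))) (at (\<gamma> t))"
      by (rule has_derivative_partials[OF diff[OF constant_along_ruling_smooth[OF g] \<gamma>[OF t]]])
    have "((\<lambda>t. g (\<gamma> t)) has_derivative (\<lambda>s. (s *\<^sub>R v)$1 * partial 1 g (\<gamma> t) + (s *\<^sub>R v)$2 * partial 2 g (\<gamma> t))) (at t)"
      by (rule has_derivative_compose[OF 1 2])
    moreover have "(\<lambda>s. (s *\<^sub>R v)$1 * partial 1 g (\<gamma> t) + (s *\<^sub>R v)$2 * partial 2 g (\<gamma> t)) = (*) (\<rho> t * g (\<gamma> t))"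
      using eq[OF \<gamma>[OF t]] by (auto simp: partial_eq_height_deriv[OF g \<gamma>[OF t]] \<rho>_def algebra_simps)
    ultimately have "((\<lambda>t. g (\<gamma> t)) has_real_derivative \<rho> t * g (\<gamma> t)) (at t)"
      by (simp add: has_field_derivative_def)
    then show ?thesis by (rule has_field_derivative_at_within)
  qed
  moreover have "continuous_on {0..1} \<rho>"
  proof -
    have c: "continuous_on {0..1} \<gamma>" unfolding \<gamma>_def by (intro continuous_intros)
    have i: "\<gamma> ` {0..1} \<subseteq> B" using \<gamma> by blast
    have "continuous_on {0..1} (\<lambda>t. f (\<gamma> t))" if "continuous_on B f" for f :: "real^2 \<Rightarrow> real"
      by (rule continuous_on_compose2[OF that c i])
    note C = this
    show ?thesis
      unfolding \<rho>_def by (intro continuous_on_add continuous_on_mult continuous_on_const C[OF \<psi>]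
          C[OF smooth_on_continuous_on[OF smooth_on_partial[OF smooth_height]]])
  qed
  ultimately have "g (\<gamma> 1) = 0"
    using linear_ode_zero[of "\<lambda>t. g (\<gamma> t)" \<rho> 1] a by (simp add: \<gamma>_def)
  then show ?thesis by (simp add: \<gamma>_def)
qed

text \<open>At a vertical point the derivative of the intercept vanishes, and the equation for it is linear;
  so the intercept is constant, and the rulings rotate about the \<open>z\<close>-axis at a constant rate.\<close>

lemma vertical_point_normal_form:
  assumes B: "convex B" and u0: "u0 \<in> B" "x u0 = 0" "y u0 = 0" "z u0 = 0" "slope u0 = 0"
    and vert: "partial 1 x u0 * partial 2 y u0 = partial 2 x u0 * partial 1 y u0"
  obtains rate where "\<And>u. u \<in> B \<Longrightarrow> y u = x u * tan (rate * z u)" "\<And>u. u \<in> B \<Longrightarrow> \<bar>rate * z u\<bar> < pi / 2"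
    "\<And>u. u \<in> B \<Longrightarrow> partial 1 x u * partial 2 z u - partial 2 x u * partial 1 z u \<noteq> 0"
proof -
  have i0: "intercept u0 = 0" using u0 by (simp add: intercept_def)
  have "intercept' u0 = 0"
    using vertical_minor[OF u0(1)] jacobian_nonzero[OF u0(1)] vert u0 by simp
  have P: "1 + (slope u)\<^sup>2 \<noteq> 0" for u by (smt (verit) zero_le_power2)
  have I': "intercept' u = 0" if "u \<in> B" for u
  proof (rule zero_if_linear_equation[OF constants(5) B _ _ u0(1) \<open>intercept' u0 = 0\<close> that])
    define \<psi> where "\<psi> = (\<lambda>u. 2 * slope u * (slope' u + (intercept' u)\<^sup>2 / 2) / (1 + (slope u)\<^sup>2))"
    show "intercept'' u = \<psi> u * intercept' u" if "u \<in> B" for u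
      using ruling_equations(1)[OF that] P[of u] by (simp add: \<psi>_def eq_divide_eq mult_ac)
    show "continuous_on B \<psi>"
      unfolding \<psi>_def using P
      by (intro continuous_intros smooth_on_continuous_on constants[THEN constant_along_ruling_smooth]) auto
  qed
  have I: "intercept u = 0" if "u \<in> B" for u
    using constant_if_height_deriv_zero[OF constants(2) B I' that u0(1)] i0 by simp
  have y: "y u = slope u * x u" and h: "height u = z u" if "u \<in> B" for u
    using I[OF that] y_eq[of u] z_eq[of u] by auto
  \<comment> \<open>the derivative of \<open>arctan slope\<close> with respect to the height, which the equation for the slope makes constant\<close>
  define rate where "rate = slope' u0 / (1 + (slope u0)\<^sup>2)"
  have rate: "slope' u / (1 + (slope u)\<^sup>2) = rate" if "u \<in> B" for u
    unfolding rate_def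
  proof (rule constant_if_partials_zero[OF B _ _ _ that u0(1)])
    fix v assume v: "v \<in> B"
    note d = constants[THEN constant_along_ruling_smooth, THEN diff, OF v]
    show "(\<lambda>u. slope' u / (1 + (slope u)\<^sup>2)) differentiable (at v)"
      using P d by simp
    have e: "(1 + (slope v)\<^sup>2) * slope'' v = 2 * slope v * slope' v * slope' v"
      using ruling_equations(2)[OF v] I'[OF v] by simp
    have "partial i (\<lambda>u. slope' u / (1 + (slope u)\<^sup>2)) v = 0" for i
    proof -
      have "partial i (\<lambda>u. slope' u / (1 + slope u * slope u)) v =
        (partial i slope' v * (1 + slope v * slope v) - slope' v * (slope v * partial i slope v + partial i slope v * slope v))
          / (1 + slope v * slope v)\<^sup>2"
        using P[of v] d by (subst partial_divide) (auto simp: partial_rules power2_eq_square)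
      also have "partial i slope' v * (1 + slope v * slope v)
          - slope' v * (slope v * partial i slope v + partial i slope v * slope v)
        = partial i height v * ((1 + (slope v)\<^sup>2) * slope'' v - 2 * slope v * slope' v * slope' v)"
        unfolding partial_eq_height_deriv[OF constants(1) v] partial_eq_height_deriv[OF constants(4) v]
        by (simp add: power2_eq_square algebra_simps)
      finally show ?thesis unfolding e by (simp add: power2_eq_square)
    qed
    then show "partial 1 (\<lambda>u. slope' u / (1 + (slope u)\<^sup>2)) v = 0"
      "partial 2 (\<lambda>u. slope' u / (1 + (slope u)\<^sup>2)) v = 0" by auto
  qed
  have arc: "arctan (slope u) = rate * z u" if u: "u \<in> B" for u
  proof -
    have "arctan (slope u) - rate * height u = arctan (slope u0) - rate * height u0"
    proof (rule constant_if_partials_zero[OF B _ _ _ u u0(1)])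
      fix v assume v: "v \<in> B"
      note d = constants[THEN constant_along_ruling_smooth, THEN diff, OF v]
      have da: "(\<lambda>u. arctan (slope u)) differentiable (at v)"
        using has_derivative_compose[OF d(1)[unfolded frechet_derivative_works] DERIV_arctan[unfolded has_field_derivative_def]]
        by (auto simp: differentiable_def)
      then show "(\<lambda>u. arctan (slope u) - rate * height u) differentiable (at v)"
        using d by simp
      have "partial i (\<lambda>u. arctan (slope u)) v = rate * partial i height v" for i
        using partial_compose_real[OF d(1) DERIV_arctan] rate[OF v]
        by (simp add: partial_eq_height_deriv[OF constants(1) v] divide_inverse mult_ac)
      then have "partial i (\<lambda>u. arctan (slope u) - rate * height u) v = 0" for i
        using da d by (simp add: partial_rules)
      then show "partial 1 (\<lambda>u. arctan (slope u) - rate * height u) v = 0"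
        "partial 2 (\<lambda>u. arctan (slope u) - rate * height u) v = 0" by auto
    qed
    then show ?thesis using u0 h[OF u] h[OF u0(1)] by simp
  qed
  show ?thesis
  proof
    fix u assume u: "u \<in> B"
    show "y u = x u * tan (rate * z u)"
      unfolding arc[OF u, symmetric] tan_arctan by (simp add: y[OF u])
    show "\<bar>rate * z u\<bar> < pi / 2"
      unfolding arc[OF u, symmetric] using arctan_bounded[of "slope u"] by auto
    have "partial i z u = partial i height u" for i
      by (rule partial_cong[OF open_B u]) (simp add: h)
    then show "partial 1 x u * partial 2 z u - partial 2 x u * partial 1 z u \<noteq> 0"
      using jacobian_nonzero[OF u] by simp
  qed
qed

end

context ruled_chart
begin

text \<open>While the direction of the rulings varies, the ratio \<open>r\<close> of the derivatives of intercept and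
  slope is constant, which says that all rulings meet one vertical axis, over the point
  \<open>(- r, b0)\<close>; there the coordinate \<open>z\<close> of a ruling is, up to additive constants, \<open>C\<close> times its angle \<open>arctan slope\<close>.\<close>

lemma turning_normal_form:
  assumes V: "convex V" "V \<subseteq> B" "q \<in> V" and turn: "\<And>u. u \<in> V \<Longrightarrow> slope' u \<noteq> 0"
  obtains r b0 C z0 where "\<And>u. u \<in> V \<Longrightarrow> intercept u = r * slope u + b0"
    "\<And>u. u \<in> V \<Longrightarrow> height u + r\<^sup>2 / 2 * slope u = C * arctan (slope u) + z0"
proof -
  have P: "1 + (slope u)\<^sup>2 \<noteq> 0" for u by (smt (verit) zero_le_power2)
  have const: "g u = g q" if g: "\<And>u. u \<in> V \<Longrightarrow> g differentiable (at u)"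
      "\<And>u i. u \<in> V \<Longrightarrow> partial i g u = 0" and u: "u \<in> V" for g :: "real^2 \<Rightarrow> real" and u
    by (rule constant_if_partials_zero[OF V(1) g(1) g(2) g(2) u V(3)])
  have d: "slope differentiable (at u)" "intercept differentiable (at u)" "height differentiable (at u)"
    "slope' differentiable (at u)" "intercept' differentiable (at u)" if "u \<in> V" for u
    using that V(2) constants[THEN constant_along_ruling_smooth, THEN diff, of u] by auto
  have pe: "partial i slope u = slope' u * partial i height u" "partial i intercept u = intercept' u * partial i height u"
    "partial i slope' u = slope'' u * partial i height u" "partial i intercept' u = intercept'' u * partial i height u"
    if "u \<in> V" for u i
    using that V(2) constants(1,2,4,5)[THEN partial_eq_height_deriv, of u i] by auto
  define r where "r = intercept' q / slope' q"
  have "intercept' u / slope' u = r" if "u \<in> V" for u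
    unfolding r_def
  proof (rule const[OF _ _ that])
    fix u i assume u: "u \<in> V"
    show "(\<lambda>u. intercept' u / slope' u) differentiable (at u)"
      using d[OF u] turn[OF u] by simp
    have uB: "u \<in> B" using u V(2) by auto
    have "(1 + (slope u)\<^sup>2) * (intercept'' u * slope' u - intercept' u * slope'' u) = 0"
      using ruling_equations[OF uB] by algebra
    then have "intercept'' u * slope' u - intercept' u * slope'' u = 0"
      using P[of u] by simp
    then have "intercept'' u * partial i height u * slope' u - intercept' u * (slope'' u * partial i height u) = 0"
      by algebra
    then show "partial i (\<lambda>u. intercept' u / slope' u) u = 0"
      using d[OF u] turn[OF u] by (simp add: partial_divide pe[OF u])
  qed
  then have r: "intercept' u = r * slope' u" if "u \<in> V" for u
    using turn[OF that] that by (simp add: divide_eq_eq)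
  define b0 where "b0 = intercept q - r * slope q"
  have "intercept u - r * slope u = b0" if "u \<in> V" for u
    unfolding b0_def
    by (rule const[OF _ _ that]) (use d in \<open>auto simp: partial_rules pe r\<close>)
  then have I: "intercept u = r * slope u + b0" if "u \<in> V" for u
    using that by (simp add: algebra_simps)
  \<comment> \<open>the derivative of the height on the axis with respect to the angle \<open>arctan slope\<close>\<close>
  define C where "C = (1 / slope' q + r\<^sup>2 / 2) * (1 + slope q * slope q)"
  have C: "(1 / slope' u + r\<^sup>2 / 2) * (1 + slope u * slope u) = C" if "u \<in> V" for u
    unfolding C_def
  proof (rule const[OF _ _ that])
    fix u i assume u: "u \<in> V"
    have uB: "u \<in> B" using u V(2) by auto
    show "(\<lambda>u. (1 / slope' u + r\<^sup>2 / 2) * (1 + slope u * slope u)) differentiable (at u)"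
      using d[OF u] turn[OF u] by simp
    define k k1 m where "k = slope u" and "k1 = slope' u" and "m = partial i height u"
    have k1: "k1 \<noteq> 0" using turn[OF u] by (simp add: k1_def)
    have "(1 + k\<^sup>2) * slope'' u = 2 * k * k1 * (k1 + (r * k1)\<^sup>2 / 2)"
      using ruling_equations(2)[OF uB] by (simp add: k_def k1_def r[OF u])
    then have k2: "(1 + k * k) * slope'' u = k1\<^sup>2 * (2 * k + r\<^sup>2 * k * k1)"
      by (simp add: power2_eq_square field_simps)
    have "partial i (\<lambda>u. (1 / slope' u + r\<^sup>2 / 2) * (1 + slope u * slope u)) u
      = m * ((1 / k1 + r\<^sup>2 / 2) * (2 * k * k1) - (1 + k * k) * slope'' u / k1\<^sup>2)"
      using d[OF u] turn[OF u]
      by (simp add: partial_rules partial_divide pe[OF u] k_def k1_def m_def) (simp add: algebra_simps)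
    also have "\<dots> = 0"
      unfolding k2 using k1 by (simp add: field_simps)
    finally show "partial i (\<lambda>u. (1 / slope' u + r\<^sup>2 / 2) * (1 + slope u * slope u)) u = 0" .
  qed
  define z0 where "z0 = height q + r\<^sup>2 / 2 * slope q - C * arctan (slope q)"
  have "height u + r\<^sup>2 / 2 * slope u - C * arctan (slope u) = z0" if "u \<in> V" for u
    unfolding z0_def
  proof (rule const[OF _ _ that])
    fix u i assume u: "u \<in> V"
    have da: "(\<lambda>u. arctan (slope u)) differentiable (at u)"
      using has_derivative_compose[OF d(1)[OF u, unfolded frechet_derivative_works] DERIV_arctan[unfolded has_field_derivative_def]]
      by (auto simp: differentiable_def)
    show "(\<lambda>u. height u + r\<^sup>2 / 2 * slope u - C * arctan (slope u)) differentiable (at u)"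
      using d[OF u] da by simp
    have pa: "partial i (\<lambda>u. arctan (slope u)) u = inverse (1 + (slope u)\<^sup>2) * (slope' u * partial i height u)"
      using partial_compose_real[OF d(1)[OF u] DERIV_arctan] by (simp add: pe[OF u])
    have "C * (inverse (1 + (slope u)\<^sup>2) * slope' u) = (1 / slope' u + r\<^sup>2 / 2) * slope' u"
      unfolding C[OF u, symmetric] using P[of u] by (simp add: power2_eq_square)
    also have "\<dots> = 1 + r\<^sup>2 / 2 * slope' u"
      using turn[OF u] by (simp add: field_simps)
    finally have e: "C * (inverse (1 + (slope u)\<^sup>2) * slope' u) = 1 + r\<^sup>2 / 2 * slope' u" .
    have "partial i (\<lambda>u. height u + r\<^sup>2 / 2 * slope u - C * arctan (slope u)) u =
        partial i height u * (1 + r\<^sup>2 / 2 * slope' u - C * (inverse (1 + (slope u)\<^sup>2) * slope' u))"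
      using d[OF u] da pa by (simp add: partial_rules partial_divide_const pe[OF u]) (simp add: algebra_simps)
    then show "partial i (\<lambda>u. height u + r\<^sup>2 / 2 * slope u - C * arctan (slope u)) u = 0"
      unfolding e by simp
  qed
  then have Z: "height u + r\<^sup>2 / 2 * slope u = C * arctan (slope u) + z0" if "u \<in> V" for u
    using that by (simp add: algebra_simps)
  show ?thesis using that I Z by blast
qed

text \<open>If the slope is not constant, the rulings near some point rotate about a vertical axis at a constant rate \<open>1 / C\<close>, or, for
  \<open>C = 0\<close>, all pass through one point. If it is constant, the rulings are parallel in projection, and the derivative of the
  intercept is a constant \<open>b\<close>.\<close>

lemma local_classification:
  assumes B: "convex B" and u0: "u0 \<in> B" "x u0 = 0" "y u0 = 0" "z u0 = 0" "slope u0 = 0"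
  obtains V \<phi> S where "open V" "V \<noteq> {}" "V \<subseteq> B" "is_heis_motion \<phi>" "minimal_model S"
    "\<And>u. u \<in> V \<Longrightarrow> \<phi> (vector [x u, y u, z u]) \<in> S"
proof (cases "\<exists>q\<in>B. slope' q \<noteq> 0")
  case True
  then obtain q where q: "q \<in> B" "slope' q \<noteq> 0" by blast
  have "open {u \<in> B. slope' u \<noteq> 0}"
  proof -
    have "continuous_on B slope'"
      by (intro smooth_on_continuous_on constant_along_ruling_smooth constants)
    then have "open (B \<inter> slope' -` (- {0}))"
      by (intro continuous_open_preimage open_B) auto
    moreover have "{u \<in> B. slope' u \<noteq> 0} = B \<inter> slope' -` (- {0})" by auto
    ultimately show ?thesis by simp
  qed
  then obtain e where e: "e > 0" "ball q e \<subseteq> {u \<in> B. slope' u \<noteq> 0}"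
    using q unfolding open_contains_ball by blast
  define V where "V = ball q e"
  have V: "convex V" "V \<subseteq> B" "q \<in> V" and turn: "\<And>u. u \<in> V \<Longrightarrow> slope' u \<noteq> 0"
    using e by (auto simp: V_def)
  obtain r b0 C z0 where I: "\<And>u. u \<in> V \<Longrightarrow> intercept u = r * slope u + b0"
    and Z: "\<And>u. u \<in> V \<Longrightarrow> height u + r\<^sup>2 / 2 * slope u = C * arctan (slope u) + z0"
    using turning_normal_form[OF V turn] by blast
  \<comment> \<open>the left translation that moves the common axis of the rulings to the \<open>z\<close>-axis\<close>
  define \<phi> where "\<phi> = heis_motion 1 0 r (- b0) (- z0 - r * b0 / 2)"
  have \<phi>: "is_heis_motion \<phi>" unfolding \<phi>_def by (rule is_heis_motionI) simp
  have p: "\<phi> (vector [x u, y u, z u]) $ 2 = slope u * \<phi> (vector [x u, y u, z u]) $ 1"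
    "\<phi> (vector [x u, y u, z u]) $ 3 = C * arctan (slope u)" if u: "u \<in> V" for u
  proof -
    show "\<phi> (vector [x u, y u, z u]) $ 2 = slope u * \<phi> (vector [x u, y u, z u]) $ 1"
      by (simp add: \<phi>_def y_eq[of u] I[OF u] algebra_simps)
    have "\<phi> (vector [x u, y u, z u]) $ 3 = height u + r\<^sup>2 / 2 * slope u - z0"
      by (simp add: \<phi>_def y_eq[of u] z_eq[of u] I[OF u] power2_eq_square field_simps)
    then show "\<phi> (vector [x u, y u, z u]) $ 3 = C * arctan (slope u)" using Z[OF u] by simp
  qed
  show ?thesis
  proof (cases "C = 0")
    case True
    then show ?thesis
      using that[OF _ _ V(2) \<phi>, of horizontal_plane] p V(3)
      by (auto simp: V_def minimal_model_def horizontal_plane_def)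
  next
    case False
    have "\<phi> (vector [x u, y u, z u]) \<in> helicoid (1 / C)" if u: "u \<in> V" for u
      using False by (simp add: helicoid_def p[OF u] sin_arctan cos_arctan)
    moreover have "minimal_model (helicoid (1 / C))"
      unfolding minimal_model_def by (rule disjI2, rule disjI2, rule disjI1, rule exI[of _ "1 / C"]) (use False in simp)
    moreover have "open V" "V \<noteq> {}" using V(3) by (auto simp: V_def)
    ultimately show ?thesis
      using that V(2) \<phi> by blast
  qed
next
  case False
  then have s': "slope' u = 0" if "u \<in> B" for u using that by blast
  have s: "slope u = 0" if "u \<in> B" for u
    using constant_if_height_deriv_zero[OF constants(1) B s' that u0(1)] u0 by simp
  have P: "1 + (slope u)\<^sup>2 \<noteq> 0" for u by (smt (verit) zero_le_power2)
  have "intercept'' u = 0" if "u \<in> B" for u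
    using ruling_equations(1)[OF that] s[OF that] by simp
  then have b: "intercept' u = intercept' u0" if "u \<in> B" for u
    using constant_if_height_deriv_zero[OF constants(5) B _ that u0(1)] by simp
  define b where "b = intercept' u0"
  have i0: "intercept u0 = 0" "height u0 = 0" using u0 by (simp_all add: intercept_def height_def)
  have "intercept u - b * height u = intercept u0 - b * height u0" if u: "u \<in> B" for u
  proof (rule constant_if_partials_zero[OF B _ _ _ u u0(1)])
    fix v assume v: "v \<in> B"
    note d = constants(2,3)[THEN constant_along_ruling_smooth, THEN diff, OF v]
    show "(\<lambda>u. intercept u - b * height u) differentiable (at v)" using d by simp
    show "partial 1 (\<lambda>u. intercept u - b * height u) v = 0" "partial 2 (\<lambda>u. intercept u - b * height u) v = 0"
      using d by (simp_all add: partial_rules partial_eq_height_deriv[OF constants(2) v] b[OF v] b_def)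
  qed
  then have y: "y u = b * height u" if "u \<in> B" for u
    using i0 that y_eq[of u] s[OF that] by simp
  show ?thesis
  proof (cases "b = 0")
    case True
    then show ?thesis
      using that[OF open_B _ order_refl is_heis_motion_id, of vertical_plane] u0(1) y
      by (auto simp: minimal_model_def vertical_plane_def)
  next
    case False
    \<comment> \<open>here \<open>z = y / b - x y / 2\<close>, and the translation by \<open>- 1 / b\<close> in \<open>x\<close> removes the linear term\<close>
    define \<phi> where "\<phi> = heis_motion 1 0 (- 1 / b) 0 0"
    have \<phi>: "is_heis_motion \<phi>" unfolding \<phi>_def by (rule is_heis_motionI) simp
    have "\<phi> (vector [x u, y u, z u]) \<in> hyperbolic_paraboloid" if u: "u \<in> B" for u
    proof -
      have "intercept u = b * height u" using y[OF u] y_eq[of u] s[OF u] by simp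
      then show ?thesis
        using False by (simp add: \<phi>_def hyperbolic_paraboloid_def y[OF u] z_eq[of u] field_simps)
    qed
    then show ?thesis
      using that[OF open_B _ order_refl \<phi>, of hyperbolic_paraboloid] u0(1)
      by (auto simp: minimal_model_def)
  qed
qed

end

lemma doubly_minimal_chart_subset:
  assumes "doubly_minimal_chart U x y z" "V \<subseteq> U" "open V"
  shows "doubly_minimal_chart V x y z"
  using assms unfolding doubly_minimal_chart_def by (blast intro: smooth_on_subset)

lemma open_nonzero:
  fixes g :: "real^2 \<Rightarrow> real"
  assumes "open U" "smooth_on U g"
  shows "open {u \<in> U. g u \<noteq> 0}"
proof -
  have "open (U \<inter> g -` (- {0}))"
    by (intro continuous_open_preimage assms smooth_on_continuous_on) auto
  moreover have "{u \<in> U. g u \<noteq> 0} = U \<inter> g -` (- {0})" by auto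
  ultimately show ?thesis by simp
qed

text \<open>At the origin with the \<open>x\<close>-axis as ruling, intercept and \<open>x\<close> vanish, so that the differential of the height is that of \<open>z\<close>, which
  is the contact form there. Both nondegeneracy conditions hold at the point, hence on a disc around it.\<close>

lemma ruled_chart_around:
  assumes ch: "doubly_minimal_chart U x y z" and u0: "u0 \<in> U" "x u0 = 0" "y u0 = 0" "z u0 = 0"
    and ry: "contact_partial x y z 2 u0 * partial 1 y u0 = contact_partial x y z 1 u0 * partial 2 y u0"
    and rx: "contact_partial x y z 2 u0 * partial 1 x u0 - contact_partial x y z 1 u0 * partial 2 x u0 \<noteq> 0"
  obtains e where "e > 0" "ball u0 e \<subseteq> U" "ruled_chart (ball u0 e) x y z"
    "foliated_chart.slope x y z u0 = 0"
proof -
  have U: "open U" and sm: "smooth_on U x" "smooth_on U y" "smooth_on U z"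
    using ch by (auto simp: doubly_minimal_chart_def)
  define rul where "rul = (\<lambda>u. contact_partial x y z 2 u * partial 1 x u - contact_partial x y z 1 u * partial 2 x u)"
  define V where "V = {u \<in> U. rul u \<noteq> 0}"
  have smr: "smooth_on U rul"
    unfolding rul_def contact_partial_def by (intro smooth_intros U smooth_on_partial sm) auto
  have "rul u0 \<noteq> 0" using rx by (simp add: rul_def)
  then have V: "open V" "u0 \<in> V" "V \<subseteq> U"
    using open_nonzero[OF U smr] u0(1) by (auto simp: V_def)
  interpret foliated_chart V x y z
  proof
    show "doubly_minimal_chart V x y z" by (rule doubly_minimal_chart_subset[OF ch V(3,1)])
    show "contact_partial x y z 2 u * partial 1 x u - contact_partial x y z 1 u * partial 2 x u \<noteq> 0"
      if "u \<in> V" for u using that by (simp add: V_def rul_def)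
  qed
  have sl: "slope u0 = 0" using ry by (simp add: slope_def ruling_y_def)
  then have i0: "intercept u0 = 0" using u0 by (simp add: intercept_def)
  define tr where "tr = (\<lambda>u. partial 1 height u * w 1 u + partial 2 height u * w 2 u)"
  have str: "smooth_on V tr"
    unfolding tr_def by (intro smooth_intros open_B smooth_on_partial smooth_height smooth_w)
  have "partial i height u0 = w i u0" for i
  proof -
    note d = smooth_xyz[THEN smooth_on_differentiable, OF V(2)] smooth_intercept[THEN smooth_on_differentiable, OF V(2)]
    have "partial i height u0 = partial i z u0 + (intercept u0 * partial i x u0 + partial i intercept u0 * x u0) / 2"
      unfolding height_def[abs_def] by (simp add: partial_rules partial_divide_const d)
    then show ?thesis using i0 u0 by (simp add: contact_partial_def)
  qed
  moreover have "w 1 u0 \<noteq> 0 \<or> w 2 u0 \<noteq> 0" using rx by auto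
  ultimately have "tr u0 \<noteq> 0"
    by (simp add: tr_def sum_power2_eq_zero_iff[unfolded power2_eq_square])
  then have "u0 \<in> {u \<in> V. tr u \<noteq> 0}" using V(2) by simp
  then obtain e where e: "e > 0" "ball u0 e \<subseteq> {u \<in> V. tr u \<noteq> 0}"
    using open_nonzero[OF V(1) str] unfolding open_contains_ball by blast
  show ?thesis
  proof
    show "e > 0" "ball u0 e \<subseteq> U" "foliated_chart.slope x y z u0 = 0"
      using e V sl by auto
    have sub: "ball u0 e \<subseteq> V" using e by auto
    interpret b: foliated_chart "ball u0 e" x y z
    proof
      show "doubly_minimal_chart (ball u0 e) x y z"
        by (rule doubly_minimal_chart_subset[OF chart sub open_ball])
    qed (use ruling_x_nonzero sub in blast)
    show "ruled_chart (ball u0 e) x y z"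
    proof
      show "partial 1 b.height u * w 1 u + partial 2 b.height u * w 2 u \<noteq> 0" if "u \<in> ball u0 e" for u
        using that e(2) unfolding tr_def by blast
    qed
  qed
qed

text \<open>A noncharacteristic point is moved to the origin by a left translation, and its ruling to the \<open>x\<close>-axis by a rotation. If
  the projected horizontal tangent vector \<open>(p, q)\<close> vanished, the tangent vectors would be linearly dependent.\<close>

lemma ruled_chart_after_motion:
  assumes ch: "doubly_minimal_chart U x y z" and u0: "u0 \<in> U"
    and nonchar: "contact_partial x y z 1 u0 \<noteq> 0 \<or> contact_partial x y z 2 u0 \<noteq> 0"
  obtains c s a b d e X Y Z where "c\<^sup>2 + s\<^sup>2 = 1" "e > 0" "ball u0 e \<subseteq> U"
    "X = (\<lambda>u. c * x u - s * y u + a)" "Y = (\<lambda>u. s * x u + c * y u + b)"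
    "Z = (\<lambda>u. z u + (a * (s * x u + c * y u) - b * (c * x u - s * y u)) / 2 + d)"
    "ruled_chart (ball u0 e) X Y Z"
    "X u0 = 0" "Y u0 = 0" "Z u0 = 0" "foliated_chart.slope X Y Z u0 = 0"
proof -
  have U: "open U" and sm: "smooth_on U x" "smooth_on U y" "smooth_on U z"
    using ch by (auto simp: doubly_minimal_chart_def)
  note df = sm[THEN smooth_on_differentiable, OF u0]
  define w where "w i = contact_partial x y z i u0" for i
  define p q where "p = w 2 * partial 1 x u0 - w 1 * partial 2 x u0"
    and "q = w 2 * partial 1 y u0 - w 1 * partial 2 y u0"
  have pq: "p \<noteq> 0 \<or> q \<noteq> 0"
  proof (rule ccontr)
    assume "\<not> ?thesis"
    then have 0: "w 2 * partial 1 x u0 = w 1 * partial 2 x u0" "w 2 * partial 1 y u0 = w 1 * partial 2 y u0"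
      by (auto simp: p_def q_def)
    have 1: "2 * w i = 2 * partial i z u0 + (y u0 * partial i x u0 - x u0 * partial i y u0)" for i
      by (simp add: w_def contact_partial_def)
    have "2 * (w 2 * partial 1 z u0) = 2 * (w 1 * partial 2 z u0)"
      using 1[of 1] 1[of 2] 0 by algebra
    then have 2: "w 2 * partial 1 z u0 = w 1 * partial 2 z u0" by simp
    have "w 1 * (partial 1 y u0 * partial 2 z u0 - partial 1 z u0 * partial 2 y u0) = 0"
       "w 1 * (partial 1 z u0 * partial 2 x u0 - partial 1 x u0 * partial 2 z u0) = 0"
       "w 1 * (partial 1 x u0 * partial 2 y u0 - partial 1 y u0 * partial 2 x u0) = 0"
       "w 2 * (partial 1 y u0 * partial 2 z u0 - partial 1 z u0 * partial 2 y u0) = 0"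
       "w 2 * (partial 1 z u0 * partial 2 x u0 - partial 1 x u0 * partial 2 z u0) = 0"
       "w 2 * (partial 1 x u0 * partial 2 y u0 - partial 1 y u0 * partial 2 x u0) = 0"
      using 0 2 by algebra+
    then show False
      using ch u0 nonchar unfolding doubly_minimal_chart_def w_def by (metis mult_eq_0_iff)
  qed
  define \<rho> where "\<rho> = sqrt (p\<^sup>2 + q\<^sup>2)"
  have \<rho>: "\<rho> \<noteq> 0" "\<rho>\<^sup>2 = p\<^sup>2 + q\<^sup>2"
    using pq by (auto simp: \<rho>_def sum_power2_eq_zero_iff)
  define c s where "c = p / \<rho>" and "s = - q / \<rho>"
  have "c\<^sup>2 + s\<^sup>2 = (p\<^sup>2 + q\<^sup>2) / \<rho>\<^sup>2"
    by (simp add: c_def s_def power_divide add_divide_distrib)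
  then have cs: "c\<^sup>2 + s\<^sup>2 = 1" unfolding \<rho>(2)[symmetric] using \<rho>(1) by simp
  define a b d where "a = - (c * x u0 - s * y u0)" and "b = - (s * x u0 + c * y u0)" and "d = - z u0"
  define X Y Z where XYZ: "X = (\<lambda>u. c * x u - s * y u + a)" "Y = (\<lambda>u. s * x u + c * y u + b)"
    "Z = (\<lambda>u. z u + (a * (s * x u + c * y u) - b * (c * x u - s * y u)) / 2 + d)"
  have ch': "doubly_minimal_chart U X Y Z"
    unfolding XYZ by (rule doubly_minimal_chart_motion[OF ch cs])
  have w': "contact_partial X Y Z i u0 = w i" for i
    unfolding XYZ w_def by (rule contact_partial_motion[OF cs df])
  have X1: "partial i X u0 = c * partial i x u0 - s * partial i y u0" for i
    using partial_affine[OF df, of i c "-s" 0 a] by (simp add: XYZ)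
  have Y1: "partial i Y u0 = s * partial i x u0 + c * partial i y u0" for i
    using partial_affine[OF df, of i s c 0 b] by (simp add: XYZ)
  have zero: "X u0 = 0" "Y u0 = 0" "Z u0 = 0"
    by (simp_all add: XYZ a_def b_def d_def algebra_simps)
  have "w 2 * partial 1 Y u0 - w 1 * partial 2 Y u0 = s * p + c * q"
    "w 2 * partial 1 X u0 - w 1 * partial 2 X u0 = c * p - s * q"
    unfolding X1 Y1 p_def q_def by (simp_all add: algebra_simps)
  moreover have "s * p + c * q = 0" by (simp add: c_def s_def)
  moreover have "c * p - s * q = \<rho>\<^sup>2 / \<rho>"
    unfolding \<rho>(2) by (simp add: c_def s_def power2_eq_square add_divide_distrib)
  ultimately obtain e where "e > 0" "ball u0 e \<subseteq> U" "ruled_chart (ball u0 e) X Y Z" "foliated_chart.slope X Y Z u0 = 0"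
    using ruled_chart_around[OF ch' u0 zero] \<rho>(1) unfolding w' by auto
  then show ?thesis
    using that[OF cs _ _ XYZ] zero by blast
qed

section \<open>Unique continuation\<close>

text \<open>Analyticity is expressed by a holomorphic extension to a convex open set, which keeps the domains of sums and products connected.\<close>

definition real_analytic_on :: "real set \<Rightarrow> (real \<Rightarrow> real) \<Rightarrow> bool" where
  "real_analytic_on I g \<longleftrightarrow> (\<exists>D G. open D \<and> convex D \<and> complex_of_real ` I \<subseteq> D \<and> G holomorphic_on D \<and>
     (\<forall>t\<in>I. G (complex_of_real t) = complex_of_real (g t)))"

lemma real_analytic_onI:
  "open D \<Longrightarrow> convex D \<Longrightarrow> complex_of_real ` I \<subseteq> D \<Longrightarrow> G holomorphic_on D \<Longrightarrow>
    (\<And>t. t \<in> I \<Longrightarrow> G (complex_of_real t) = complex_of_real (g t)) \<Longrightarrow> real_analytic_on I g"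
  unfolding real_analytic_on_def by blast

lemma real_analytic_on_const: "real_analytic_on I (\<lambda>t. c)"
  by (rule real_analytic_onI[of UNIV _ "\<lambda>t. complex_of_real c"]) auto

lemma real_analytic_on_id: "real_analytic_on I (\<lambda>t. t)"
  by (rule real_analytic_onI[of UNIV _ "\<lambda>t. t"]) auto

lemma real_analytic_on_compose:
  assumes "real_analytic_on I g" "H holomorphic_on UNIV"
    and "\<And>t. H (complex_of_real t) = complex_of_real (h t)"
  shows "real_analytic_on I (\<lambda>t. h (g t))"
proof -
  obtain D G where D: "open D" "convex D" "complex_of_real ` I \<subseteq> D" "G holomorphic_on D"
    "\<And>t. t \<in> I \<Longrightarrow> G (complex_of_real t) = complex_of_real (g t)"
    using assms(1) unfolding real_analytic_on_def by blast
  show ?thesis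
  proof (rule real_analytic_onI[OF D(1-3)])
    show "(\<lambda>t. H (G t)) holomorphic_on D"
      using holomorphic_on_compose_gen[OF D(4) assms(2)] by (simp add: o_def)
  qed (use D(5) assms(3) in simp)
qed

lemma real_analytic_on_combine:
  assumes "real_analytic_on I f" "real_analytic_on I g"
    and "\<And>F G D. F holomorphic_on D \<Longrightarrow> G holomorphic_on D \<Longrightarrow> (\<lambda>t. P (F t) (G t)) holomorphic_on D"
    and "\<And>s t. P (complex_of_real s) (complex_of_real t) = complex_of_real (p s t)"
  shows "real_analytic_on I (\<lambda>t. p (f t) (g t))"
proof -
  obtain D F where D: "open D" "convex D" "complex_of_real ` I \<subseteq> D" "F holomorphic_on D"
    "\<And>t. t \<in> I \<Longrightarrow> F (complex_of_real t) = complex_of_real (f t)"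
    using assms(1) unfolding real_analytic_on_def by blast
  obtain E G where E: "open E" "convex E" "complex_of_real ` I \<subseteq> E" "G holomorphic_on E"
    "\<And>t. t \<in> I \<Longrightarrow> G (complex_of_real t) = complex_of_real (g t)"
    using assms(2) unfolding real_analytic_on_def by blast
  show ?thesis
  proof (rule real_analytic_onI[of "D \<inter> E" _ "\<lambda>t. P (F t) (G t)"])
    show "(\<lambda>t. P (F t) (G t)) holomorphic_on D \<inter> E"
      using D(4) E(4) by (intro assms(3)) (auto elim: holomorphic_on_subset)
  qed (use D E assms(4) in \<open>auto intro: convex_Int\<close>)
qed

lemma real_analytic_on_add:
  assumes "real_analytic_on I f" "real_analytic_on I g"
  shows "real_analytic_on I (\<lambda>t. f t + g t)"
  by (rule real_analytic_on_combine[OF assms, where P = "(+)" and p = "(+)"]) (auto intro: holomorphic_intros)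

lemma real_analytic_on_diff:
  assumes "real_analytic_on I f" "real_analytic_on I g"
  shows "real_analytic_on I (\<lambda>t. f t - g t)"
  by (rule real_analytic_on_combine[OF assms, where P = "(-)" and p = "(-)"]) (auto intro: holomorphic_intros)

lemma real_analytic_on_mult:
  assumes "real_analytic_on I f" "real_analytic_on I g"
  shows "real_analytic_on I (\<lambda>t. f t * g t)"
  by (rule real_analytic_on_combine[OF assms, where P = "(*)" and p = "(*)"]) (auto intro: holomorphic_intros)

lemma real_analytic_on_sin:
  assumes "real_analytic_on I f"
  shows "real_analytic_on I (\<lambda>t. sin (f t))"
  by (rule real_analytic_on_compose[OF assms, of sin]) (auto intro: holomorphic_intros simp: sin_of_real)

lemma real_analytic_on_cos:
  assumes "real_analytic_on I f"
  shows "real_analytic_on I (\<lambda>t. cos (f t))"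
  by (rule real_analytic_on_compose[OF assms, of cos]) (auto intro: holomorphic_intros simp: cos_of_real)

text \<open>The extension lives on the strip in which \<open>k * Re \<tau>\<close> stays between \<open>- pi / 2\<close> and \<open>pi / 2\<close>.\<close>

lemma real_analytic_on_tan:
  assumes "\<And>t. t \<in> I \<Longrightarrow> \<bar>k * t\<bar> < pi / 2"
  shows "real_analytic_on I (\<lambda>t. tan (k * t))"
proof -
  define D where "D = {\<tau>. - (pi / 2) < k * Re \<tau>} \<inter> {\<tau>. k * Re \<tau> < pi / 2}"
  have c: "cos (complex_of_real k * \<tau>) \<noteq> 0" if \<tau>: "\<tau> \<in> D" for \<tau>
  proof
    assume "cos (complex_of_real k * \<tau>) = 0"
    then obtain n :: int where "complex_of_real k * \<tau> = complex_of_real (n * pi) + of_real pi / 2"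
      unfolding cos_eq_0 by blast
    then have "Re (complex_of_real k * \<tau>) = Re (complex_of_real (n * pi + pi / 2))" by simp
    then have e: "k * Re \<tau> = n * pi + pi / 2" by simp
    have n: "n * pi + pi / 2 < pi / 2" "- (pi / 2) < n * pi + pi / 2"
      using \<tau> unfolding D_def e[symmetric] by auto
    show False
    proof (cases "n \<ge> 0")
      case True
      then have "0 \<le> real_of_int n * pi" by simp
      then show False using n by linarith
    next
      case False
      then have "real_of_int n \<le> - 1" by linarith
      then have "real_of_int n * pi \<le> - 1 * pi" by (rule mult_right_mono) simp
      then show False using n by linarith
    qed
  qed
  show ?thesis
  proof (rule real_analytic_onI[of D _ "\<lambda>\<tau>. tan (complex_of_real k * \<tau>)"])
    show "open D" unfolding D_def by (intro open_Int open_Collect_less continuous_intros)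
    have h: "{\<tau>. - (pi / 2) < k * Re \<tau>} = {\<tau>. inner (complex_of_real k) \<tau> > - (pi / 2)}"
      "{\<tau>. k * Re \<tau> < pi / 2} = {\<tau>. inner (complex_of_real k) \<tau> < pi / 2}"
      by (auto simp: inner_complex_def)
    show "convex D" unfolding D_def h by (intro convex_Int convex_halfspace_lt convex_halfspace_gt)
    show "complex_of_real ` I \<subseteq> D" using assms by (fastforce simp: D_def abs_less_iff)
    show "(\<lambda>\<tau>. tan (complex_of_real k * \<tau>)) holomorphic_on D"
      unfolding tan_def using c by (intro holomorphic_intros) auto
    show "tan (complex_of_real k * complex_of_real t) = complex_of_real (tan (k * t))" for t
      by (simp add: tan_def sin_of_real[symmetric] cos_of_real[symmetric] flip: of_real_mult)
  qed
qed

lemma real_analytic_on_vanish: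
  assumes g: "real_analytic_on I g" and J: "open J" "J \<noteq> {}" "J \<subseteq> I"
    and 0: "\<And>t. t \<in> J \<Longrightarrow> g t = 0" and t: "t \<in> I"
  shows "g t = 0"
proof -
  obtain D G where D: "open D" "convex D" "complex_of_real ` I \<subseteq> D" "G holomorphic_on D"
    "\<And>t. t \<in> I \<Longrightarrow> G (complex_of_real t) = complex_of_real (g t)"
    using g unfolding real_analytic_on_def by blast
  obtain s where s: "s \<in> J" using J by blast
  have lim: "complex_of_real s islimpt complex_of_real ` J"
    unfolding islimpt_approachable
  proof (intro allI impI)
    fix e :: real assume e: "e > 0"
    obtain d where d: "d > 0" "ball s d \<subseteq> J" using J(1) s open_contains_ball by blast
    define r where "r = s + min d e / 2"
    have "dist s r < d" "dist s r < e" "r \<noteq> s"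
      using d e by (auto simp: r_def dist_real_def min_def)
    moreover have "r \<in> J" using d(2) calculation(1) by auto
    ultimately have "complex_of_real r \<in> complex_of_real ` J" "complex_of_real r \<noteq> complex_of_real s"
      "dist (complex_of_real r) (complex_of_real s) < e"
      by (auto simp: dist_of_real dist_commute)
    then show "\<exists>x'\<in>complex_of_real ` J. x' \<noteq> complex_of_real s \<and> dist x' (complex_of_real s) < e" by blast
  qed
  have "G (complex_of_real t) = 0"
  proof (rule analytic_continuation[OF D(4,1) convex_connected[OF D(2)] _ _ lim])
    show "complex_of_real ` J \<subseteq> D" "complex_of_real s \<in> D" "complex_of_real t \<in> D"
      using D(3) J(3) s t by blast+
    show "G \<tau> = 0" if "\<tau> \<in> complex_of_real ` J" for \<tau>
      using that D(5) 0 J(3) by auto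
  qed
  then show ?thesis using D(5)[OF t] by simp
qed

text \<open>The zero set of a function whose restrictions to analytic curves are analytic. Restrictions to curves are all that unique
  continuation needs, and they avoid power series in several variables.\<close>

definition analytic_set :: "(real^3) set \<Rightarrow> bool" where
  "analytic_set S \<longleftrightarrow> (\<exists>F :: real^3 \<Rightarrow> real. S = {p. F p = 0} \<and>
     (\<forall>I g1 g2 g3. real_analytic_on I g1 \<longrightarrow> real_analytic_on I g2 \<longrightarrow> real_analytic_on I g3 \<longrightarrow>
        real_analytic_on I (\<lambda>t. F (vector [g1 t, g2 t, g3 t]))))"

lemmas real_analytic_intros = real_analytic_on_const real_analytic_on_add real_analytic_on_diff
  real_analytic_on_mult real_analytic_on_sin real_analytic_on_cos

lemma minimal_model_analytic:
  assumes "minimal_model S"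
  shows "analytic_set S"
proof -
  have I: "analytic_set {p. F p = 0}"
    if "\<And>I g1 g2 g3. real_analytic_on I g1 \<Longrightarrow> real_analytic_on I g2 \<Longrightarrow> real_analytic_on I g3 \<Longrightarrow>
        real_analytic_on I (\<lambda>t. F (vector [g1 t, g2 t, g3 t]))" for F
    unfolding analytic_set_def using that by blast
  have "analytic_set horizontal_plane"
    unfolding horizontal_plane_def by (rule I) simp
  moreover have "analytic_set vertical_plane"
    unfolding vertical_plane_def by (rule I) simp
  moreover have "analytic_set (helicoid c)" for c
  proof -
    have "helicoid c = {p. p$1 * sin (c * p$3) - p$2 * cos (c * p$3) = 0}"
      by (auto simp: helicoid_def)
    also have "analytic_set \<dots>" by (rule I) (simp, intro real_analytic_intros)
    finally show ?thesis .
  qed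
  moreover have "analytic_set hyperbolic_paraboloid"
  proof -
    have "hyperbolic_paraboloid = {p. p$3 + 1/2 * (p$1 * p$2) = 0}"
      by (auto simp: hyperbolic_paraboloid_def)
    also have "analytic_set \<dots>" by (rule I) (simp only: vector_3, intro real_analytic_intros)
    finally show ?thesis .
  qed
  ultimately show ?thesis using assms unfolding minimal_model_def by blast
qed

lemma analytic_set_motion:
  assumes S: "analytic_set S" and \<phi>: "is_heis_motion \<phi>"
  shows "analytic_set {p. \<phi> p \<in> S}"
proof -
  obtain F where F: "S = {p. F p = 0}" and
    FI: "\<And>I g1 g2 g3. real_analytic_on I g1 \<Longrightarrow> real_analytic_on I g2 \<Longrightarrow> real_analytic_on I g3 \<Longrightarrow>
        real_analytic_on I (\<lambda>t. F (vector [g1 t, g2 t, g3 t]))"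
    using S unfolding analytic_set_def by blast
  obtain c s a b d where \<phi>: "\<phi> = heis_motion c s a b d"
    using \<phi> by (auto simp: is_heis_motion_def)
  have an: "real_analytic_on I (\<lambda>t. F (\<phi> (vector [g1 t, g2 t, g3 t])))"
    if "real_analytic_on I g1" "real_analytic_on I g2" "real_analytic_on I g3" for I g1 g2 g3
  proof -
    have eq: "(\<lambda>t. F (\<phi> (vector [g1 t, g2 t, g3 t]))) = (\<lambda>t. F (vector [c * g1 t - s * g2 t + a, s * g1 t + c * g2 t + b,
        g3 t + (1/2) * (a * (s * g1 t + c * g2 t) - b * (c * g1 t - s * g2 t)) + d]))"
      by (simp add: \<phi> heis_motion_def)
    show ?thesis
      unfolding eq by (intro FI real_analytic_intros that)
  qed
  show ?thesis
    unfolding analytic_set_def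
  proof (rule exI[of _ "\<lambda>p. F (\<phi> p)"], intro conjI allI impI)
    show "{p. \<phi> p \<in> S} = {p. F (\<phi> p) = 0}" using F by auto
  qed (rule an)
qed

text \<open>A harmonic function \<open>Re H\<close> is analytic along every segment: \<open>(H(\<gamma> \<tau>) + cnj (H(\<gamma> (cnj \<tau>)))) / 2\<close> is a holomorphic extension of it
  to complex parameters. The identity theorem is applied on the segment from a point of \<open>W\<close> to \<open>\<zeta>\<close>.\<close>

lemma harmonic_graph_continuation:
  assumes S: "analytic_set S" and H: "H holomorphic_on ball \<zeta>0 r"
    and W: "open W" "W \<noteq> {}" "W \<subseteq> ball \<zeta>0 r" and WS: "\<And>\<zeta>. \<zeta> \<in> W \<Longrightarrow> vector [Re \<zeta>, Im \<zeta>, Re (H \<zeta>)] \<in> S"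
    and \<zeta>: "\<zeta> \<in> ball \<zeta>0 r"
  shows "vector [Re \<zeta>, Im \<zeta>, Re (H \<zeta>)] \<in> S"
proof -
  obtain F where F: "S = {p. F p = 0}" and
    FI: "\<And>I g1 g2 g3. real_analytic_on I g1 \<Longrightarrow> real_analytic_on I g2 \<Longrightarrow> real_analytic_on I g3 \<Longrightarrow>
        real_analytic_on I (\<lambda>t. F (vector [g1 t, g2 t, g3 t]))"
    using S unfolding analytic_set_def by blast
  obtain \<zeta>1 where \<zeta>1: "\<zeta>1 \<in> W" using W by blast
  define B where "B = ball \<zeta>0 r"
  define \<omega> where "\<omega> = \<zeta> - \<zeta>1"
  define \<gamma> where "\<gamma> \<tau> = \<zeta>1 + \<tau> * \<omega>" for \<tau>
  define D where "D = \<gamma> -` B \<inter> cnj -` (\<gamma> -` B)"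
  define I where "I = {t. complex_of_real t \<in> D}"
  have cont: "continuous_on UNIV \<gamma>" unfolding \<gamma>_def by (intro continuous_intros)
  have opB: "open (\<gamma> -` B)"
    using cont by (simp add: B_def open_vimage)
  have oD: "open D"
    unfolding D_def by (intro open_Int opB open_vimage) (intro continuous_intros)
  have convB: "convex (\<gamma> -` B)"
  proof (rule convexI)
    fix p q and u v :: real assume a: "p \<in> \<gamma> -` B" "q \<in> \<gamma> -` B" "0 \<le> u" "0 \<le> v" "u + v = 1"
    have "\<gamma> (u *\<^sub>R p + v *\<^sub>R q) = u *\<^sub>R \<gamma> p + v *\<^sub>R \<gamma> q"
    proof -
      have "\<zeta>1 = (u + v) *\<^sub>R \<zeta>1" using a by simp
      then show ?thesis by (simp add: \<gamma>_def algebra_simps)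
    qed
    moreover have "u *\<^sub>R \<gamma> p + v *\<^sub>R \<gamma> q \<in> B"
      using a convexD[of B "\<gamma> p" "\<gamma> q" u v] by (simp add: B_def)
    ultimately show "u *\<^sub>R p + v *\<^sub>R q \<in> \<gamma> -` B" by simp
  qed
  have cD: "convex D"
  proof -
    have "convex (cnj -` (\<gamma> -` B))"
      by (rule convex_linear_vimage[OF _ convB]) (simp add: bounded_linear.linear bounded_linear_cnj)
    then show ?thesis unfolding D_def by (intro convex_Int convB)
  qed
  have subI: "complex_of_real ` I \<subseteq> D" by (auto simp: I_def)
  have IB: "\<gamma> (complex_of_real t) \<in> B" if "t \<in> I" for t using that by (auto simp: I_def D_def)
  define K where "K \<tau> = H (\<gamma> \<tau>)" for \<tau>
  have K: "K holomorphic_on \<gamma> -` B"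
  proof -
    have 1: "\<gamma> holomorphic_on \<gamma> -` B"
      unfolding \<gamma>_def[abs_def] by (intro holomorphic_intros)
    have 2: "\<gamma> ` (\<gamma> -` B) \<subseteq> B" by auto
    have "K = H \<circ> \<gamma>" by (simp add: K_def fun_eq_iff)
    then show ?thesis
      using holomorphic_on_compose_gen[OF 1 H[folded B_def] 2] by simp
  qed
  have K': "(cnj \<circ> K \<circ> cnj) holomorphic_on (cnj -` (\<gamma> -` B))"
  proof (rule holomorphic_on_compose_cnj_cnj)
    have "cnj ` cnj -` (\<gamma> -` B) \<subseteq> \<gamma> -` B" by auto
    then show "K holomorphic_on cnj ` cnj -` (\<gamma> -` B)" by (rule holomorphic_on_subset[OF K])
    show "open (cnj -` (\<gamma> -` B))" by (intro opB open_vimage) (intro continuous_intros)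
  qed
  have g3: "real_analytic_on I (\<lambda>t. Re (K (complex_of_real t)))"
  proof (rule real_analytic_onI[OF oD cD subI])
    have k: "K holomorphic_on D" "(cnj \<circ> K \<circ> cnj) holomorphic_on D"
      using K K' by (auto simp: D_def elim: holomorphic_on_subset)
    show "(\<lambda>\<tau>. (K \<tau> + (cnj \<circ> K \<circ> cnj) \<tau>) / 2) holomorphic_on D"
      by (intro holomorphic_on_divide holomorphic_on_add holomorphic_on_const k) simp
    show "(K (complex_of_real t) + (cnj \<circ> K \<circ> cnj) (complex_of_real t)) / 2 = complex_of_real (Re (K (complex_of_real t)))" for t
      by (simp add: complex_add_cnj)
  qed
  have g1: "real_analytic_on I (\<lambda>t. Re \<zeta>1 + t * Re \<omega>)" and g2: "real_analytic_on I (\<lambda>t. Im \<zeta>1 + t * Im \<omega>)"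
    by (intro real_analytic_intros real_analytic_on_id)+
  define f where "f t = F (vector [Re (\<gamma> (complex_of_real t)), Im (\<gamma> (complex_of_real t)), Re (H (\<gamma> (complex_of_real t)))])" for t :: real
  have f: "real_analytic_on I f"
    using FI[OF g1 g2 g3] by (simp add: f_def[abs_def] \<gamma>_def K_def)
  define J where "J = {t. \<gamma> (complex_of_real t) \<in> W}"
  have "open ((\<lambda>t. \<gamma> (complex_of_real t)) -` W)"
    by (intro open_vimage W) (auto simp: \<gamma>_def intro!: continuous_intros)
  then have oJ: "open J" by (simp add: J_def vimage_def)
  have JI: "J \<subseteq> I" using W by (auto simp: J_def I_def D_def B_def)
  have "0 \<in> J" using \<zeta>1 by (simp add: J_def \<gamma>_def)
  moreover have "1 \<in> I" using \<zeta> by (simp add: I_def D_def B_def \<gamma>_def \<omega>_def)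
  moreover have "f t = 0" if "t \<in> J" for t
    using WS[of "\<gamma> (complex_of_real t)"] that F by (simp add: f_def J_def)
  ultimately have "f 1 = 0"
    using real_analytic_on_vanish[OF f oJ _ JI] by blast
  then show ?thesis
    using F by (simp add: f_def \<gamma>_def \<omega>_def)
qed

text \<open>Two functions with independent differentials can be used as coordinates near \<open>u0\<close>. The inverse \<open>g\<close> is defined on a complex disc, so
  that differentiability in the new coordinates can be turned into complex differentiability.\<close>

lemma plane_inverse:
  fixes p q :: "real^2 \<Rightarrow> real"
  assumes U: "open U" and sm: "smooth_on U p" "smooth_on U q" and u0: "u0 \<in> U"
    and J: "partial 1 p u0 * partial 2 q u0 - partial 2 p u0 * partial 1 q u0 \<noteq> 0"
  obtains r g where "r > 0" "continuous_on (ball (Complex (p u0) (q u0)) r) g"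
    "open (g ` ball (Complex (p u0) (q u0)) r)" "u0 \<in> g ` ball (Complex (p u0) (q u0)) r"
    "\<And>\<zeta>. \<zeta> \<in> ball (Complex (p u0) (q u0)) r \<Longrightarrow> g \<zeta> \<in> U \<and> p (g \<zeta>) = Re \<zeta> \<and> q (g \<zeta>) = Im \<zeta>"
    "\<forall>\<zeta>\<in>ball (Complex (p u0) (q u0)) r. \<forall>f a b. f differentiable (at (g \<zeta>)) \<longrightarrow>
        (\<forall>i. partial i f (g \<zeta>) = a * partial i p (g \<zeta>) + b * partial i q (g \<zeta>)) \<longrightarrow>
        ((\<lambda>\<zeta>. f (g \<zeta>)) has_derivative (\<lambda>h. a * Re h + b * Im h)) (at \<zeta>)"
proof -
  define L where "L a b c d = Blinfun (\<lambda>h :: real^2. vector [h$1 * a + h$2 * b, h$1 * c + h$2 * d] :: real^2)"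
    for a b c d :: real
  have L: "blinfun_apply (L a b c d) = (\<lambda>h. vector [h$1 * a + h$2 * b, h$1 * c + h$2 * d])" for a b c d
    unfolding L_def
    by (rule bounded_linear_Blinfun_apply)
      (auto simp: linear_conv_bounded_linear[symmetric] vec_eq_iff forall_2 algebra_simps intro!: linearI)
  define F where "F u = (vector [p u, q u] :: real^2)" for u
  define F' where "F' u = L (partial 1 p u) (partial 2 p u) (partial 1 q u) (partial 2 q u)" for u
  have F: "(F has_derivative blinfun_apply (F' u)) (at u)" if u: "u \<in> U" for u
  proof -
    note d = sm[THEN smooth_on_differentiable, OF u, THEN has_derivative_partials]
    have "(F has_derivative (\<lambda>h. vector [h$1 * partial 1 p u + h$2 * partial 2 p u, h$1 * partial 1 q u + h$2 * partial 2 q u])) (at u)"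
      unfolding has_derivative_componentwise_within[of F]
      using d by (auto simp: F_def Basis_vec_def inner_axis forall_2 UNIV_2)
    then show ?thesis by (simp add: F'_def L)
  qed
  have contF': "continuous_on U F'"
  proof (rule continuous_on_blinfun_componentwise)
    fix i :: "real^2"
    have c: "continuous_on U (partial j p)" "continuous_on U (partial j q)" for j
      by (intro smooth_on_continuous_on smooth_on_partial sm)+
    have "continuous_on U (\<lambda>u. \<chi> j::2. if j = 1 then i$1 * partial 1 p u + i$2 * partial 2 p u else i$1 * partial 1 q u + i$2 * partial 2 q u)"
    proof (rule continuous_on_vec_lambda)
      fix j :: 2
      show "continuous_on U (\<lambda>u. if j = 1 then i$1 * partial 1 p u + i$2 * partial 2 p u else i$1 * partial 1 q u + i$2 * partial 2 q u)"
        by (cases "j = 1") (auto intro!: continuous_on_add continuous_on_mult continuous_on_const c)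
    qed
    moreover have "(\<lambda>u. blinfun_apply (F' u) i) = (\<lambda>u. \<chi> j::2. if j = 1 then i$1 * partial 1 p u + i$2 * partial 2 p u else i$1 * partial 1 q u + i$2 * partial 2 q u)"
      by (auto simp: F'_def L vec_eq_iff forall_2)
    ultimately show "continuous_on U (\<lambda>u. blinfun_apply (F' u) i)" by (simp only:)
  qed
  define j where "j = partial 1 p u0 * partial 2 q u0 - partial 2 p u0 * partial 1 q u0"
  have j: "j \<noteq> 0" using J by (simp add: j_def)
  have inv: "L (partial 2 q u0 / j) (- partial 2 p u0 / j) (- partial 1 q u0 / j) (partial 1 p u0 / j) o\<^sub>L F' u0 = id_blinfun"
  proof (rule blinfun_eqI)
    fix h :: "real^2"
    have 1: "(h$1 * partial 1 p u0 + h$2 * partial 2 p u0) * (partial 2 q u0 / j) + (h$1 * partial 1 q u0 + h$2 * partial 2 q u0) * (- partial 2 p u0 / j) = h$1 * j / j"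
      and 2: "(h$1 * partial 1 p u0 + h$2 * partial 2 p u0) * (- partial 1 q u0 / j) + (h$1 * partial 1 q u0 + h$2 * partial 2 q u0) * (partial 1 p u0 / j) = h$2 * j / j"
      using j by (simp_all add: field_simps) (simp_all add: j_def algebra_simps)
    show "blinfun_apply (L (partial 2 q u0 / j) (- partial 2 p u0 / j) (- partial 1 q u0 / j) (partial 1 p u0 / j) o\<^sub>L F' u0) h
       = blinfun_apply id_blinfun h"
      using 1 2 j by (simp add: F'_def L vec_eq_iff forall_2)
  qed
  obtain U' V G G' where IFT: "open U'" "U' \<subseteq> U" "u0 \<in> U'" "open V" "F u0 \<in> V" "homeomorphism U' V F G"
    and G: "\<And>y. y \<in> V \<Longrightarrow> (G has_derivative (G' y)) (at y)"
    and G': "\<And>y. y \<in> V \<Longrightarrow> G' y = inv (blinfun_apply (F' (G y)))"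
    and bij: "\<And>y. y \<in> V \<Longrightarrow> bij (blinfun_apply (F' (G y)))"
    by (rule inverse_function_theorem[OF U F contF' u0 inv]) blast+
  have hom: "G y \<in> U'" "F (G y) = y" if "y \<in> V" for y
    using IFT(6) that by (auto simp: homeomorphism_def)
  have hom': "G (F u) = u" if "u \<in> U'" for u
    using IFT(6) that by (auto simp: homeomorphism_def)
  define \<kappa> where "\<kappa> \<zeta> = (vector [Re \<zeta>, Im \<zeta>] :: real^2)" for \<zeta>
  have \<kappa>: "bounded_linear \<kappa>"
    unfolding linear_conv_bounded_linear[symmetric] \<kappa>_def
    by (rule linearI) (auto simp: vec_eq_iff forall_2)
  have "open (\<kappa> -` V)"
    using IFT(4) \<kappa> by (intro open_vimage) (auto intro: linear_continuous_on)
  moreover define \<zeta>0 where "\<zeta>0 = Complex (p u0) (q u0)"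
  moreover have F\<kappa>: "F u = \<kappa> (Complex (p u) (q u))" for u by (simp add: F_def \<kappa>_def)
  ultimately obtain r where r: "r > 0" "ball \<zeta>0 r \<subseteq> \<kappa> -` V"
    using IFT(5) by (metis open_contains_ball vimageI)
  define g where "g \<zeta> = G (\<kappa> \<zeta>)" for \<zeta>
  have V: "\<kappa> \<zeta> \<in> V" if "\<zeta> \<in> ball \<zeta>0 r" for \<zeta> using r that by auto
  have g: "g \<zeta> \<in> U" "p (g \<zeta>) = Re \<zeta>" "q (g \<zeta>) = Im \<zeta>" if "\<zeta> \<in> ball \<zeta>0 r" for \<zeta>
  proof -
    have "vector [p (g \<zeta>), q (g \<zeta>)] = (vector [Re \<zeta>, Im \<zeta>] :: real^2)"
      using hom(2)[OF V[OF that]] by (simp add: F_def g_def \<kappa>_def)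
    then show "p (g \<zeta>) = Re \<zeta>" "q (g \<zeta>) = Im \<zeta>" by (simp_all add: vec_eq_iff forall_2)
    show "g \<zeta> \<in> U" using hom(1)[OF V[OF that]] IFT(2) by (auto simp: g_def)
  qed
  have gder: "(g has_derivative (\<lambda>h. G' (\<kappa> \<zeta>) (\<kappa> h))) (at \<zeta>)" if "\<zeta> \<in> ball \<zeta>0 r" for \<zeta>
    unfolding g_def
    using has_derivative_compose[OF bounded_linear_imp_has_derivative[OF \<kappa>] G[OF V[OF that]]] .
  show ?thesis
  proof (rule that[OF r(1)]; unfold \<zeta>0_def[symmetric])
    show "continuous_on (ball \<zeta>0 r) g"
      using gder has_derivative_continuous continuous_at_imp_continuous_on by blast
    have "g ` ball \<zeta>0 r = {u \<in> U'. Complex (p u) (q u) \<in> ball \<zeta>0 r}"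
    proof (intro equalityI subsetI)
      fix u assume "u \<in> g ` ball \<zeta>0 r"
      then obtain \<zeta> where \<zeta>: "u = g \<zeta>" "\<zeta> \<in> ball \<zeta>0 r" by blast
      then have "Complex (p u) (q u) = \<zeta>" using g[OF \<zeta>(2)] by (simp add: complex_eq_iff)
      then show "u \<in> {u \<in> U'. Complex (p u) (q u) \<in> ball \<zeta>0 r}"
        using \<zeta> hom(1)[OF V[OF \<zeta>(2)]] by (simp add: g_def)
    next
      fix u assume "u \<in> {u \<in> U'. Complex (p u) (q u) \<in> ball \<zeta>0 r}"
      then have u: "u \<in> U'" "Complex (p u) (q u) \<in> ball \<zeta>0 r" by auto
      then have "u = g (Complex (p u) (q u))" using hom' F\<kappa> by (simp add: g_def)
      then show "u \<in> g ` ball \<zeta>0 r" using u by blast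
    qed
    moreover have "open {u \<in> U'. Complex (p u) (q u) \<in> ball \<zeta>0 r}"
    proof -
      have "continuous_on U' (\<lambda>u. Complex (p u) (q u))"
        unfolding Complex_eq
        by (intro continuous_intros smooth_on_continuous_on smooth_on_subset[OF _ IFT(2)] sm)
      then have "open (U' \<inter> (\<lambda>u. Complex (p u) (q u)) -` ball \<zeta>0 r)"
        using IFT(1) by (intro continuous_open_preimage) auto
      then show ?thesis by (simp add: Int_def vimage_def)
    qed
    ultimately show "open (g ` ball \<zeta>0 r)" by simp
    have "g \<zeta>0 = u0" using hom'[OF IFT(3)] F\<kappa> by (simp add: g_def \<zeta>0_def)
    then show "u0 \<in> g ` ball \<zeta>0 r" using r(1) by force
    show "g \<zeta> \<in> U \<and> p (g \<zeta>) = Re \<zeta> \<and> q (g \<zeta>) = Im \<zeta>" if "\<zeta> \<in> ball \<zeta>0 r" for \<zeta>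
      using g[OF that] by blast
    show "\<forall>\<zeta>\<in>ball \<zeta>0 r. \<forall>f a b. f differentiable (at (g \<zeta>)) \<longrightarrow>
        (\<forall>i. partial i f (g \<zeta>) = a * partial i p (g \<zeta>) + b * partial i q (g \<zeta>)) \<longrightarrow>
        ((\<lambda>\<zeta>. f (g \<zeta>)) has_derivative (\<lambda>h. a * Re h + b * Im h)) (at \<zeta>)"
    proof (intro ballI allI impI)
      fix \<zeta> f a b assume \<zeta>: "\<zeta> \<in> ball \<zeta>0 r" and fd: "f differentiable (at (g \<zeta>))"
        and pf: "\<forall>i. partial i f (g \<zeta>) = a * partial i p (g \<zeta>) + b * partial i q (g \<zeta>)"
      have surj: "surj (blinfun_apply (F' (g \<zeta>)))" using bij[OF V[OF \<zeta>]] by (simp add: g_def bij_def)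
      have "((\<lambda>\<zeta>. f (g \<zeta>)) has_derivative (\<lambda>h. (G' (\<kappa> \<zeta>) (\<kappa> h))$1 * partial 1 f (g \<zeta>) + (G' (\<kappa> \<zeta>) (\<kappa> h))$2 * partial 2 f (g \<zeta>))) (at \<zeta>)"
        by (rule has_derivative_compose[OF gder[OF \<zeta>] has_derivative_partials[OF fd]])
      moreover have "(G' (\<kappa> \<zeta>) (\<kappa> h))$1 * partial 1 f (g \<zeta>) + (G' (\<kappa> \<zeta>) (\<kappa> h))$2 * partial 2 f (g \<zeta>) = a * Re h + b * Im h" for h
      proof -
        define v where "v = G' (\<kappa> \<zeta>) (\<kappa> h)"
        have "blinfun_apply (F' (g \<zeta>)) v = \<kappa> h"
          using surj unfolding v_def G'[OF V[OF \<zeta>]] g_def[symmetric] by (simp add: surj_f_inv_f)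
        then have e: "v$1 * partial 1 p (g \<zeta>) + v$2 * partial 2 p (g \<zeta>) = Re h" "v$1 * partial 1 q (g \<zeta>) + v$2 * partial 2 q (g \<zeta>) = Im h"
          by (simp_all add: F'_def L vec_eq_iff forall_2 \<kappa>_def)
        show ?thesis unfolding pf[rule_format] v_def[symmetric] e[symmetric] by (simp add: algebra_simps)
      qed
      ultimately show "((\<lambda>\<zeta>. f (g \<zeta>)) has_derivative (\<lambda>h. a * Re h + b * Im h)) (at \<zeta>)" by simp
    qed
  qed
qed

text \<open>The property that makes containment in an analytic set propagate from any open part of \<open>V\<close> to \<open>V\<close>.\<close>

definition continuation_nbhd :: "(real^2 \<Rightarrow> real^3) \<Rightarrow> (real^2) set \<Rightarrow> bool" where
  "continuation_nbhd P V \<longleftrightarrow> open V \<and> (\<forall>S W. analytic_set S \<longrightarrow> open W \<longrightarrow> W \<noteq> {} \<longrightarrow> W \<subseteq> V \<longrightarrow>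
     (\<forall>u\<in>W. P u \<in> S) \<longrightarrow> (\<forall>u\<in>V. P u \<in> S))"

lemma continuation_nbhdI:
  assumes "open V"
    and "\<And>S W u. analytic_set S \<Longrightarrow> open W \<Longrightarrow> W \<noteq> {} \<Longrightarrow> W \<subseteq> V \<Longrightarrow> (\<And>v. v \<in> W \<Longrightarrow> P v \<in> S) \<Longrightarrow> u \<in> V \<Longrightarrow> P u \<in> S"
  shows "continuation_nbhd P V"
  unfolding continuation_nbhd_def using assms by blast

text \<open>The second equation for a graph: \<open>a\<close>, \<open>b\<close> are the partial derivatives of \<open>z\<close> with respect to \<open>x\<close>, \<open>y\<close>, and \<open>p\<close>, \<open>q\<close>, \<open>s\<close>
  those of second order, so that the conclusion is Laplace's equation.\<close>

lemma graph_algebra: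
  fixes a b x1 x2 y1 y2 :: real
  assumes z1: "z1 = a * x1 + b * y1" and z2: "z2 = a * x2 + b * y2"
    and z11: "z11 = (p * x1 + q * y1) * x1 + a * x11 + ((q * x1 + s * y1) * y1 + b * y11)"
    and z12: "z12 = (p * x1 + q * y1) * x2 + a * x12 + ((q * x1 + s * y1) * y2 + b * y12)"
    and z22: "z22 = (p * x2 + q * y2) * x2 + a * x22 + ((q * x2 + s * y2) * y2 + b * y22)"
    and h11: "h11 = (y1 * z2 - z1 * y2) * x11 + (z1 * x2 - x1 * z2) * y11 + (x1 * y2 - y1 * x2) * z11"
    and h12: "h12 = (y1 * z2 - z1 * y2) * x12 + (z1 * x2 - x1 * z2) * y12 + (x1 * y2 - y1 * x2) * z12"
    and h22: "h22 = (y1 * z2 - z1 * y2) * x22 + (z1 * x2 - x1 * z2) * y22 + (x1 * y2 - y1 * x2) * z22"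
    and E: "(x2\<^sup>2 + y2\<^sup>2) * h11 - 2 * (x1 * x2 + y1 * y2) * h12 + (x1\<^sup>2 + y1\<^sup>2) * h22 = 0"
    and J: "x1 * y2 - x2 * y1 \<noteq> 0"
  shows "p + s = 0"
proof -
  define j where "j = x1 * y2 - y1 * x2"
  have n: "y1 * z2 - z1 * y2 = - a * j" "z1 * x2 - x1 * z2 = - b * j"
    unfolding z1 z2 j_def by (simp_all add: algebra_simps)
  have h: "h11 = j * (p * x1 * x1 + 2 * q * x1 * y1 + s * y1 * y1)"
    "h12 = j * (p * x1 * x2 + q * (x1 * y2 + x2 * y1) + s * y1 * y2)"
    "h22 = j * (p * x2 * x2 + 2 * q * x2 * y2 + s * y2 * y2)"
    unfolding h11 h12 h22 n j_def[symmetric] z11 z12 z22 by (simp_all add: algebra_simps)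
  have "(x2\<^sup>2 + y2\<^sup>2) * h11 - 2 * (x1 * x2 + y1 * y2) * h12 + (x1\<^sup>2 + y1\<^sup>2) * h22 = j * j * j * (p + s)"
    unfolding h j_def power2_eq_square by (simp add: algebra_simps)
  then show ?thesis using E J by (simp add: j_def mult.commute)
qed

text \<open>Where the tangent plane is not vertical, the surface is a graph over the \<open>(x, y)\<close>-plane. With \<open>a\<close>, \<open>b\<close> the partial derivatives of \<open>z\<close>
  with respect to \<open>x\<close> and \<open>y\<close>, the second equation and the symmetry of second derivatives are the Cauchy--Riemann equations for
  \<open>a - i b\<close>; a primitive \<open>H\<close> of this holomorphic function has real part \<open>z\<close> up to a constant.\<close>

lemma graph_continuation:
  assumes ch: "doubly_minimal_chart U x y z" and u0: "u0 \<in> U"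
    and J0: "partial 1 x u0 * partial 2 y u0 - partial 2 x u0 * partial 1 y u0 \<noteq> 0"
  obtains V where "u0 \<in> V" "V \<subseteq> U" "continuation_nbhd (\<lambda>u. vector [x u, y u, z u]) V"
proof -
  have U: "open U" and sm: "smooth_on U x" "smooth_on U y" "smooth_on U z"
    using ch by (auto simp: doubly_minimal_chart_def)
  define J where "J u = partial 1 x u * partial 2 y u - partial 2 x u * partial 1 y u" for u
  define U0 where "U0 = {u \<in> U. J u \<noteq> 0}"
  have smJ: "smooth_on U J"
    unfolding J_def[abs_def] by (intro smooth_on_diff smooth_on_mult U smooth_on_partial sm)
  then have U0: "open U0" "u0 \<in> U0" "U0 \<subseteq> U" and J: "\<And>u. u \<in> U0 \<Longrightarrow> J u \<noteq> 0"
    using open_nonzero[OF U, of J] u0 J0 by (auto simp: U0_def J_def)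
  have smJ0: "smooth_on U0 J" by (rule smooth_on_subset[OF smJ U0(3)])
  have sm0: "smooth_on U0 x" "smooth_on U0 y" "smooth_on U0 z"
    using sm U0(3) by (auto intro: smooth_on_subset)
  \<comment> \<open>the derivatives of \<open>f\<close> with respect to \<open>x\<close> and \<open>y\<close> as coordinates, by Cramer's rule\<close>
  define A B where "A f u = (partial 1 f u * partial 2 y u - partial 2 f u * partial 1 y u) / J u"
    and "B f u = (partial 1 x u * partial 2 f u - partial 2 x u * partial 1 f u) / J u"
    for f :: "real^2 \<Rightarrow> real" and u
  have pAB: "partial i f u = A f u * partial i x u + B f u * partial i y u" if u: "u \<in> U0" for f i u
  proof -
    have "J u * partial 1 f u = (partial 1 f u * partial 2 y u - partial 2 f u * partial 1 y u) * partial 1 x u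
      + (partial 1 x u * partial 2 f u - partial 2 x u * partial 1 f u) * partial 1 y u"
      "J u * partial 2 f u = (partial 1 f u * partial 2 y u - partial 2 f u * partial 1 y u) * partial 2 x u
      + (partial 1 x u * partial 2 f u - partial 2 x u * partial 1 f u) * partial 2 y u"
      by (simp_all add: J_def algebra_simps)
    then have "partial i f u = ((partial 1 f u * partial 2 y u - partial 2 f u * partial 1 y u) * partial i x u
      + (partial 1 x u * partial 2 f u - partial 2 x u * partial 1 f u) * partial i y u) / J u"
      using J[OF u] exhaust_2[of i] by (auto simp: eq_divide_eq mult.commute)
    then show ?thesis by (simp add: A_def B_def add_divide_distrib)
  qed
  have smAB: "smooth_on U0 (A f)" "smooth_on U0 (B f)" if "smooth_on U0 f" for f
  proof -
    have pf: "smooth_on U0 (partial i f)" "smooth_on U0 (partial i x)" "smooth_on U0 (partial i y)" for i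
      using that sm0 by (auto intro: smooth_on_partial)
    have n: "smooth_on U0 (\<lambda>u. partial 1 f u * partial 2 y u - partial 2 f u * partial 1 y u)"
      "smooth_on U0 (\<lambda>u. partial 1 x u * partial 2 f u - partial 2 x u * partial 1 f u)"
      by (intro smooth_on_diff smooth_on_mult U0(1) pf)+
    show "smooth_on U0 (A f)" "smooth_on U0 (B f)"
      unfolding A_def[abs_def] B_def[abs_def]
      by (rule smooth_on_divide[OF U0(1) n(1) smJ0 J] smooth_on_divide[OF U0(1) n(2) smJ0 J], assumption)+
  qed
  define a b where "a = A z" and "b = B z"
  have sab: "smooth_on U0 a" "smooth_on U0 b" unfolding a_def b_def by (intro smAB sm0)+
  have z1: "partial i z u = a u * partial i x u + b u * partial i y u" if "u \<in> U0" for i u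
    unfolding a_def b_def by (rule pAB[OF that])
  have z2: "partial i (partial j z) u = partial i a u * partial j x u + a u * partial i (partial j x) u
      + (partial i b u * partial j y u + b u * partial i (partial j y) u)" if u: "u \<in> U0" for i j u
  proof -
    note d = sab[THEN smooth_on_differentiable, OF u]
      sm0[THEN smooth_on_partial, THEN smooth_on_differentiable, OF u]
    show ?thesis
      using partial_cong[OF U0(1) u z1] by (simp add: partial_rules d)
  qed
  have symm: "B a u = A b u" if u: "u \<in> U0" for u
  proof -
    have "partial 2 (partial 1 z) u = partial 1 (partial 2 z) u" "partial 2 (partial 1 x) u = partial 1 (partial 2 x) u"
      "partial 2 (partial 1 y) u = partial 1 (partial 2 y) u"
      using partial_commute[OF U0(1) _ u] sm0 by auto
    then have "partial 1 x u * partial 2 a u - partial 2 x u * partial 1 a u = partial 1 b u * partial 2 y u - partial 2 b u * partial 1 y u"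
      unfolding z2[OF u] by (simp add: algebra_simps)
    then show ?thesis by (simp add: A_def B_def)
  qed
  have harm: "A a u + B b u = 0" if u: "u \<in> U0" for u
  proof -
    have uU: "u \<in> U" using u U0(3) by blast
    have pa: "partial i a u = A a u * partial i x u + A b u * partial i y u" for i
      unfolding symm[OF u, symmetric] by (rule pAB[OF u])
    note pb = pAB[OF u, of _ b]
    have E: "((partial 2 x u)\<^sup>2 + (partial 2 y u)\<^sup>2) * normal_acceleration x y z 1 1 u
        - 2 * (partial 1 x u * partial 2 x u + partial 1 y u * partial 2 y u) * normal_acceleration x y z 1 2 u
        + ((partial 1 x u)\<^sup>2 + (partial 1 y u)\<^sup>2) * normal_acceleration x y z 2 2 u = 0"
      using ch uU by (simp add: doubly_minimal_chart_def)
    show ?thesis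
      by (rule graph_algebra[OF z1[OF u] z1[OF u] z2[OF u, unfolded pa pb] z2[OF u, unfolded pa pb] z2[OF u, unfolded pa pb]
        normal_acceleration_def normal_acceleration_def normal_acceleration_def E J[OF u, unfolded J_def]])
  qed
  define \<zeta>0 where "\<zeta>0 = Complex (x u0) (y u0)"
  obtain r g where r: "r > 0" and gc: "continuous_on (ball \<zeta>0 r) g"
    and og: "open (g ` ball \<zeta>0 r)" and ug: "u0 \<in> g ` ball \<zeta>0 r"
    and g: "\<And>\<zeta>. \<zeta> \<in> ball \<zeta>0 r \<Longrightarrow> g \<zeta> \<in> U0 \<and> x (g \<zeta>) = Re \<zeta> \<and> y (g \<zeta>) = Im \<zeta>"
    and gd: "\<forall>\<zeta>\<in>ball \<zeta>0 r. \<forall>f p q. f differentiable (at (g \<zeta>)) \<longrightarrow>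
        (\<forall>i. partial i f (g \<zeta>) = p * partial i x (g \<zeta>) + q * partial i y (g \<zeta>)) \<longrightarrow>
        ((\<lambda>\<zeta>. f (g \<zeta>)) has_derivative (\<lambda>h. p * Re h + q * Im h)) (at \<zeta>)"
    by (rule plane_inverse[OF U0(1) sm0(1,2) U0(2) J0, folded \<zeta>0_def]) (rule that, assumption+)
  define D where "D = ball \<zeta>0 r"
  have D: "convex D" "open D" by (auto simp: D_def)
  define \<phi> where "\<phi> \<zeta> = complex_of_real (a (g \<zeta>)) - \<i> * complex_of_real (b (g \<zeta>))" for \<zeta>
  have gdAB: "((\<lambda>\<zeta>. f (g \<zeta>)) has_derivative (\<lambda>h. A f (g \<zeta>) * Re h + B f (g \<zeta>) * Im h)) (at \<zeta>)"
    if "\<zeta> \<in> D" "smooth_on U0 f" for f \<zeta>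
  proof -
    have "g \<zeta> \<in> U0" and \<zeta>: "\<zeta> \<in> ball \<zeta>0 r" using g that by (auto simp: D_def)
    then show ?thesis
      by (intro gd[rule_format, OF \<zeta>] smooth_on_differentiable[OF that(2)] pAB)
  qed
  have "(\<phi> has_field_derivative (complex_of_real (A a (g \<zeta>)) - \<i> * complex_of_real (A b (g \<zeta>)))) (at \<zeta>)" if \<zeta>: "\<zeta> \<in> D" for \<zeta>
  proof -
    have gU: "g \<zeta> \<in> U0" using g \<zeta> by (simp add: D_def)
    have d: "(\<phi> has_derivative (\<lambda>h. complex_of_real (A a (g \<zeta>) * Re h + B a (g \<zeta>) * Im h)
        - \<i> * complex_of_real (A b (g \<zeta>) * Re h + B b (g \<zeta>) * Im h))) (at \<zeta>)"
      unfolding \<phi>_def[abs_def]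
      by (intro has_derivative_diff has_derivative_mult_right has_derivative_of_real gdAB \<zeta> sab)
    have B: "B b (g \<zeta>) = - A a (g \<zeta>)" using harm[OF gU] by simp
    have "(\<lambda>h. complex_of_real (A a (g \<zeta>) * Re h + B a (g \<zeta>) * Im h)
        - \<i> * complex_of_real (A b (g \<zeta>) * Re h + B b (g \<zeta>) * Im h))
      = (*) (complex_of_real (A a (g \<zeta>)) - \<i> * complex_of_real (A b (g \<zeta>)))"
      by (simp add: fun_eq_iff complex_eq_iff symm[OF gU] B)
    then show ?thesis
      using d unfolding has_field_derivative_def by (simp only:)
  qed
  then have "\<phi> holomorphic_on D"
    using D(2) by (auto simp: holomorphic_on_open)
  then obtain H0 where H0: "\<And>\<zeta>. \<zeta> \<in> D \<Longrightarrow> (H0 has_field_derivative \<phi> \<zeta>) (at \<zeta> within D)"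
    using holomorphic_convex_primitive'[OF D] by blast
  have der0: "((\<lambda>\<zeta>. z (g \<zeta>) - Re (H0 \<zeta>)) has_derivative (\<lambda>h. 0)) (at \<zeta> within D)" if \<zeta>: "\<zeta> \<in> D" for \<zeta>
  proof -
    have 1: "((\<lambda>\<zeta>. z (g \<zeta>)) has_derivative (\<lambda>h. a (g \<zeta>) * Re h + b (g \<zeta>) * Im h)) (at \<zeta> within D)"
      using gdAB[OF \<zeta> sm0(3)] by (auto simp: a_def b_def intro: has_derivative_at_withinI)
    have 2: "((\<lambda>\<zeta>. Re (H0 \<zeta>)) has_derivative (\<lambda>h. Re (\<phi> \<zeta> * h))) (at \<zeta> within D)"
      using bounded_linear.has_derivative[OF bounded_linear_Re H0[OF \<zeta>, unfolded has_field_derivative_def]] .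
    show ?thesis
      using has_derivative_diff[OF 1 2] by (simp add: \<phi>_def)
  qed
  obtain c where c: "\<And>\<zeta>. \<zeta> \<in> D \<Longrightarrow> z (g \<zeta>) - Re (H0 \<zeta>) = c"
    using has_derivative_zero_constant[OF D(1) der0] by auto
  define H where "H \<zeta> = H0 \<zeta> + complex_of_real c" for \<zeta>
  have H: "H holomorphic_on D"
  proof -
    have "H0 holomorphic_on D"
      using H0 by (auto simp: holomorphic_on_def field_differentiable_def)
    then show ?thesis unfolding H_def[abs_def] by (intro holomorphic_intros)
  qed
  have P: "vector [x (g \<zeta>), y (g \<zeta>), z (g \<zeta>)] = (vector [Re \<zeta>, Im \<zeta>, Re (H \<zeta>)] :: real^3)" if "\<zeta> \<in> D" for \<zeta>
    using g c[OF that] that by (simp add: H_def D_def algebra_simps)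
  show ?thesis
  proof
    show "u0 \<in> g ` D" "g ` D \<subseteq> U" using ug g U0(3) by (auto simp: D_def)
    show "continuation_nbhd (\<lambda>u. vector [x u, y u, z u]) (g ` D)"
    proof (rule continuation_nbhdI)
      show "open (g ` D)" using og by (simp add: D_def)
      fix S W u
      assume S: "analytic_set S" and W: "open W" "W \<noteq> {}" "W \<subseteq> g ` D"
        and WS: "\<And>v. v \<in> W \<Longrightarrow> vector [x v, y v, z v] \<in> S" and u: "u \<in> g ` D"
      define Wc where "Wc = D \<inter> g -` W"
      have "open Wc" unfolding Wc_def using gc W(1) D by (auto simp: D_def intro: continuous_open_preimage)
      moreover have "Wc \<noteq> {}" "Wc \<subseteq> ball \<zeta>0 r" using W by (auto simp: Wc_def D_def)
      moreover have "vector [Re \<zeta>, Im \<zeta>, Re (H \<zeta>)] \<in> S" if "\<zeta> \<in> Wc" for \<zeta>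
        using WS[of "g \<zeta>"] P[of \<zeta>] that by (simp add: Wc_def)
      ultimately have "vector [Re \<zeta>, Im \<zeta>, Re (H \<zeta>)] \<in> S" if "\<zeta> \<in> D" for \<zeta>
        using harmonic_graph_continuation[OF S H[unfolded D_def]] that unfolding D_def by blast
      then show "vector [x u, y u, z u] \<in> S"
        using P u by (metis imageE)
    qed
  qed
qed

text \<open>At a vertical point the surface is \<open>y = x tan (rate * z)\<close> up to a motion, and this
  expression is analytic in \<open>x\<close> and in \<open>z\<close>.\<close>

lemma vertical_continuation:
  assumes ch: "doubly_minimal_chart U x y z" and u0: "u0 \<in> U"
    and J0: "partial 1 x u0 * partial 2 y u0 = partial 2 x u0 * partial 1 y u0"
  obtains V where "u0 \<in> V" "V \<subseteq> U" "continuation_nbhd (\<lambda>u. vector [x u, y u, z u]) V"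
proof -
  have U: "open U" and sm: "smooth_on U x" "smooth_on U y" "smooth_on U z"
    using ch by (auto simp: doubly_minimal_chart_def)
  note df = sm[THEN smooth_on_differentiable, OF u0]
  have nonchar: "contact_partial x y z 1 u0 \<noteq> 0 \<or> contact_partial x y z 2 u0 \<noteq> 0"
  proof (rule ccontr)
    assume "\<not> ?thesis"
    then have "2 * partial 1 z u0 = - (y u0 * partial 1 x u0 - x u0 * partial 1 y u0)"
      "2 * partial 2 z u0 = - (y u0 * partial 2 x u0 - x u0 * partial 2 y u0)"
      by (auto simp: contact_partial_def field_simps)
    then have "2 * (partial 1 y u0 * partial 2 z u0 - partial 1 z u0 * partial 2 y u0) = 0"
       "2 * (partial 1 z u0 * partial 2 x u0 - partial 1 x u0 * partial 2 z u0) = 0"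
      using J0 by algebra+
    moreover have "partial 1 x u0 * partial 2 y u0 - partial 1 y u0 * partial 2 x u0 = 0"
      using J0 by (simp add: mult.commute)
    ultimately show False
      using ch u0 unfolding doubly_minimal_chart_def by auto
  qed
  obtain c s a b d e X Y Z where cs: "c\<^sup>2 + s\<^sup>2 = 1" and e: "e > 0" "ball u0 e \<subseteq> U" and
    XYZ: "X = (\<lambda>u. c * x u - s * y u + a)" "Y = (\<lambda>u. s * x u + c * y u + b)"
      "Z = (\<lambda>u. z u + (a * (s * x u + c * y u) - b * (c * x u - s * y u)) / 2 + d)"
    and rc: "ruled_chart (ball u0 e) X Y Z" and zero: "X u0 = 0" "Y u0 = 0" "Z u0 = 0" "foliated_chart.slope X Y Z u0 = 0"
    by (rule ruled_chart_after_motion[OF ch u0 nonchar]) (rule that, assumption+)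
  interpret ruled_chart "ball u0 e" X Y Z by (rule rc)
  have u0e: "u0 \<in> ball u0 e" using e by simp
  have "partial 1 X u0 * partial 2 Y u0 = partial 2 X u0 * partial 1 Y u0"
  proof -
    have X1: "partial i X u0 = c * partial i x u0 - s * partial i y u0" for i
      using partial_affine[OF df, of i c "-s" 0 a] by (simp add: XYZ)
    have Y1: "partial i Y u0 = s * partial i x u0 + c * partial i y u0" for i
      using partial_affine[OF df, of i s c 0 b] by (simp add: XYZ)
    show ?thesis unfolding X1 Y1 using J0 by algebra
  qed
  then obtain rate where y: "\<And>u. u \<in> ball u0 e \<Longrightarrow> Y u = X u * tan (rate * Z u)"
    and bd: "\<And>u. u \<in> ball u0 e \<Longrightarrow> \<bar>rate * Z u\<bar> < pi / 2"
    and jac: "\<And>u. u \<in> ball u0 e \<Longrightarrow> partial 1 X u * partial 2 Z u - partial 2 X u * partial 1 Z u \<noteq> 0"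
    using vertical_point_normal_form[OF convex_ball u0e zero] by blast
  define \<phi> where "\<phi> = heis_motion c s a b d"
  have \<phi>: "is_heis_motion \<phi>" unfolding \<phi>_def by (rule is_heis_motionI[OF cs])
  have \<phi>P: "\<phi> (vector [x u, y u, z u]) = vector [X u, Y u, Z u]" for u
    by (simp add: \<phi>_def heis_motion_def XYZ)
  obtain \<psi> where \<psi>: "is_heis_motion \<psi>" "\<And>p. \<psi> (\<phi> p) = p"
    using is_heis_motion_inverse[OF \<phi>] by metis
  show ?thesis
  proof
    show "u0 \<in> ball u0 e" "ball u0 e \<subseteq> U" by fact+
    show "continuation_nbhd (\<lambda>u. vector [x u, y u, z u]) (ball u0 e)"
    proof (rule continuation_nbhdI)
      fix S W u
      assume S: "analytic_set S" and W: "open W" "W \<noteq> {}" "W \<subseteq> ball u0 e"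
        and WS: "\<And>v. v \<in> W \<Longrightarrow> vector [x v, y v, z v] \<in> S" and u: "u \<in> ball u0 e"
      obtain F where F: "{p. \<psi> p \<in> S} = {p. F p = 0}" and
        FI: "\<And>I g1 g2 g3. real_analytic_on I g1 \<Longrightarrow> real_analytic_on I g2 \<Longrightarrow> real_analytic_on I g3 \<Longrightarrow>
          real_analytic_on I (\<lambda>t. F (vector [g1 t, g2 t, g3 t]))"
        using analytic_set_motion[OF S \<psi>(1)] unfolding analytic_set_def by blast
      have FS: "F (vector [X v, Y v, Z v]) = 0 \<longleftrightarrow> vector [x v, y v, z v] \<in> S" for v
      proof -
        have "F (vector [X v, Y v, Z v]) = 0 \<longleftrightarrow> \<psi> (vector [X v, Y v, Z v]) \<in> S" using F by blast
        then show ?thesis unfolding \<phi>P[symmetric] \<psi>(2) .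
      qed
      obtain v where v: "v \<in> W" using W by blast
      have vB: "v \<in> ball u0 e" using v W by blast
      have "smooth_on W X" "smooth_on W Z" using smooth_xyz W(3) smooth_on_subset by blast+
      then obtain r g where r: "r > 0" and
        g: "\<And>\<zeta>. \<zeta> \<in> ball (Complex (X v) (Z v)) r \<Longrightarrow> g \<zeta> \<in> W \<and> X (g \<zeta>) = Re \<zeta> \<and> Z (g \<zeta>) = Im \<zeta>"
        by (rule plane_inverse[OF W(1) _ _ v jac[OF vB]]) (rule that, assumption+)
      define J where "J m = {m - r / 2 <..< m + r / 2}" for m
      have J: "open (J m)" "J m \<noteq> {}" for m using r by (auto simp: J_def)
      have near: "F (vector [\<sigma>, \<sigma> * tan (rate * \<tau>), \<tau>]) = 0" "\<bar>rate * \<tau>\<bar> < pi / 2"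
        if "\<sigma> \<in> J (X v)" "\<tau> \<in> J (Z v)" for \<sigma> \<tau>
      proof -
        have close: "\<bar>\<sigma> - X v\<bar> < r / 2" "\<bar>\<tau> - Z v\<bar> < r / 2"
          using that unfolding J_def greaterThanLessThan_iff by linarith+
        have "cmod (Complex \<sigma> \<tau> - Complex (X v) (Z v)) \<le> \<bar>\<sigma> - X v\<bar> + \<bar>\<tau> - Z v\<bar>"
          using cmod_le[of "Complex \<sigma> \<tau> - Complex (X v) (Z v)"] by simp
        also have "\<dots> < r" using close by simp
        finally have "Complex \<sigma> \<tau> \<in> ball (Complex (X v) (Z v)) r"
          by (simp add: dist_norm norm_minus_commute)
        note g' = g[OF this]
        define q where "q = g (Complex \<sigma> \<tau>)"
        have q: "q \<in> W" "X q = \<sigma>" "Z q = \<tau>" using g' by (simp_all add: q_def)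
        have qB: "q \<in> ball u0 e" using q(1) W(3) by blast
        show "\<bar>rate * \<tau>\<bar> < pi / 2" using bd[OF qB] by (simp add: q)
        show "F (vector [\<sigma>, \<sigma> * tan (rate * \<tau>), \<tau>]) = 0"
          using FS[of q] WS[OF q(1)] y[OF qB] by (simp add: q)
      qed
      \<comment> \<open>continuation first in \<open>x\<close> at fixed \<open>z\<close>, then in \<open>z\<close> at fixed \<open>x\<close>\<close>
      have strip: "F (vector [\<sigma>, \<sigma> * tan (rate * \<tau>), \<tau>]) = 0" if \<tau>: "\<tau> \<in> J (Z v)" for \<sigma> \<tau>
      proof -
        have "real_analytic_on UNIV (\<lambda>\<sigma>. F (vector [\<sigma>, \<sigma> * tan (rate * \<tau>), \<tau>]))"
          by (intro FI real_analytic_on_mult real_analytic_on_id real_analytic_on_const)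
        from real_analytic_on_vanish[OF this J[of "X v"] subset_UNIV] near(1) \<tau>
        show ?thesis by auto
      qed
      define I where "I = {\<tau>. \<bar>rate * \<tau>\<bar> < pi / 2}"
      have "real_analytic_on I (\<lambda>\<tau>. F (vector [X u, X u * tan (rate * \<tau>), \<tau>]))"
        by (intro FI real_analytic_on_mult real_analytic_on_id real_analytic_on_const real_analytic_on_tan)
          (simp add: I_def)
      moreover have "J (Z v) \<subseteq> I" using near(2) J(2)[of "X v"] unfolding I_def by blast
      moreover have "Z u \<in> I" using bd[OF u] by (simp add: I_def)
      ultimately have "F (vector [X u, X u * tan (rate * Z u), Z u]) = 0"
        using real_analytic_on_vanish[OF _ J[of "Z v"]] strip by blast
      then show "vector [x u, y u, z u] \<in> S"
        using FS[of u] y[OF u] by simp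
    qed simp
  qed
qed

lemma local_continuation:
  assumes ch: "doubly_minimal_chart U x y z" and u0: "u0 \<in> U"
  obtains V where "u0 \<in> V" "V \<subseteq> U" "continuation_nbhd (\<lambda>u. vector [x u, y u, z u]) V"
proof (cases "partial 1 x u0 * partial 2 y u0 - partial 2 x u0 * partial 1 y u0 = 0")
  case True
  then show ?thesis using vertical_continuation[OF ch u0] that by auto
next
  case False
  then show ?thesis using graph_continuation[OF ch u0] that by blast
qed

text \<open>If the contact form vanished on the surface, so would its exterior derivative \<open>- dx dy\<close>. But the contact
  planes project isomorphically to the \<open>(x, y)\<close>-plane, so that \<open>dx dy\<close> is nonzero on them.\<close>

lemma noncharacteristic_point:
  assumes ch: "doubly_minimal_chart U x y z" and "U \<noteq> {}"
  obtains u where "u \<in> U" "contact_partial x y z 1 u \<noteq> 0 \<or> contact_partial x y z 2 u \<noteq> 0"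
proof (rule ccontr)
  assume "\<not> thesis"
  then have w: "contact_partial x y z 1 u = 0" "contact_partial x y z 2 u = 0" if "u \<in> U" for u
    using that \<open>\<And>u. u \<in> U \<Longrightarrow> _ \<Longrightarrow> thesis\<close> by blast+
  have U: "open U" and sm: "smooth_on U x" "smooth_on U y" "smooth_on U z"
    using ch by (auto simp: doubly_minimal_chart_def)
  obtain u where u: "u \<in> U" using assms(2) by blast
  have "partial 1 (contact_partial x y z 2) u = 0" "partial 2 (contact_partial x y z 1) u = 0"
    using partial_cong[OF U u, of "contact_partial x y z 2" "\<lambda>u. 0"]
      partial_cong[OF U u, of "contact_partial x y z 1" "\<lambda>u. 0"] w by auto
  moreover have "partial 2 (partial 1 z) u = partial 1 (partial 2 z) u" "partial 2 (partial 1 x) u = partial 1 (partial 2 x) u"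
      "partial 2 (partial 1 y) u = partial 1 (partial 2 y) u"
    using partial_commute[OF U _ u] sm by auto
  ultimately have J: "partial 1 x u * partial 2 y u - partial 1 y u * partial 2 x u = 0"
    unfolding partial_contact_partial[OF U sm u] by (simp add: field_simps)
  have "2 * partial 1 z u = - (y u * partial 1 x u - x u * partial 1 y u)"
      "2 * partial 2 z u = - (y u * partial 2 x u - x u * partial 2 y u)"
    using w[OF u] by (auto simp: contact_partial_def field_simps)
  then have "2 * (partial 1 y u * partial 2 z u - partial 1 z u * partial 2 y u) = 0"
       "2 * (partial 1 z u * partial 2 x u - partial 1 x u * partial 2 z u) = 0"
    using J by algebra+
  then show False
    using ch u J unfolding doubly_minimal_chart_def by auto
qed

section \<open>The classification\<close>

lemma chart_local_classification:
  assumes ch: "doubly_minimal_chart U x y z" and "U \<noteq> {}"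
  obtains V \<phi> S where "open V" "V \<noteq> {}" "V \<subseteq> U" "is_heis_motion \<phi>" "minimal_model S"
    "\<And>u. u \<in> V \<Longrightarrow> \<phi> (vector [x u, y u, z u]) \<in> S"
proof -
  obtain u0 where u0: "u0 \<in> U" "contact_partial x y z 1 u0 \<noteq> 0 \<or> contact_partial x y z 2 u0 \<noteq> 0"
    using noncharacteristic_point[OF assms] by blast
  obtain c s a b d e X Y Z where cs: "c\<^sup>2 + s\<^sup>2 = 1" and e: "e > 0" "ball u0 e \<subseteq> U" and
    XYZ: "X = (\<lambda>u. c * x u - s * y u + a)" "Y = (\<lambda>u. s * x u + c * y u + b)"
      "Z = (\<lambda>u. z u + (a * (s * x u + c * y u) - b * (c * x u - s * y u)) / 2 + d)"
    and rc: "ruled_chart (ball u0 e) X Y Z" and zero: "X u0 = 0" "Y u0 = 0" "Z u0 = 0" "foliated_chart.slope X Y Z u0 = 0"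
    by (rule ruled_chart_after_motion[OF ch u0]) (rule that, assumption+)
  interpret ruled_chart "ball u0 e" X Y Z by (rule rc)
  have u0e: "u0 \<in> ball u0 e" using e by simp
  obtain V \<phi> S where V: "open V" "V \<noteq> {}" "V \<subseteq> ball u0 e" and \<phi>: "is_heis_motion \<phi>" and S: "minimal_model S"
    and VS: "\<And>u. u \<in> V \<Longrightarrow> \<phi> (vector [X u, Y u, Z u]) \<in> S"
    using local_classification[OF convex_ball u0e zero] by blast
  define \<psi> where "\<psi> = heis_motion c s a b d"
  have "is_heis_motion \<psi>" unfolding \<psi>_def by (rule is_heis_motionI[OF cs])
  then have m: "is_heis_motion (\<lambda>p. \<phi> (\<psi> p))" by (rule is_heis_motion_compose[OF \<phi>])
  have "\<psi> (vector [x u, y u, z u]) = vector [X u, Y u, Z u]" for u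
    by (simp add: \<psi>_def heis_motion_def XYZ)
  then have "\<phi> (\<psi> (vector [x u, y u, z u])) \<in> S" if "u \<in> V" for u
    using VS[OF that] by simp
  then show ?thesis
    using that[OF V(1,2) _ m S] V(3) e(2) by blast
qed

lemma surface_chart_doubly_minimal:
  assumes surf: "connected_immersed_surface M A f"
    and zr: "zero_mean_curvature heis_riem A f" and zl: "zero_mean_curvature heis_lor A f"
    and UX: "(U, X) \<in> A"
  shows "doubly_minimal_chart U (\<lambda>u. f (X u) $ 1) (\<lambda>u. f (X u) $ 2) (\<lambda>u. f (X u) $ 3)"
proof -
  have "open U" using surf UX unfolding connected_immersed_surface_def smooth_surface_def by fast
  moreover have "smooth_on U (f \<circ> X)" "\<And>u. u \<in> U \<Longrightarrow> inj (frechet_derivative (f \<circ> X) (at u))"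
    using surf UX unfolding connected_immersed_surface_def smooth_immersion_def by fast+
  moreover have z: "zero_mean_curvature (heis_metric e) A f" if "e = 1 \<or> e = -1" for e
    using that zr zl by (auto simp: heis_riem_eq heis_lor_eq)
  ultimately have "doubly_minimal_chart U (\<lambda>u. (f \<circ> X) u $ 1) (\<lambda>u. (f \<circ> X) u $ 2) (\<lambda>u. (f \<circ> X) u $ 3)"
  proof (intro doubly_minimal_chartI)
    show "\<not> lightlike_point (heis_metric e) (f \<circ> X) u" if "e = 1 \<or> e = -1" "u \<in> U" for e u
      using z[OF that(1)] UX that(2) unfolding zero_mean_curvature_def by fast
    show "mean_curvature (heis_metric e) (f \<circ> X) u N = 0"
      if "e = 1 \<or> e = -1" "u \<in> U" "unit_normal (heis_metric e) (f \<circ> X) u N" for e u N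
      using z[OF that(1)] UX that(2,3) unfolding zero_mean_curvature_def by fast
  qed
  then show ?thesis by (simp add: o_def)
qed

lemma vector_components_3: "vector [p $ 1, p $ 2, p $ 3] = (p :: real^3)"
  by (simp add: vec_eq_iff forall_3)

lemma openin_chart_image:
  assumes "open U" "openin M (X ` U)" "homeomorphic_map (top_of_set U) (subtopology M (X ` U)) X"
    and "open V" "V \<subseteq> U"
  shows "openin M (X ` V)"
proof -
  have "openin (top_of_set U) V" using assms by (simp add: open_openin_trans)
  then have "openin (subtopology M (X ` U)) (X ` V)"
    using homeomorphic_imp_open_map[OF assms(3)] by (simp add: open_map_def)
  then show ?thesis using openin_trans_full assms(2) by blast
qed

lemma open_chart_preimage:
  assumes "open U" "homeomorphic_map (top_of_set U) (subtopology M (X ` U)) X" "openin M N"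
  shows "open {u \<in> U. X u \<in> N}"
proof -
  have "openin (subtopology M (X ` U)) (N \<inter> X ` U)"
    using assms(3) by (auto simp: openin_subtopology)
  then have "openin (top_of_set U) {u \<in> topspace (top_of_set U). X u \<in> N \<inter> X ` U}"
    by (rule openin_continuous_map_preimage[OF homeomorphic_imp_continuous_map[OF assms(2)]])
  moreover have "{u \<in> topspace (top_of_set U). X u \<in> N \<inter> X ` U} = {u \<in> U. X u \<in> N}" by auto
  ultimately show ?thesis using assms(1) openin_open_trans by auto
qed

theorem theorem3p2:
  fixes M :: "'a topology" and A :: "'a atlas" and f :: "'a \<Rightarrow> real^3"
  assumes "connected_immersed_surface M A f"
    and "zero_mean_curvature heis_riem A f"
    and "zero_mean_curvature heis_lor A f"
  shows "\<exists>\<phi>. riem_isometry heis_riem \<phi> \<and>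
    (\<phi> ` f ` topspace M \<subseteq> horizontal_plane \<or>
     \<phi> ` f ` topspace M \<subseteq> vertical_plane \<or>
     (\<exists>c. c \<noteq> 0 \<and> \<phi> ` f ` topspace M \<subseteq> helicoid c) \<or>
     \<phi> ` f ` topspace M \<subseteq> hyperbolic_paraboloid)"
proof (cases "topspace M = {}")
  case True
  then show ?thesis using is_heis_motion_isometry[OF is_heis_motion_id] by auto
next
  case False
  have conn: "connected_space M" and cover: "(\<Union>(U, X)\<in>A. X ` U) = topspace M"
    using assms(1) unfolding connected_immersed_surface_def smooth_surface_def by auto
  have atlas: "open U" "openin M (X ` U)" "homeomorphic_map (top_of_set U) (subtopology M (X ` U)) X"
    if "(U, X) \<in> A" for U X
    using assms(1) that unfolding connected_immersed_surface_def smooth_surface_def by fast+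
  note chart = surface_chart_doubly_minimal[OF assms]
  obtain p0 where "p0 \<in> topspace M" using False by blast
  then obtain U0 X0 u0 where U0: "(U0, X0) \<in> A" "u0 \<in> U0" "p0 = X0 u0" using cover by blast
  obtain V \<phi> S where V: "open V" "V \<noteq> {}" "V \<subseteq> U0" and \<phi>: "is_heis_motion \<phi>" and S: "minimal_model S"
    and VS: "\<And>u. u \<in> V \<Longrightarrow> \<phi> (vector [f (X0 u) $ 1, f (X0 u) $ 2, f (X0 u) $ 3]) \<in> S"
    using chart_local_classification[OF chart[OF U0(1)]] U0(2) by blast
  define T where "T = {p. \<phi> p \<in> S}"
  have T: "analytic_set T"
    unfolding T_def by (rule analytic_set_motion[OF minimal_model_analytic[OF S] \<phi>])
  \<comment> \<open>the points near which the surface lies in the model; this set is open by definition and closed by unique continuation\<close>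
  define \<Omega> where "\<Omega> = \<Union>{N. openin M N \<and> f ` N \<subseteq> T}"
  have \<Omega>: "openin M \<Omega>" "f ` \<Omega> \<subseteq> T" unfolding \<Omega>_def by auto
  have "openin M (X0 ` V)" using openin_chart_image[OF atlas[OF U0(1)] V(1,3)] .
  moreover have "f ` X0 ` V \<subseteq> T" using VS by (auto simp: T_def vector_components_3)
  ultimately have ne: "\<Omega> \<noteq> {}" using V(2) unfolding \<Omega>_def by blast
  have nbhd: "\<exists>N. openin M N \<and> p \<in> N \<and> (N \<inter> \<Omega> \<noteq> {} \<longrightarrow> N \<subseteq> \<Omega>)" if p: "p \<in> topspace M" for p
  proof -
    obtain U X u where U: "(U, X) \<in> A" "u \<in> U" "p = X u" using p cover by blast
    obtain W where W: "u \<in> W" "W \<subseteq> U" and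
      "continuation_nbhd (\<lambda>u. vector [f (X u) $ 1, f (X u) $ 2, f (X u) $ 3]) W"
      using local_continuation[OF chart[OF U(1)] U(2)] by blast
    then have cn: "continuation_nbhd (\<lambda>u. f (X u)) W" by (simp add: vector_components_3)
    then have oW: "open W" by (simp add: continuation_nbhd_def)
    have oN: "openin M (X ` W)" using openin_chart_image[OF atlas[OF U(1)] oW W(2)] .
    have "X ` W \<subseteq> \<Omega>" if "X ` W \<inter> \<Omega> \<noteq> {}"
    proof -
      define W' where "W' = W \<inter> {u \<in> U. X u \<in> \<Omega>}"
      have "open W'"
        unfolding W'_def using oW open_chart_preimage[OF atlas(1,3)[OF U(1)] \<Omega>(1)] by blast
      moreover have "W' \<noteq> {}" "W' \<subseteq> W" using that W(2) by (auto simp: W'_def)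
      moreover have "\<forall>u\<in>W'. f (X u) \<in> T" using \<Omega>(2) by (auto simp: W'_def)
      ultimately have "\<forall>u\<in>W. f (X u) \<in> T" using cn T unfolding continuation_nbhd_def by blast
      then show ?thesis using oN unfolding \<Omega>_def by blast
    qed
    then show ?thesis using oN W(1) U(3) by blast
  qed
  have "openin M (topspace M - \<Omega>)"
  proof (subst openin_subopen, intro ballI)
    fix p assume p: "p \<in> topspace M - \<Omega>"
    then obtain N where N: "openin M N" "p \<in> N" "N \<inter> \<Omega> \<noteq> {} \<longrightarrow> N \<subseteq> \<Omega>" using nbhd by blast
    then have "N \<subseteq> topspace M - \<Omega>" using p openin_subset[OF N(1)] by blast
    then show "\<exists>N. openin M N \<and> p \<in> N \<and> N \<subseteq> topspace M - \<Omega>" using N by blast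
  qed
  then have "topspace M - \<Omega> = {}"
    using conn \<Omega>(1) ne openin_subset[OF \<Omega>(1)] unfolding connected_space_def by blast
  then have "\<phi> ` f ` topspace M \<subseteq> S" using \<Omega>(2) by (auto simp: T_def)
  then show ?thesis
    using S is_heis_motion_isometry[OF \<phi>] unfolding minimal_model_def by blast
qed

end
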